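(* Let $c$ be a finite positive constant and let $N_S,N_T\to\infty$ with $N_S/N_T=c$. Then the ergodic linear minimum mean square error $$J_{\mathrm{ELMMSE}}=\mathbb E_{\mathbf S}\left[\operatorname{tr}\left(\mathbf R\left(\mathbf I+\sigma_s^{-2}\left(\mathbf R_R\otimes\mathbf R_T^{1/2}\mathbf F\mathbf S\mathbf S^{\mathrm H}\mathbf F^{\mathrm H}\mathbf R_T^{1/2}\right)\right)^{-1}\right)\right]$$ satisfies $$J_{\mathrm{ELMMSE}}=\sum_{j=1}^K\bar\varkappa_j(\mathbf\Phi)+\mathcal O\left(\frac1{N_S}\right),\qquad \bar\varkappa_j(\mathbf\Phi)=\sigma_s^2\lambda_{R,j}\operatorname{tr}\left(\mathbf R_T\mathbf M_{T,j}\right),$$ where $$\mathbf M_{T,j}=\left(\mathbf I_{N_T}+\frac{\lambda_{R,j}}{1+\lambda_{R,j}\delta(\lambda_{R,j})}\mathbf T(\mathbf\Phi)\right)^{-1},$$ $\mathbf\Phi=\mathbf F\mathbf F^{\mathrm H}$, $\mathbf T(\mathbf\Phi)=\mathbf R_T^{1/2}\mathbf\Phi\mathbf R_T^{1/2}$, $\{\lambda_{R,j}\}_{j=1}^K$ are the eigenvalues of $\sigma_s^{-2}\mathbf R_R$, and, for each $\rho$, $\delta(\rho)$ is the (nonnegative) solution of $$\delta(\rho)=\frac1{N_S}\operatorname{tr}\left(\mathbf T(\mathbf\Phi)\left(\mathbf I_{N_T}+\frac{\rho}{1+\rho\,\delta(\rho)}\mathbf T(\mathbf\Phi)\right)^{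-1}\right).$$
   Context: Sensing model: $\mathbf Y_s=\mathbf H_s\mathbf X+\mathbf N_s\in\mathbb C^{N_R\times N_S}$ with transmitted signal $\mathbf X=\mathbf F\mathbf S$, where $\mathbf F\in\mathbb C^{N_T\times N_T}$ is a deterministic precoding matrix and $\mathbf S\in\mathbb C^{N_T\times N_S}$ is random with i.i.d. circularly symmetric complex Gaussian entries of mean zero and variance $1/N_S$ (so $\mathbb E(\mathbf S\mathbf S^{\mathrm H})=\mathbf I$), and $N_S\ge N_T$. The noise has i.i.d. $\mathcal{CN}(0,\sigma_s^2)$ entries, $\sigma_s^2>0$. The vector $\mathbf h_s=\mathrm{vec}(\mathbf H_s^{\mathrm H})\sim\mathcal{CN}(\mathbf 0,\mathbf R)$ is independent of $\mathbf S$ and of the noise, with $\mathbf R=\mathbf R_R\otimes\mathbf R_T$, where $\mathbf R_R\in\mathbb C^{N_R\times N_R}$ and $\mathbf R_T\in\mathbb C^{N_T\times N_T}$ are Hermitian positive semidefinite with $\mathrm{rank}(\mathbf R_R)\le K$ and $\mathrm{rank}(\mathbf R_T)\le K$; $K$ is the number of sensing targets. $J_{\mathrm{ELMMSE}}$ is the mean, over the random signal $\mathbf S$, of the mean square error of the linear MMSE estimator of $\mathbf h_s$ from $\mathbf y_s=\mathrm{vec}(\mathbf Y_s^{\mathrm H})$ with $\mathbf S$ known. Notation: $\otimes$ is the Kronecker product, $(\cdot)^{1/2}$ the Hermitian positive semidefinite square root. The list $\{\lambda_{R,j}\}_{j=1}^K$ consists of the $K$ largest eigenvalues of $\sigma_s^{-2}\mathbf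 R_R$ with multiplicity (padded with zeros if needed); it contains all nonzero eigenvalues. In the asymptotic regime only $N_S$ and $N_T$ (and with them $\mathbf F$, $\mathbf R_T$) vary; $K$, $N_R$, $\mathbf R_R$, $\sigma_s^2$ are held fixed.
   Formalization: The added assumption tr(R_T) = O(N_T) is needed: with K = N_R = c = σ_s = 1, R_R = 1, R_T = N_T² e₁e₁^H and F = I/N_T, the error tends to −1/32 rather than being O(1/N_S). *)

theory Defs
  imports
    "HOL-Probability.Probability"
    "HOL-Library.Landau_Symbols"
    "Jordan_Normal_Form.Schur_Decomposition"
    "Jordan_Normal_Form.Gauss_Jordan_Elimination"
    "Jordan_Normal_Form.DL_Rank"
begin

no_notation Finite_Cartesian_Product.vec_nth (infixl \<open>$\<close> 90)
hide_const (open) Finite_Cartesian_Product.vec Finite_Cartesian_Product.mat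
  Determinants.trace Finite_Cartesian_Product.vec_nth

section \<open>Matrices\<close>

definition mtrace :: "complex mat \<Rightarrow> complex" where
  "mtrace A = (\<Sum>i<dim_row A. A $$ (i, i))"

definition kronecker :: "complex mat \<Rightarrow> complex mat \<Rightarrow> complex mat" (infixr \<open>\<otimes>\<^sub>K\<close> 72) where
  "A \<otimes>\<^sub>K B = Matrix.mat (dim_row A * dim_row B) (dim_col A * dim_col B)
     (\<lambda>(i, j). A $$ (i div dim_row B, j div dim_col B) * B $$ (i mod dim_row B, j mod dim_col B))"

text \<open>Column stacking.\<close>

definition vectorize :: "complex mat \<Rightarrow> complex vec" where
  "vectorize A = Matrix.vec (dim_row A * dim_col A)
     (\<lambda>k. A $$ (k mod dim_row A, k div dim_row A))"

text \<open>The value is unspecified on singular matrices.\<close>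

definition minv :: "complex mat \<Rightarrow> complex mat" where
  "minv A = the (mat_inverse A)"

text \<open>Here \<open>(A *\<^sub>v v) \<bullet>c v\<close> is the Hermitian form $v^{\mathrm H} A v$.\<close>

definition psd :: "nat \<Rightarrow> complex mat \<Rightarrow> bool" where
  "psd n A \<longleftrightarrow> A \<in> carrier_mat n n \<and> mat_adjoint A = A \<and>
     (\<forall>v \<in> carrier_vec n. 0 \<le> Re ((A *\<^sub>v v) \<bullet>c v))"

definition psd_sqrt :: "complex mat \<Rightarrow> complex mat" where
  "psd_sqrt A = (THE B. psd (dim_row A) B \<and> B * B = A)"

abbreviation mrank :: "complex mat \<Rightarrow> nat" where
  "mrank A \<equiv> vec_space.rank (dim_row A) A"

text \<open>
  The \<open>K\<close> largest eigenvalues, with multiplicity and in decreasing order, padded with zeros if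
  there are fewer than \<open>K\<close>. It is meant for positive semidefinite matrices, whose eigenvalues are
  real and nonnegative (so that \<open>Re\<close> loses nothing and the padding respects the order).
\<close>

definition largest_eigenvalues :: "nat \<Rightarrow> complex mat \<Rightarrow> real list" where
  "largest_eigenvalues K A =
     take K (rev (sorted_list_of_multiset (image_mset Re (proots (char_poly A)))) @ replicate K 0)"

section \<open>Complex Gaussian random variables, vectors and matrices\<close>

text \<open>
  The circularly symmetric law $\mathcal{CN}(0, v)$ of variance $v = \mathbb E|X|^2$; it is the
  point mass at 0 for $v = 0$.
\<close>

definition cgauss :: "real \<Rightarrow> complex measure" where
  "cgauss v = (if v = 0 then return borel 0
     else density lborel (\<lambda>z. ennreal (exp (- (cmod z)\<^sup>2 / v) / (pi * v))))"

text \<open>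
  $\mathcal{CN}(0, R)$ for a possibly singular covariance matrix $R$: every linear functional
  $a^{\mathrm H} h$ is $\mathcal{CN}(0, a^{\mathrm H} R a)$.
\<close>

definition cgauss_vec :: "'a measure \<Rightarrow> nat \<Rightarrow> complex mat \<Rightarrow> ('a \<Rightarrow> complex vec) \<Rightarrow> bool" where
  "cgauss_vec M d R h \<longleftrightarrow>
     (\<forall>\<omega> \<in> space M. h \<omega> \<in> carrier_vec d) \<and>
     (\<forall>a \<in> carrier_vec d.
        (\<lambda>\<omega>. h \<omega> \<bullet>c a) \<in> borel_measurable M \<and>
        distr M borel (\<lambda>\<omega>. h \<omega> \<bullet>c a) = cgauss (Re ((R *\<^sub>v a) \<bullet>c a)))"

text \<open>The sigma-algebra on the \<open>r\<close> by \<open>c\<close> matrices that is generated by the entries.\<close>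

definition mat_space :: "nat \<Rightarrow> nat \<Rightarrow> complex mat measure" where
  "mat_space r c = vimage_algebra (carrier_mat r c)
     (\<lambda>A. \<lambda>p \<in> {..<r} \<times> {..<c}. A $$ p) (Pi\<^sub>M ({..<r} \<times> {..<c}) (\<lambda>_. borel))"

definition iid_cgauss_mat ::
    "'a measure \<Rightarrow> nat \<Rightarrow> nat \<Rightarrow> real \<Rightarrow> ('a \<Rightarrow> complex mat) \<Rightarrow> bool" where
  "iid_cgauss_mat M r c v X \<longleftrightarrow>
     X \<in> measurable M (mat_space r c) \<and>
     prob_space.indep_vars M (\<lambda>_. borel) (\<lambda>p \<omega>. X \<omega> $$ p) ({..<r} \<times> {..<c}) \<and>
     (\<forall>p \<in> {..<r} \<times> {..<c}. distr M borel (\<lambda>\<omega>. X \<omega> $$ p) = cgauss v)"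

text \<open>Joint (not merely pairwise) independence of three random matrices of the given formats.\<close>

definition indep_mats3 ::
    "'a measure \<Rightarrow> nat \<times> nat \<Rightarrow> ('a \<Rightarrow> complex mat) \<Rightarrow> nat \<times> nat \<Rightarrow> ('a \<Rightarrow> complex mat) \<Rightarrow>
     nat \<times> nat \<Rightarrow> ('a \<Rightarrow> complex mat) \<Rightarrow> bool" where
  "indep_mats3 M d\<^sub>1 X\<^sub>1 d\<^sub>2 X\<^sub>2 d\<^sub>3 X\<^sub>3 \<longleftrightarrow>
     prob_space.indep_vars M (\<lambda>i. case_prod mat_space ([d\<^sub>1, d\<^sub>2, d\<^sub>3] ! i))
       (\<lambda>i. [X\<^sub>1, X\<^sub>2, X\<^sub>3] ! i) {..<3::nat}"

section \<open>The ergodic linear MMSE\<close>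

text \<open>
  The least mean square error of a linear estimate \<open>W *\<^sub>v y\<close> of the \<open>d\<close>-dimensional
  \<open>h\<close> from the \<open>m\<close>-dimensional \<open>y\<close>. All variables to which it is applied have mean zero, hence an
  affine term would not lower the error.
\<close>

definition lmmse ::
    "'a measure \<Rightarrow> nat \<Rightarrow> nat \<Rightarrow> ('a \<Rightarrow> complex vec) \<Rightarrow> ('a \<Rightarrow> complex vec) \<Rightarrow> real" where
  "lmmse M d m h y = (INF W \<in> carrier_mat d m.
     (LINT \<omega>|M. (\<Sum>i<d. (cmod ((h \<omega> - W *\<^sub>v y \<omega>) $ i))\<^sup>2)))"

text \<open>
  The inner error is taken at a fixed value \<open>s\<close> of the known signal, with the expectation running
  over channel and noise only; as these are independent of the signal, this is the error
  conditional on \<open>S = s\<close>. The outer expectation runs over the signal.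
\<close>

definition J_ELMMSE ::
    "'a measure \<Rightarrow> nat \<Rightarrow> nat \<Rightarrow> nat \<Rightarrow> complex mat \<Rightarrow> ('a \<Rightarrow> complex mat) \<Rightarrow>
     ('a \<Rightarrow> complex mat) \<Rightarrow> ('a \<Rightarrow> complex mat) \<Rightarrow> real" where
  "J_ELMMSE M N\<^sub>R N\<^sub>T N\<^sub>S F S H N =
     (LINT \<omega>\<^sub>S|M. (let s = S \<omega>\<^sub>S in
        lmmse M (N\<^sub>R * N\<^sub>T) (N\<^sub>R * N\<^sub>S)
          (\<lambda>\<omega>. vectorize (mat_adjoint (H \<omega>)))
          (\<lambda>\<omega>. vectorize (mat_adjoint (H \<omega> * (F * s) + N \<omega>)))))"

section \<open>The deterministic equivalent\<close>

definition T_mat :: "complex mat \<Rightarrow> complex mat \<Rightarrow> complex mat" where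
  "T_mat R\<^sub>T \<Phi> = psd_sqrt R\<^sub>T * \<Phi> * psd_sqrt R\<^sub>T"

definition delta :: "nat \<Rightarrow> complex mat \<Rightarrow> real \<Rightarrow> real" where
  "delta N\<^sub>S T \<rho> = (THE d. 0 \<le> d \<and>
     complex_of_real d = 1 / of_nat N\<^sub>S *
       mtrace (T * minv (1\<^sub>m (dim_row T) + complex_of_real (\<rho> / (1 + \<rho> * d)) \<cdot>\<^sub>m T)))"

definition M_mat :: "nat \<Rightarrow> complex mat \<Rightarrow> real \<Rightarrow> complex mat" where
  "M_mat N\<^sub>S T l = minv (1\<^sub>m (dim_row T) + complex_of_real (l / (1 + l * delta N\<^sub>S T l)) \<cdot>\<^sub>m T)"

definition kappa_bar ::
    "nat \<Rightarrow> nat \<Rightarrow> real \<Rightarrow> complex mat \<Rightarrow> complex mat \<Rightarrow> complex mat \<Rightarrow> nat \<Rightarrow> complex" where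
  "kappa_bar K N\<^sub>S \<sigma> R\<^sub>R R\<^sub>T \<Phi> j =
     (let l = largest_eigenvalues K (complex_of_real (1 / \<sigma>\<^sup>2) \<cdot>\<^sub>m R\<^sub>R) ! j in
      complex_of_real (\<sigma>\<^sup>2 * l) * mtrace (R\<^sub>T * M_mat N\<^sub>S (T_mat R\<^sub>T \<Phi>) l))"

end

theory Submission
  imports Defs "Jordan_Normal_Form.Spectral_Radius"
begin

text \<open>Completing the square in the filter and averaging the optimal error over \<open>S\<close> yields the trace formula for the
  error. Diagonalising \<open>R\<^sub>R\<close> then splits the trace into one resolvent of \<open>R\<^sub>T\<^sup>1\<^sup>/\<^sup>2 F S S\<^sup>H F\<^sup>H R\<^sub>T\<^sup>1\<^sup>/\<^sup>2\<close> per eigenvalue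
  \<open>\<rho>\<close> of \<open>R\<^sub>R / \<sigma>\<^sup>2\<close>. In the eigenbasis of \<open>T\<close> this resolvent, normalised on both sides, is \<open>(I + X)\<^sup>-\<^sup>1\<close> with
  \<open>X\<close> a centred Wishart deviation of rank at most \<open>K\<close>. Expanding to third order, \<open>E X = 0\<close>, the term \<open>E X\<^sup>2\<close>
  is the \<open>1/N\<^sub>S\<close> correction already contained in the fixed point \<open>\<delta>(\<rho>)\<close>, and both \<open>E X\<^sup>3\<close> and \<open>E \<parallel>X\<parallel>\<^sup>4\<close>
  are \<open>O(1/N\<^sub>S\<^sup>2)\<close>. Since the rank of \<open>R\<^sub>T\<close> is bounded and \<open>tr R\<^sub>T = O(N\<^sub>T)\<close>, the total error is \<open>O(1/N\<^sub>S)\<close>.\<close>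

section \<open>Positive semidefinite matrices\<close>

text \<open>The obstacle is uniformity. The precoder is arbitrary, so the eigenvalues
  \<open>t\<close> of the limit matrix \<open>T\<close> may have any size, and the trace of
  \<open>R\<^sub>T\<close> may grow like N_T; the latter costs a factor N_S, so each entry of the
  mean resolvent must be known up to a constant times 1/N_S^2, which a first-order comparison does
  not give. Dividing by the root of 1 + \<rho> t on both sides turns the covariance into \<rho> t /
  (1 + \<rho> t), at most 1 for every precoder, so the constants of the entry estimate depend on
  \<open>K\<close> alone. The deviation X is unbounded; instead of cutting off an exceptional event,
  the remainder is bounded by \<open>fro_norm X ^ 4\<close> for every X, large ones being handled by
  the contraction property of the resolvent. In the eigenbasis of \<open>T\<close> the null
  directions carry no error at all, so at most K^2 entries are summed although the matrices grow.
  The fixed point is never solved: with e = \<rho> \<delta>(\<rho>) it is only shown that e is the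
  sum of the normalised eigenvalues divided by N_S up to order 1/N_S^2, which reproduces the
  second-moment term.\<close>

notation mat_adjoint (\<open>_\<^sup>H\<close> [1000] 999)

section \<open>Adjoints, traces and inverses of complex matrices\<close>

lemma dim_adjoint [simp]: "dim_row (A\<^sup>H) = dim_col A" "dim_col (A\<^sup>H) = dim_row A"
  by (simp_all add: mat_adjoint_def)

lemma adjoint_carrier [simp, intro]: "A \<in> carrier_mat m n \<Longrightarrow> A\<^sup>H \<in> carrier_mat n m"
  by (intro carrier_matI) simp_all

lemma index_adjoint [simp]:
  fixes A :: "complex mat"
  assumes "i < dim_col A" "j < dim_row A"
  shows "A\<^sup>H $$ (i, j) = cnj (A $$ (j, i))"
  using assms by (simp add: mat_adjoint_def mat_of_rows_index conjugate_complex_def)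

lemma adjoint_adjoint [simp]:
  fixes A :: "complex mat"
  shows "(A\<^sup>H)\<^sup>H = A"
  by (rule eq_matI) auto

lemma index_mult_sum:
  assumes "A \<in> carrier_mat l m" "B \<in> carrier_mat m n" "i < l" "j < n"
  shows "(A * B) $$ (i, j) = (\<Sum>k<m. A $$ (i, k) * B $$ (k, j))"
  using assms by (auto simp: scalar_prod_def atLeast0LessThan intro!: sum.cong)

lemma index_mult_vec_sum:
  assumes "A \<in> carrier_mat l m" "v \<in> carrier_vec m" "i < l"
  shows "(A *\<^sub>v v) $ i = (\<Sum>k<m. A $$ (i, k) * v $ k)"
  using assms by (auto simp: scalar_prod_def atLeast0LessThan intro!: sum.cong)

lemma cscalar_prod_sum:
  fixes v w :: "complex vec"
  assumes "v \<in> carrier_vec n" "w \<in> carrier_vec n"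
  shows "v \<bullet>c w = (\<Sum>i<n. v $ i * cnj (w $ i))"
  using assms by (auto simp: scalar_prod_def atLeast0LessThan conjugate_complex_def intro!: sum.cong)

lemma adjoint_mult:
  fixes A B :: "complex mat"
  assumes "A \<in> carrier_mat l m" "B \<in> carrier_mat m n"
  shows "(A * B)\<^sup>H = B\<^sup>H * A\<^sup>H"
proof (rule eq_matI)
  fix i j assume "i < dim_row (B\<^sup>H * A\<^sup>H)" "j < dim_col (B\<^sup>H * A\<^sup>H)"
  then have ij: "i < n" "j < l" using assms by auto
  show "(A * B)\<^sup>H $$ (i, j) = (B\<^sup>H * A\<^sup>H) $$ (i, j)"
    using assms ij
    by (subst index_mult_sum[of _ n m _ l]; simp add: index_mult_sum[OF assms] mult.commute del: index_mult_mat(1))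
qed (use assms in auto)

lemma adjoint_one [simp]: "(1\<^sub>m n)\<^sup>H = (1\<^sub>m n :: complex mat)"
  by (rule eq_matI) auto

lemma adjoint_plus:
  fixes A B :: "complex mat"
  assumes "A \<in> carrier_mat m n" "B \<in> carrier_mat m n"
  shows "(A + B)\<^sup>H = A\<^sup>H + B\<^sup>H"
  using assms by (intro eq_matI) auto

lemma adjoint_smult:
  fixes A :: "complex mat"
  shows "(c \<cdot>\<^sub>m A)\<^sup>H = cnj c \<cdot>\<^sub>m A\<^sup>H"
  by (intro eq_matI) auto

lemma mtrace_mult_comm:
  assumes "A \<in> carrier_mat m n" "B \<in> carrier_mat n m"
  shows "mtrace (A * B) = mtrace (B * A)"
proof -
  have "mtrace (A * B) = (\<Sum>i<m. \<Sum>k<n. A $$ (i, k) * B $$ (k, i))"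
    unfolding mtrace_def using assms by (intro sum.cong) (auto simp: index_mult_sum[OF assms] simp del: index_mult_mat(1))
  also have "\<dots> = (\<Sum>k<n. \<Sum>i<m. B $$ (k, i) * A $$ (i, k))"
    by (subst sum.swap) (simp add: mult.commute)
  also have "\<dots> = mtrace (B * A)"
    unfolding mtrace_def using assms
    by (intro sum.cong) (auto simp: index_mult_sum[OF assms(2,1)] simp del: index_mult_mat(1))
  finally show ?thesis .
qed

text \<open>A square matrix over a field has at most one right inverse, and it is also a left
  inverse. Later evaluations of \<open>minv\<close> exhibit a right inverse and apply this rule, so
  the option value behind \<open>minv\<close> is inspected only here.\<close>

lemma minv_eqI:
  assumes A: "A \<in> carrier_mat n n" and B: "B \<in> carrier_mat n n" and AB: "A * B = 1\<^sub>m n"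
  shows "minv A = B"
proof -
  have BA: "B * A = 1\<^sub>m n" using mat_mult_left_right_inverse[OF A B AB] .
  have "A \<in> Units (ring_mat TYPE(complex) n ())"
    using A B AB BA by (auto simp: Units_def ring_mat_def)
  then obtain C where C: "mat_inverse A = Some C"
    using mat_inverse(1)[OF A, of "()"] by (cases "mat_inverse A") auto
  from mat_inverse(2)[OF A C] have "A * C = 1\<^sub>m n" "C \<in> carrier_mat n n" by auto
  then have "C = B" using A B BA by (metis assoc_mult_mat left_mult_one_mat right_mult_one_mat)
  then show ?thesis by (simp add: minv_def C)
qed

section \<open>Unitary matrices and real diagonal matrices\<close>

definition unitary :: "nat \<Rightarrow> complex mat \<Rightarrow> bool" where
  "unitary n U \<longleftrightarrow> U \<in> carrier_mat n n \<and> U\<^sup>H * U = 1\<^sub>m n"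

lemma unitaryD:
  assumes "unitary n U"
  shows "U \<in> carrier_mat n n" "U\<^sup>H \<in> carrier_mat n n" "U\<^sup>H * U = 1\<^sub>m n" "U * U\<^sup>H = 1\<^sub>m n"
  using assms mat_mult_left_right_inverse[of "U\<^sup>H" n U] by (auto simp: unitary_def)

lemma unitary_mult:
  assumes "unitary n U" "unitary n V"
  shows "unitary n (U * V)"
proof -
  note U = unitaryD[OF assms(1)] and V = unitaryD[OF assms(2)]
  have "(U * V)\<^sup>H * (U * V) = V\<^sup>H * ((U\<^sup>H * U) * V)"
    unfolding adjoint_mult[OF U(1) V(1)]
    using assoc_mult_mat[OF V(2) U(2) mult_carrier_mat[OF U(1) V(1)]] assoc_mult_mat[OF U(2,1) V(1)] by simp
  then show ?thesis unfolding unitary_def U(3) left_mult_one_mat[OF V(1)] V(3)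
    using mult_carrier_mat[OF U(1) V(1)] by simp
qed

text \<open>A real function as diagonal makes functional calculus a matter of composition: squares,
  square roots and resolvents of a Hermitian matrix are obtained by changing \<open>d\<close> while
  the unitary factor stays.\<close>

definition rdiag :: "nat \<Rightarrow> (nat \<Rightarrow> real) \<Rightarrow> complex mat" where
  "rdiag n d = Matrix.mat n n (\<lambda>(i, j). if i = j then complex_of_real (d i) else 0)"

lemma rdiag_carrier [simp, intro]: "rdiag n d \<in> carrier_mat n n"
  and dim_rdiag [simp]: "dim_row (rdiag n d) = n" "dim_col (rdiag n d) = n"
  and index_rdiag [simp]: "i < n \<Longrightarrow> j < n \<Longrightarrow> rdiag n d $$ (i, j) = (if i = j then complex_of_real (d i) else 0)"
  by (auto simp: rdiag_def)

lemma adjoint_rdiag [simp]: "(rdiag n d)\<^sup>H = rdiag n d"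
  by (rule eq_matI) auto

lemma index_rdiag_mult:
  assumes "A \<in> carrier_mat n m" "i < n" "j < m"
  shows "(rdiag n d * A) $$ (i, j) = complex_of_real (d i) * A $$ (i, j)"
  using assms by (subst index_mult_sum[of _ n n _ m])
    (auto simp: if_distrib[where f="\<lambda>x. x * _"] cong: if_cong)

lemma index_mult_rdiag:
  assumes "A \<in> carrier_mat m n" "i < m" "j < n"
  shows "(A * rdiag n d) $$ (i, j) = A $$ (i, j) * complex_of_real (d j)"
  using assms by (subst index_mult_sum[of _ m n _ n])
    (auto simp: if_distrib[where f="\<lambda>x. _ * x"] cong: if_cong)

lemma rdiag_mult: "rdiag n a * rdiag n b = rdiag n (\<lambda>i. a i * b i)"
  by (rule eq_matI) (auto simp: index_rdiag_mult[where m=n] simp del: index_mult_mat(1))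

lemma rdiag_cong: "(\<And>i. i < n \<Longrightarrow> a i = b i) \<Longrightarrow> rdiag n a = rdiag n b"
  by (rule eq_matI) auto

section \<open>Spectral theorem for Hermitian matrices\<close>

lemma normalized_corthogonal_unitary:
  fixes ws :: "complex vec list"
  assumes ws: "set ws \<subseteq> carrier_vec n" "corthogonal ws" "length ws = n"
  defines "W \<equiv> Matrix.mat n n (\<lambda>(i, j). (ws ! j) $ i / complex_of_real (sqrt (Re ((ws ! j) \<bullet>c (ws ! j)))))"
  shows "unitary n W"
proof -
  have c: "ws ! j \<in> carrier_vec n" if "j < n" for j using ws that by auto
  \<comment> \<open>\<open>corthogonal\<close> excludes vanishing self-products, so every length is
    positive and the columns can be normalised.\<close>
  have sq: "(ws ! j) \<bullet>c (ws ! j) = complex_of_real (Re ((ws ! j) \<bullet>c (ws ! j)))"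
     "Re ((ws ! j) \<bullet>c (ws ! j)) > 0" if j: "j < n" for j
  proof -
    have *: "(ws ! j) \<bullet>c (ws ! j) = complex_of_real (\<Sum>i<n. (cmod ((ws ! j) $ i))\<^sup>2)"
      unfolding cscalar_prod_sum[OF c[OF j] c[OF j]] by (simp add: complex_norm_square del: of_real_power)
    then show "(ws ! j) \<bullet>c (ws ! j) = complex_of_real (Re ((ws ! j) \<bullet>c (ws ! j)))" by simp
    have "(ws ! j) \<bullet>c (ws ! j) \<noteq> 0" using corthogonalD[OF ws(2), of j j] j ws(3) by auto
    moreover have "(\<Sum>i<n. (cmod ((ws ! j) $ i))\<^sup>2) \<ge> 0" by (simp add: sum_nonneg)
    ultimately show "Re ((ws ! j) \<bullet>c (ws ! j)) > 0" unfolding * by (auto simp: less_le simp del: of_real_sum)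
  qed
  have W: "W \<in> carrier_mat n n" by (auto simp: W_def)
  have "W\<^sup>H * W = 1\<^sub>m n"
  proof (rule eq_matI)
    fix i j assume "i < dim_row (1\<^sub>m n :: complex mat)" "j < dim_col (1\<^sub>m n :: complex mat)"
    then have ij: "i < n" "j < n" by auto
    have "(W\<^sup>H * W) $$ (i, j) = (\<Sum>k<n. cnj (W $$ (k, i)) * W $$ (k, j))"
      using W ij by (subst index_mult_sum[of _ n n _ n]) auto
    also have "\<dots> = ((ws ! j) \<bullet>c (ws ! i)) / (complex_of_real (sqrt (Re ((ws ! i) \<bullet>c (ws ! i)))) * complex_of_real (sqrt (Re ((ws ! j) \<bullet>c (ws ! j)))))"
      unfolding cscalar_prod_sum[OF c[OF ij(2)] c[OF ij(1)]] sum_divide_distrib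
      using ij by (intro sum.cong) (auto simp: W_def mult.commute)
    also have "\<dots> = 1\<^sub>m n $$ (i, j)"
    proof (cases "i = j")
      case True
      define r where "r = Re ((ws ! i) \<bullet>c (ws ! i))"
      have "(ws ! i) \<bullet>c (ws ! i) = complex_of_real r" "r > 0" using sq[OF ij(1)] by (auto simp: r_def)
      moreover have "complex_of_real (sqrt r) * complex_of_real (sqrt r) = complex_of_real r"
        using \<open>r > 0\<close> by (simp flip: of_real_mult)
      ultimately show ?thesis unfolding True[symmetric] r_def[symmetric] using ij by simp
    next
      case False
      then show ?thesis using corthogonalD[OF ws(2), of j i] ij ws(3) by auto
    qed
    finally show "(W\<^sup>H * W) $$ (i, j) = 1\<^sub>m n $$ (i, j)" .
  qed (use W in auto)
  then show ?thesis using W by (simp add: unitary_def)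
qed

text \<open>Gram-Schmidt leaves the first vector of a basis unchanged and the normalisation only
  rescales it, so completing \<open>v\<close> to a basis that starts with \<open>v\<close> gives the
  column. The scalar \<open>c\<close> may remain unknown because an eigenvector is needed only up to
  a factor.\<close>

lemma unitary_with_first_column:
  assumes v: "v \<in> carrier_vec n" "v \<noteq> 0\<^sub>v n"
  obtains W c where "unitary n W" "col W 0 = c \<cdot>\<^sub>v v"
proof -
  interpret cof_vec_space n "TYPE(complex)" .
  define b where "b = basis_completion v"
  define ws where "ws = gram_schmidt n b"
  have n: "n \<noteq> 0" using v by (metis carrier_vecD eq_vecI gr_implies_not0 index_zero_vec(2))
  from basis_completion[OF v, folded b_def]
  have dist_b: "distinct b" and indep: "\<not> lin_dep (set b)" and b: "set b \<subseteq> carrier_vec n"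
    and hdb: "hd b = v" and len_b: "length b = n" by auto
  from hdb len_b n obtain vs where bv: "b = v # vs" by (cases b) auto
  from gram_schmidt_result[OF b dist_b indep refl, folded ws_def]
  have ws: "set ws \<subseteq> carrier_vec n" "corthogonal ws" "length ws = n" by (auto simp: len_b)
  have hd: "hd ws = v" unfolding ws_def bv using gram_schmidt_hd[OF v(1)] .
  then have ws0: "ws ! 0 = v" using ws(3) n by (metis hd_conv_nth list.size(3))
  show ?thesis
    by (rule that[OF normalized_corthogonal_unitary[OF ws], of "1 / complex_of_real (sqrt (Re (v \<bullet>c v)))"])
      (use v n ws0 in \<open>auto intro!: eq_vecI\<close>)
qed

lemma rdiag_conj_index:
  assumes "U \<in> carrier_mat n n" "i < n" "j < n"
  shows "(U * rdiag n d * U\<^sup>H) $$ (i, j) = (\<Sum>k<n. U $$ (i, k) * complex_of_real (d k) * cnj (U $$ (j, k)))"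
  using assms by (subst index_mult_sum[of _ n n _ n]) (auto simp: index_mult_rdiag simp del: index_mult_mat(1))

text \<open>Deflation by induction on the dimension: over the complex numbers an eigenvector exists;
  in an orthonormal basis that starts with it the first column is \<open>e\<close> times a unit
  vector, Hermitian symmetry clears the first row as well, and the remaining block is Hermitian of
  dimension one less.\<close>

theorem hermitian_spectral:
  fixes A :: "complex mat"
  assumes "A \<in> carrier_mat n n" "A\<^sup>H = A"
  obtains U d where "unitary n U" "A = U * rdiag n d * U\<^sup>H"
  using assms
proof (induction n arbitrary: A thesis)
  case 0
  show ?case by (rule 0(1)[of "1\<^sub>m 0" "\<lambda>_. 0"]) (use 0 in \<open>auto simp: unitary_def\<close>)
next
  case (Suc m A)
  let ?n = "Suc m"
  note A = Suc.prems(2) and herm = Suc.prems(3)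
  obtain e where "e \<in> spectrum A" using spectrum_non_empty[OF A] by auto
  then obtain v where ev: "v \<in> carrier_vec ?n" "v \<noteq> 0\<^sub>v ?n" "A *\<^sub>v v = e \<cdot>\<^sub>v v"
    using A by (auto simp: spectrum_def eigenvalue_def eigenvector_def)
  obtain W c where W: "unitary ?n W" and W0: "col W 0 = c \<cdot>\<^sub>v v" using unitary_with_first_column[OF ev(1,2)] .
  note WD = unitaryD[OF W]
  define B where "B = W\<^sup>H * (A * W)"
  have AW: "A * W \<in> carrier_mat ?n ?n" and B: "B \<in> carrier_mat ?n ?n"
    using A WD by (auto simp: B_def)
  have hermB: "B\<^sup>H = B"
    unfolding B_def adjoint_mult[OF WD(2) AW] adjoint_mult[OF A WD(1)] herm
    using assoc_mult_mat[OF WD(2) A WD(1)] by simp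
  have AWcol: "(A * W) $$ (k, 0) = e * W $$ (k, 0)" if k: "k < ?n" for k
  proof -
    have "(A * W) $$ (k, 0) = (A *\<^sub>v col W 0) $ k" using A WD k by auto
    also have "\<dots> = (c \<cdot>\<^sub>v (A *\<^sub>v v)) $ k" unfolding W0 using mult_mat_vec[OF A ev(1)] by simp
    also have "\<dots> = e * (c \<cdot>\<^sub>v v) $ k" unfolding ev(3) using ev(1) k by simp
    also have "(c \<cdot>\<^sub>v v) $ k = W $$ (k, 0)" unfolding W0[symmetric] using WD k by auto
    finally show ?thesis .
  qed
  \<comment> \<open>In the new basis the eigenvalue equation says that the first column of
    \<open>B\<close> is \<open>e\<close> times the first unit vector.\<close>
  have B0: "B $$ (i, 0) = (if i = 0 then e else 0)" if i: "i < ?n" for i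
  proof -
    have "B $$ (i, 0) = (\<Sum>k<?n. W\<^sup>H $$ (i, k) * (A * W) $$ (k, 0))"
      unfolding B_def using index_mult_sum[OF WD(2) AW i] by simp
    also have "\<dots> = e * (\<Sum>k<?n. W\<^sup>H $$ (i, k) * W $$ (k, 0))"
      unfolding sum_distrib_left by (intro sum.cong refl) (simp add: AWcol mult_ac del: index_mult_mat(1))
    also have "(\<Sum>k<?n. W\<^sup>H $$ (i, k) * W $$ (k, 0)) = (W\<^sup>H * W) $$ (i, 0)"
      using index_mult_sum[OF WD(2,1) i, of 0] by simp
    also have "\<dots> = (if i = 0 then 1 else 0)" unfolding WD(3) using i by simp
    finally show ?thesis by auto
  qed
  have B_herm_index: "B $$ (i, j) = cnj (B $$ (j, i))" if "i < ?n" "j < ?n" for i j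
    using arg_cong[OF hermB, of "\<lambda>X. X $$ (i, j)"] B that by simp
  \<comment> \<open>A diagonal entry of a Hermitian matrix equals its own conjugate.\<close>
  have e_real: "e = complex_of_real (Re e)"
    using B_herm_index[of 0 0] B0[of 0] by (simp add: complex_eq_iff)
  have B0': "B $$ (0, j) = (if j = 0 then e else 0)" if "j < ?n" for j
    using B_herm_index[of 0 j] B0[OF that] that e_real by (auto simp: complex_eq_iff)
  define C where "C = Matrix.mat m m (\<lambda>(i, j). B $$ (Suc i, Suc j))"
  have C: "C \<in> carrier_mat m m" by (auto simp: C_def)
  have hermC: "C\<^sup>H = C"
    using C by (intro eq_matI) (auto simp: C_def B_herm_index[symmetric])
  obtain V d where V: "unitary m V" and CV: "C = V * rdiag m d * V\<^sup>H"
    using Suc.IH[OF _ C hermC] by blast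
  note VD = unitaryD[OF V]
  \<comment> \<open>\<open>X\<close> is the block sum of the 1 by 1 identity and \<open>V\<close>:
    index 0 is the eigenvector already found, index \<open>Suc i\<close> is index i of the smaller
    block.\<close>
  define X where "X = Matrix.mat ?n ?n (\<lambda>(i, j). case i of 0 \<Rightarrow> (if j = 0 then 1 else 0)
      | Suc i' \<Rightarrow> (case j of 0 \<Rightarrow> 0 | Suc j' \<Rightarrow> V $$ (i', j')))"
  define d' where "d' = (\<lambda>i. case i of 0 \<Rightarrow> Re e | Suc i' \<Rightarrow> d i')"
  have X: "X \<in> carrier_mat ?n ?n" by (auto simp: X_def)
  have "X\<^sup>H * X = 1\<^sub>m ?n"
  proof (rule eq_matI)
    fix i j assume "i < dim_row (1\<^sub>m ?n :: complex mat)" "j < dim_col (1\<^sub>m ?n :: complex mat)"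
    then have ij: "i < ?n" "j < ?n" by auto
    have "(X\<^sup>H * X) $$ (i, j) = (\<Sum>k<?n. cnj (X $$ (k, i)) * X $$ (k, j))"
      using X ij by (subst index_mult_sum[of _ ?n ?n _ ?n]) auto
    also have "\<dots> = 1\<^sub>m ?n $$ (i, j)"
    proof (cases "i = 0 \<or> j = 0")
      case True
      then show ?thesis using ij by (subst sum.lessThan_Suc_shift) (auto simp: X_def split: nat.splits)
    next
      case False
      then obtain i' j' where [simp]: "i = Suc i'" "j = Suc j'" by (metis nat.exhaust)
      have "(V\<^sup>H * V) $$ (i', j') = (\<Sum>k<m. cnj (V $$ (k, i')) * V $$ (k, j'))"
        using VD ij by (subst index_mult_sum[of _ m m _ m]) auto
      then show ?thesis using ij VD(3) by (subst sum.lessThan_Suc_shift) (simp add: X_def)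
    qed
    finally show "(X\<^sup>H * X) $$ (i, j) = 1\<^sub>m ?n $$ (i, j)" .
  qed (use X in auto)
  then have uX: "unitary ?n X" using X by (simp add: unitary_def)
  have BX: "B = X * rdiag ?n d' * X\<^sup>H"
  proof (rule eq_matI)
    fix i j assume "i < dim_row (X * rdiag ?n d' * X\<^sup>H)" "j < dim_col (X * rdiag ?n d' * X\<^sup>H)"
    then have ij: "i < ?n" "j < ?n" using X by auto
    show "B $$ (i, j) = (X * rdiag ?n d' * X\<^sup>H) $$ (i, j)"
    proof (cases "i = 0 \<or> j = 0")
      case True
      then show ?thesis unfolding rdiag_conj_index[OF X ij] using ij e_real
        by (subst sum.lessThan_Suc_shift) (auto simp: X_def d'_def B0 B0' split: nat.splits)
    next
      case False
      then obtain i' j' where [simp]: "i = Suc i'" "j = Suc j'" by (metis nat.exhaust)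
      have "B $$ (i, j) = C $$ (i', j')" using ij by (simp add: C_def)
      also have "\<dots> = (\<Sum>k<m. V $$ (i', k) * complex_of_real (d k) * cnj (V $$ (j', k)))"
        unfolding CV using rdiag_conj_index[OF VD(1)] ij by simp
      finally show ?thesis unfolding rdiag_conj_index[OF X ij] using ij
        by (subst sum.lessThan_Suc_shift) (simp add: X_def d'_def)
    qed
  qed (use X B in auto)
  have "A = (W * X) * rdiag ?n d' * (W * X)\<^sup>H"
  proof -
    have "W * B * W\<^sup>H = (W * W\<^sup>H) * A * (W * W\<^sup>H)"
      unfolding B_def using A WD(1,2)
      by (simp add: assoc_mult_mat[of _ ?n ?n _ ?n _ ?n] mult_carrier_mat[of _ ?n ?n _ ?n] del: WD(4))
    also have "\<dots> = A" using A by (simp add: WD(4))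
    finally have "A = W * (X * rdiag ?n d' * X\<^sup>H) * W\<^sup>H" by (simp add: BX)
    also have "\<dots> = (W * X) * rdiag ?n d' * (X\<^sup>H * W\<^sup>H)"
      using X WD(1,2) by (simp add: assoc_mult_mat[of _ ?n ?n _ ?n _ ?n] mult_carrier_mat[of _ ?n ?n _ ?n])
    finally show ?thesis by (simp add: adjoint_mult[OF WD(1) X])
  qed
  then show ?case using Suc.prems(1)[OF unitary_mult[OF W uX]] by blast
qed

lemma rdiag_conj_mult:
  assumes "unitary n U"
  shows "(U * rdiag n a * U\<^sup>H) * (U * rdiag n b * U\<^sup>H) = U * rdiag n (\<lambda>i. a i * b i) * U\<^sup>H"
proof -
  note U = unitaryD[OF assms]
  have "(U * rdiag n a * U\<^sup>H) * (U * rdiag n b * U\<^sup>H) = U * (rdiag n a * ((U\<^sup>H * U) * (rdiag n b * U\<^sup>H)))"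
    using U(1,2) by (simp add: assoc_mult_mat[of _ n n _ n _ n] mult_carrier_mat[of _ n n _ n])
  also have "\<dots> = U * ((rdiag n a * rdiag n b) * U\<^sup>H)"
    using U(1,2) by (simp add: assoc_mult_mat[of _ n n _ n _ n] mult_carrier_mat[of _ n n _ n] U(3) left_mult_one_mat[of _ n n])
  also have "\<dots> = U * rdiag n (\<lambda>i. a i * b i) * U\<^sup>H"
    using U(1,2) by (simp add: assoc_mult_mat[of _ n n _ n _ n] mult_carrier_mat[of _ n n _ n] rdiag_mult)
  finally show ?thesis .
qed

lemma rdiag_conj_carrier:
  assumes "unitary n U"
  shows "U * rdiag n a * U\<^sup>H \<in> carrier_mat n n"
  using unitaryD[OF assms] by (meson mult_carrier_mat rdiag_carrier)

lemma rdiag_conj_adjoint: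
  assumes "unitary n U"
  shows "(U * rdiag n a * U\<^sup>H)\<^sup>H = U * rdiag n a * U\<^sup>H"
proof -
  note U = unitaryD[OF assms]
  have "(U * rdiag n a * U\<^sup>H)\<^sup>H = U * (rdiag n a * U\<^sup>H)"
    using U by (simp add: adjoint_mult[of _ n n _ n] mult_carrier_mat[of _ n n _ n])
  then show ?thesis using U by (simp add: assoc_mult_mat[of _ n n _ n _ n])
qed

section \<open>Quadratic forms, positivity and square roots\<close>

lemma quadform_sum:
  fixes A :: "complex mat"
  assumes A: "A \<in> carrier_mat n n" and v: "v \<in> carrier_vec n"
  shows "(A *\<^sub>v v) \<bullet>c v = (\<Sum>i<n. \<Sum>j<n. A $$ (i, j) * v $ j * cnj (v $ i))"
proof -
  have "(A *\<^sub>v v) \<bullet>c v = (\<Sum>i<n. (A *\<^sub>v v) $ i * cnj (v $ i))"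
    using A v by (intro cscalar_prod_sum) auto
  also have "\<dots> = (\<Sum>i<n. (\<Sum>j<n. A $$ (i, j) * v $ j) * cnj (v $ i))"
    by (intro sum.cong refl) (simp only: index_mult_vec_sum[OF A v] lessThan_iff)
  finally show ?thesis by (simp add: sum_distrib_right)
qed

lemma quadform_gram:
  fixes C :: "complex mat"
  assumes C: "C \<in> carrier_mat m n" and v: "v \<in> carrier_vec n"
  shows "((C\<^sup>H * C) *\<^sub>v v) \<bullet>c v = complex_of_real (\<Sum>k<m. (cmod ((C *\<^sub>v v) $ k))\<^sup>2)"
proof -
  have CC: "C\<^sup>H * C \<in> carrier_mat n n" using C by (meson adjoint_carrier mult_carrier_mat)
  have "((C\<^sup>H * C) *\<^sub>v v) \<bullet>c v = (\<Sum>i<n. \<Sum>j<n. (\<Sum>k<m. cnj (C $$ (k, i)) * C $$ (k, j)) * v $ j * cnj (v $ i))"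
    unfolding quadform_sum[OF CC v] using C
    by (intro sum.cong refl) (simp add: index_mult_sum[of _ n m _ n] del: index_mult_mat(1))
  also have "\<dots> = (\<Sum>k<m. \<Sum>i<n. \<Sum>j<n. cnj (C $$ (k, i)) * C $$ (k, j) * v $ j * cnj (v $ i))"
    by (simp add: sum_distrib_right sum.swap[of _ _ "{..<m}"])
  also have "\<dots> = (\<Sum>k<m. cnj (\<Sum>i<n. C $$ (k, i) * v $ i) * (\<Sum>j<n. C $$ (k, j) * v $ j))"
    by (intro sum.cong refl) (simp only: cnj_sum complex_cnj_mult sum_product, simp only: mult_ac)
  also have "\<dots> = (\<Sum>k<m. complex_of_real ((cmod ((C *\<^sub>v v) $ k))\<^sup>2))"
    by (intro sum.cong refl) (simp only: index_mult_vec_sum[OF C v] lessThan_iff complex_norm_square mult.commute)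
  finally show ?thesis by simp
qed

text \<open>The form at v is the squared length of \<open>C *\<^sub>v v\<close>. Exhibiting such a
  factor is how positivity is proved below, for spectral and Kronecker constructions as well as for
  the random matrices.\<close>

lemma psd_gram:
  assumes "C \<in> carrier_mat m n"
  shows "psd n (C\<^sup>H * C)"
  unfolding psd_def using assms quadform_gram[OF assms]
  by (auto simp: adjoint_mult[of _ n m _ n] sum_nonneg intro!: mult_carrier_mat[of _ n m _ n])

lemma psd_rdiag_conj:
  assumes U: "unitary n U" and a: "\<And>i. i < n \<Longrightarrow> 0 \<le> a i"
  shows "psd n (U * rdiag n a * U\<^sup>H)"
proof -
  let ?C = "U * rdiag n (\<lambda>i. sqrt (a i)) * U\<^sup>H"
  have "?C\<^sup>H * ?C = U * rdiag n (\<lambda>i. sqrt (a i) * sqrt (a i)) * U\<^sup>H"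
    unfolding rdiag_conj_adjoint[OF U] rdiag_conj_mult[OF U] ..
  also have "rdiag n (\<lambda>i. sqrt (a i) * sqrt (a i)) = rdiag n a"
    using a by (intro rdiag_cong) simp
  finally show ?thesis using psd_gram[OF rdiag_conj_carrier[OF U]] by metis
qed

theorem psd_spectral:
  assumes "psd n A"
  obtains U d where "unitary n U" "A = U * rdiag n d * U\<^sup>H" "\<And>i. i < n \<Longrightarrow> 0 \<le> d i"
proof -
  have A: "A \<in> carrier_mat n n" "A\<^sup>H = A" using assms by (auto simp: psd_def)
  obtain U d where U: "unitary n U" and AU: "A = U * rdiag n d * U\<^sup>H" using hermitian_spectral[OF A] .
  note UD = unitaryD[OF U]
  have "0 \<le> d i" if i: "i < n" for i
  proof -
    \<comment> \<open>\<open>?v\<close> is column i of \<open>U\<close>, a unit eigenvector for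
      \<open>d i\<close>; positivity at this single vector gives the sign of
      \<open>d i\<close>.\<close>
    let ?v = "U *\<^sub>v unit_vec n i"
    have v: "?v \<in> carrier_vec n" using UD by auto
    have 1: "U\<^sup>H *\<^sub>v ?v = unit_vec n i"
      using UD assoc_mult_mat_vec[OF UD(2,1), of "unit_vec n i"] by simp
    have "A *\<^sub>v ?v = U *\<^sub>v (rdiag n d *\<^sub>v (U\<^sup>H *\<^sub>v ?v))"
      unfolding AU using assoc_mult_mat_vec[OF mult_carrier_mat[OF UD(1) rdiag_carrier] UD(2) v]
        assoc_mult_mat_vec[OF UD(1) rdiag_carrier mult_mat_vec_carrier[OF UD(2) v]] by simp
    also have "rdiag n d *\<^sub>v (U\<^sup>H *\<^sub>v ?v) = complex_of_real (d i) \<cdot>\<^sub>v unit_vec n i"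
      unfolding 1 by (rule eq_vecI) (use i in \<open>auto simp: index_mult_vec_sum[of _ n n] unit_vec_def if_distrib[where f="\<lambda>x. _ * x"] simp del: index_mult_mat_vec cong: if_cong\<close>)
    also have "U *\<^sub>v (complex_of_real (d i) \<cdot>\<^sub>v unit_vec n i) = complex_of_real (d i) \<cdot>\<^sub>v ?v"
      using UD by (simp add: mult_mat_vec)
    finally have "(A *\<^sub>v ?v) \<bullet>c ?v = complex_of_real (d i) * (?v \<bullet>c ?v)" using v by simp
    also have "?v \<bullet>c ?v = ((U\<^sup>H * U) *\<^sub>v unit_vec n i) \<bullet>c unit_vec n i"
      unfolding quadform_gram[OF UD(1) unit_vec_carrier] cscalar_prod_sum[OF v v]
      by (simp only: of_real_sum complex_norm_square)
    also have "\<dots> = 1" unfolding UD(3) using i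
      by (simp add: cscalar_prod_sum[of _ n]) (simp add: unit_vec_def if_distrib[where f="\<lambda>x. x * _"] cong: if_cong)
    finally show ?thesis using assms v unfolding psd_def by (metis Re_complex_of_real mult.right_neutral)
  qed
  then show ?thesis using that U AU by blast
qed

text \<open>The two eigenbases need not coincide. Their overlap matrix
  \<open>G = U\<^sup>H * V\<close> intertwines the squared eigenvalues, so
  \<open>G $$ (i, j)\<close> vanishes unless \<open>b i\<close> and \<open>c j\<close> have equal
  squares, hence are equal since both are nonnegative. Therefore \<open>G\<close> intertwines the
  eigenvalues themselves, which is \<open>B = C\<close>.\<close>

theorem psd_sqrt_unique:
  assumes "psd n A" "psd n B" "psd n C" "B * B = A" "C * C = A"
  shows "B = C"
proof -
  obtain U b where U: "unitary n U" and B: "B = U * rdiag n b * U\<^sup>H" and b: "\<And>i. i < n \<Longrightarrow> 0 \<le> b i"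
    using psd_spectral[OF assms(2)] by blast
  obtain V c where V: "unitary n V" and C: "C = V * rdiag n c * V\<^sup>H" and c: "\<And>i. i < n \<Longrightarrow> 0 \<le> c i"
    using psd_spectral[OF assms(3)] by blast
  note UD = unitaryD[OF U] and VD = unitaryD[OF V]
  note simps = assoc_mult_mat[of _ n n _ n _ n] mult_carrier_mat[of _ n n _ n] left_mult_one_mat[of _ n n] right_mult_one_mat[of _ n n]
  define G where "G = U\<^sup>H * V"
  have G: "G \<in> carrier_mat n n" using UD VD by (auto simp: G_def)
  \<comment> \<open>Equality of two conjugated matrices is the same as intertwining by
    \<open>G\<close>; used from left to right for the squares and from right to left for the
    roots.\<close>
  have *: "(U * X * U\<^sup>H = V * Y * V\<^sup>H) = (X * G = G * Y)" if XY: "X \<in> carrier_mat n n" "Y \<in> carrier_mat n n" for X Y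
  proof
    assume eq: "U * X * U\<^sup>H = V * Y * V\<^sup>H"
    have "X * G = (U\<^sup>H * U) * X * U\<^sup>H * V" using UD(1,2) VD(1,2) XY unfolding UD(3) by (simp add: simps G_def)
    also have "\<dots> = U\<^sup>H * (U * X * U\<^sup>H) * V" using UD(1,2) VD(1,2) XY by (simp add: simps)
    also have "\<dots> = U\<^sup>H * V * Y * (V\<^sup>H * V)" unfolding eq using UD(1,2) VD(1,2) XY by (simp add: simps)
    also have "\<dots> = G * Y" unfolding VD(3) using UD(1,2) VD(1,2) XY by (simp add: simps G_def)
    finally show "X * G = G * Y" .
  next
    assume eq: "X * G = G * Y"
    have "U * X * U\<^sup>H = U * X * U\<^sup>H * (V * V\<^sup>H)" unfolding VD(4) using UD(1,2) VD(1,2) XY by (simp add: simps)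
    also have "\<dots> = U * (X * G) * V\<^sup>H" using UD(1,2) VD(1,2) XY by (simp add: simps G_def)
    also have "\<dots> = (U * U\<^sup>H) * V * Y * V\<^sup>H" unfolding eq using UD(1,2) VD(1,2) XY by (simp add: simps G_def)
    also have "\<dots> = V * Y * V\<^sup>H" unfolding UD(4) using UD(1,2) VD(1,2) XY by (simp add: simps)
    finally show "U * X * U\<^sup>H = V * Y * V\<^sup>H" .
  qed
  have "U * rdiag n (\<lambda>i. b i * b i) * U\<^sup>H = V * rdiag n (\<lambda>i. c i * c i) * V\<^sup>H"
    using assms(4,5) unfolding B C rdiag_conj_mult[OF U] rdiag_conj_mult[OF V] by simp
  then have eq: "rdiag n (\<lambda>i. b i * b i) * G = G * rdiag n (\<lambda>i. c i * c i)" by (simp add: *)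
  have "rdiag n b * G = G * rdiag n c"
  proof (rule eq_matI)
    fix i j assume "i < dim_row (G * rdiag n c)" "j < dim_col (G * rdiag n c)"
    then have ij: "i < n" "j < n" using G by auto
    have "complex_of_real (b i * b i) * G $$ (i, j) = G $$ (i, j) * complex_of_real (c j * c j)"
      using arg_cong[OF eq, of "\<lambda>X. X $$ (i, j)"] ij G
      by (simp add: index_rdiag_mult[where m=n] index_mult_rdiag[where m=n] del: index_mult_mat(1))
    then have "complex_of_real ((b i - c j) * (b i + c j)) * G $$ (i, j) = 0"
      by (simp add: algebra_simps)
    then have "b i = c j \<or> b i + c j = 0 \<or> G $$ (i, j) = 0"
      by (metis eq_iff_diff_eq_0 mult_eq_0_iff of_real_eq_0_iff)
    \<comment> \<open>A vanishing sum of two nonnegative numbers makes both zero, hence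
      equal.\<close>
    then have "b i = c j \<or> G $$ (i, j) = 0" using b[OF ij(1)] c[OF ij(2)] by linarith
    then show "(rdiag n b * G) $$ (i, j) = (G * rdiag n c) $$ (i, j)"
      using ij G by (auto simp: index_rdiag_mult[where m=n] index_mult_rdiag[where m=n] simp del: index_mult_mat(1))
  qed (use G in auto)
  then show ?thesis unfolding B C by (simp add: *)
qed

text \<open>This evaluates the definite description in \<open>psd_sqrt\<close>: the explicit matrix
  is a candidate and \<open>psd_sqrt_unique\<close> excludes any other.\<close>

lemma psd_sqrt_rdiag_conj:
  assumes U: "unitary n U" and a: "\<And>i. i < n \<Longrightarrow> 0 \<le> a i"
  shows "psd_sqrt (U * rdiag n a * U\<^sup>H) = U * rdiag n (\<lambda>i. sqrt (a i)) * U\<^sup>H"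
proof -
  let ?A = "U * rdiag n a * U\<^sup>H" and ?S = "U * rdiag n (\<lambda>i. sqrt (a i)) * U\<^sup>H"
  have dim: "dim_row ?A = n" using rdiag_conj_carrier[OF U] by blast
  have S: "psd n ?S" using a by (intro psd_rdiag_conj[OF U]) simp
  have "?S * ?S = U * rdiag n (\<lambda>i. sqrt (a i) * sqrt (a i)) * U\<^sup>H" by (rule rdiag_conj_mult[OF U])
  also have "rdiag n (\<lambda>i. sqrt (a i) * sqrt (a i)) = rdiag n a"
    using a by (intro rdiag_cong) simp
  finally have SS: "?S * ?S = ?A" .
  show ?thesis unfolding psd_sqrt_def dim
    by (rule the_equality) (use S SS psd_sqrt_unique[OF psd_rdiag_conj[OF U a] _ S _ SS] in blast)+
qed

lemma psd_sqrt:
  assumes "psd n A"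
  shows "psd n (psd_sqrt A)" "psd_sqrt A * psd_sqrt A = A"
proof -
  obtain U d where U: "unitary n U" and A: "A = U * rdiag n d * U\<^sup>H" and d: "\<And>i. i < n \<Longrightarrow> 0 \<le> d i"
    using psd_spectral[OF assms] by blast
  have eq: "psd_sqrt A = U * rdiag n (\<lambda>i. sqrt (d i)) * U\<^sup>H"
    unfolding A by (rule psd_sqrt_rdiag_conj[OF U d])
  show "psd n (psd_sqrt A)" unfolding eq using d by (intro psd_rdiag_conj[OF U]) simp
  show "psd_sqrt A * psd_sqrt A = A"
    unfolding eq rdiag_conj_mult[OF U] unfolding A
    using d by (intro arg_cong[where f="\<lambda>X. U * X * U\<^sup>H"] rdiag_cong) simp
qed

section \<open>Unitary conjugation and resolvents\<close>

lemma unitary_conj_mult: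
  assumes "unitary n W" "X \<in> carrier_mat n n" "Y \<in> carrier_mat n n"
  shows "(W * X * W\<^sup>H) * (W * Y * W\<^sup>H) = W * (X * Y) * W\<^sup>H"
proof -
  note W = unitaryD[OF assms(1)]
  note simps = assoc_mult_mat[of _ n n _ n _ n] mult_carrier_mat[of _ n n _ n] left_mult_one_mat[of _ n n]
  have "(W * X * W\<^sup>H) * (W * Y * W\<^sup>H) = W * X * (W\<^sup>H * W) * (Y * W\<^sup>H)"
    using W(1,2) assms(2,3) by (simp add: simps)
  also have "\<dots> = W * (X * Y) * W\<^sup>H" unfolding W(3) using W(1,2) assms(2,3) by (simp add: simps)
  finally show ?thesis .
qed

lemma mtrace_unitary_conj:
  assumes "unitary n W" "X \<in> carrier_mat n n"
  shows "mtrace (W * X * W\<^sup>H) = mtrace X"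
proof -
  note W = unitaryD[OF assms(1)]
  have "mtrace (W * X * W\<^sup>H) = mtrace (W\<^sup>H * (W * X))"
    using W assms(2) by (intro mtrace_mult_comm[of _ n n]) auto
  also have "W\<^sup>H * (W * X) = X"
    using assoc_mult_mat[OF W(2,1) assms(2)] W(3) assms(2) by simp
  finally show ?thesis .
qed

lemma unitary_conj_one: "unitary n W \<Longrightarrow> W * 1\<^sub>m n * W\<^sup>H = 1\<^sub>m n"
  using unitaryD[of n W] by simp

lemma unitary_conj_plus:
  assumes "unitary n W" "X \<in> carrier_mat n n" "Y \<in> carrier_mat n n"
  shows "W * (X + Y) * W\<^sup>H = W * X * W\<^sup>H + W * Y * W\<^sup>H"
  using unitaryD(1,2)[OF assms(1)] assms(2,3)
  by (simp add: mult_add_distrib_mat[of _ n n _ n] add_mult_distrib_mat[of _ n n _ _ n] mult_carrier_mat[of _ n n _ n])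

lemma unitary_conj_smult:
  assumes "unitary n W" "X \<in> carrier_mat n n"
  shows "W * (c \<cdot>\<^sub>m X) * W\<^sup>H = c \<cdot>\<^sub>m (W * X * W\<^sup>H)"
  using unitaryD(1,2)[OF assms(1)] assms(2)
  by (simp add: mult_smult_distrib[of _ n n _ n] mult_smult_assoc_mat[of _ n n _ n] mult_carrier_mat[of _ n n _ n])

lemma resolvent_rdiag_conj:
  assumes U: "unitary n U" and q: "\<And>i. i < n \<Longrightarrow> 0 \<le> q i" and t: "0 \<le> t"
  shows "minv (1\<^sub>m n + complex_of_real t \<cdot>\<^sub>m (U * rdiag n q * U\<^sup>H)) = U * rdiag n (\<lambda>i. 1 / (1 + t * q i)) * U\<^sup>H"
    and "(1\<^sub>m n + complex_of_real t \<cdot>\<^sub>m (U * rdiag n q * U\<^sup>H)) * (U * rdiag n (\<lambda>i. 1 / (1 + t * q i)) * U\<^sup>H) = 1\<^sub>m n"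
proof -
  have "1\<^sub>m n + complex_of_real t \<cdot>\<^sub>m (U * rdiag n q * U\<^sup>H) = U * (1\<^sub>m n + complex_of_real t \<cdot>\<^sub>m rdiag n q) * U\<^sup>H"
    using U by (simp add: unitary_conj_plus unitary_conj_smult unitary_conj_one)
  also have "1\<^sub>m n + complex_of_real t \<cdot>\<^sub>m rdiag n q = rdiag n (\<lambda>i. 1 + t * q i)"
    by (rule eq_matI) auto
  finally have eq: "1\<^sub>m n + complex_of_real t \<cdot>\<^sub>m (U * rdiag n q * U\<^sup>H) = U * rdiag n (\<lambda>i. 1 + t * q i) * U\<^sup>H" .
  have pos: "1 + t * q i > 0" if "i < n" for i using q[OF that] t by (simp add: add_pos_nonneg)
  have "rdiag n (\<lambda>i. (1 + t * q i) * (1 / (1 + t * q i))) = 1\<^sub>m n"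
    by (rule eq_matI) (use pos in \<open>force+\<close>)
  then show 1: "(1\<^sub>m n + complex_of_real t \<cdot>\<^sub>m (U * rdiag n q * U\<^sup>H)) * (U * rdiag n (\<lambda>i. 1 / (1 + t * q i)) * U\<^sup>H) = 1\<^sub>m n"
    unfolding eq rdiag_conj_mult[OF U] using unitary_conj_one[OF U] by simp
  show "minv (1\<^sub>m n + complex_of_real t \<cdot>\<^sub>m (U * rdiag n q * U\<^sup>H)) = U * rdiag n (\<lambda>i. 1 / (1 + t * q i)) * U\<^sup>H"
    by (rule minv_eqI[OF _ rdiag_conj_carrier[OF U] 1]) (use rdiag_conj_carrier[OF U] in auto)
qed

text \<open>All eigenvalues of the shifted matrix are at least 1, so \<open>minv\<close> is
  meaningful here for every rank and size of \<open>Q\<close>.\<close>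

lemma resolvent_psd:
  assumes Q: "psd n Q" and t: "0 \<le> t"
  shows "minv (1\<^sub>m n + complex_of_real t \<cdot>\<^sub>m Q) \<in> carrier_mat n n"
    "(1\<^sub>m n + complex_of_real t \<cdot>\<^sub>m Q) * minv (1\<^sub>m n + complex_of_real t \<cdot>\<^sub>m Q) = 1\<^sub>m n"
proof -
  obtain U d where U: "unitary n U" and QU: "Q = U * rdiag n d * U\<^sup>H" and d: "\<And>i. i < n \<Longrightarrow> 0 \<le> d i"
    using psd_spectral[OF Q] by blast
  have *: "minv (1\<^sub>m n + complex_of_real t \<cdot>\<^sub>m Q) = U * rdiag n (\<lambda>i. 1 / (1 + t * d i)) * U\<^sup>H"
    "(1\<^sub>m n + complex_of_real t \<cdot>\<^sub>m Q) * (U * rdiag n (\<lambda>i. 1 / (1 + t * d i)) * U\<^sup>H) = 1\<^sub>m n"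
    unfolding QU by (rule resolvent_rdiag_conj[OF U _ t], use d in simp)+
  show "minv (1\<^sub>m n + complex_of_real t \<cdot>\<^sub>m Q) \<in> carrier_mat n n"
    using *(1) rdiag_conj_carrier[OF U] by simp
  show "(1\<^sub>m n + complex_of_real t \<cdot>\<^sub>m Q) * minv (1\<^sub>m n + complex_of_real t \<cdot>\<^sub>m Q) = 1\<^sub>m n"
    using * by simp
qed

text \<open>Each column of \<open>U\<close> with nonzero eigenvalue is the image under
  \<open>A\<close> of a multiple of itself, so it lies in the column space; being columns of an
  invertible matrix, these vectors are independent, and their number is bounded by the dimension of
  that space.\<close>

lemma card_nonzero_eigenvalues_le_rank:
  assumes U: "unitary n U" and A: "A = U * rdiag n d * U\<^sup>H"
  shows "card {i. i < n \<and> d i \<noteq> 0} \<le> mrank A"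
proof -
  interpret vec_space "TYPE(complex)" n .
  note UD = unitaryD[OF U]
  have Ac: "A \<in> carrier_mat n n" unfolding A by (rule rdiag_conj_carrier[OF U])
  have inj: "u = 0\<^sub>v n" if "U *\<^sub>v u = 0\<^sub>v n" "u \<in> carrier_vec n" for u
  proof -
    have "U\<^sup>H *\<^sub>v 0\<^sub>v n = 0\<^sub>v n" using UD(2) by (intro eq_vecI) (auto simp: index_mult_vec_sum[of _ n n] simp del: index_mult_mat_vec)
    then show ?thesis using assoc_mult_mat_vec[OF UD(2,1) that(2)] that UD(3) by simp
  qed
  have dU: "Determinant.det U \<noteq> 0"
    using det_0_iff_vec_prod_zero_field[OF UD(1)] inj by blast
  have rU: "rank U = n" using det_rank_iff[OF UD(1)] dU by simp
  have dist: "distinct (cols U)" using non_distinct_low_rank[OF UD(1)] rU by fastforce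
  have li: "lin_indpt (set (cols U))" by (rule full_rank_lin_indpt[OF UD(1) rU dist])
  define I where "I = {i. i < n \<and> d i \<noteq> 0}"
  define X where "X = col U ` I"
  have XU: "X \<subseteq> set (cols U)" using UD(1) by (auto simp: X_def I_def cols_def)
  have inj_col: "inj_on (col U) I"
    using dist UD(1) by (auto simp: inj_on_def I_def distinct_conv_nth)
  have cardX: "card X = card I" unfolding X_def by (rule card_image[OF inj_col])
  have liX: "lin_indpt X" using li XU subset_li_is_li by blast
  have colsA: "set (cols A) \<subseteq> carrier_vec n" using Ac cols_dim by blast
  have AU: "A *\<^sub>v col U i = complex_of_real (d i) \<cdot>\<^sub>v col U i" if i: "i < n" for i
  proof -
    have "A * U = U * rdiag n d"
      unfolding A using UD by (simp add: assoc_mult_mat[of _ n n _ n _ n] mult_carrier_mat[of _ n n _ n])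
    then have "col (A * U) i = col (U * rdiag n d) i" by simp
    moreover have "col (A * U) i = A *\<^sub>v col U i" by (rule col_mult2[OF Ac UD(1) i])
    moreover have "col (U * rdiag n d) i = complex_of_real (d i) \<cdot>\<^sub>v col U i"
      using UD(1) i by (intro eq_vecI) (auto simp: index_mult_rdiag[OF UD(1)] simp del: index_mult_mat(1))
    ultimately show ?thesis by simp
  qed
  have Xspan: "X \<subseteq> span (set (cols A))"
  proof
    fix x assume "x \<in> X"
    then obtain i where i: "i < n" "d i \<noteq> 0" "x = col U i" by (auto simp: X_def I_def)
    have cU: "col U i \<in> carrier_vec n" using UD(1) by auto
    have "A *\<^sub>v ((1 / complex_of_real (d i)) \<cdot>\<^sub>v col U i) = x"
      using i cU Ac by (simp add: mult_mat_vec AU smult_smult_assoc)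
    then show "x \<in> span (set (cols A))"
      using col_space_eq[OF Ac] Ac cU unfolding col_space_def by auto
  qed
  have sub: "submodule class_ring (span (set (cols A))) V" using colsA by (simp add: span_is_submodule)
  have vs: "vectorspace class_ring (span_vs (set (cols A)))" using colsA span_is_subspace subspace_is_vs by blast
  have fd: "vectorspace.fin_dim class_ring (span_vs (set (cols A)))"
    using fin_dim_span[of "set (cols A)"] colsA by simp
  \<comment> \<open>Independence is transferred from the whole space to the column space regarded as
    a vector space of its own, where the dimension bound applies.\<close>
  have li': "LinearCombinations.module.lin_indpt class_ring (span_vs (set (cols A))) X"
    using span_li_not_depend(2)[OF Xspan sub] liX by simp
  have "card X \<le> vectorspace.dim class_ring (span_vs (set (cols A)))"
    by (rule vectorspace.li_le_dim(2)[OF vs fd _ li']) (use Xspan in auto)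
  then show ?thesis using Ac by (simp add: cardX I_def[symmetric] rank_def)
qed

lemma char_poly_rdiag_conj:
  assumes U: "unitary n U"
  shows "char_poly (U * rdiag n d * U\<^sup>H) = (\<Prod>i<n. [:- complex_of_real (d i), 1:])"
proof -
  note UD = unitaryD[OF U]
  have "similar_mat (U * rdiag n d * U\<^sup>H) (rdiag n d)"
    unfolding similar_mat_def using UD rdiag_conj_carrier[OF U]
    by (intro exI[of _ U] exI[of _ "U\<^sup>H"] similar_mat_witI[of _ _ n]) auto
  then have "char_poly (U * rdiag n d * U\<^sup>H) = char_poly (rdiag n d)" by (rule char_poly_similar)
  also have "\<dots> = (\<Prod>a\<leftarrow>diag_mat (rdiag n d). [:- a, 1:])"
    by (rule char_poly_upper_triangular[of _ n]) (auto simp: upper_triangular_def)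
  also have "\<dots> = (\<Prod>i<n. [:- complex_of_real (d i), 1:])"
  proof -
    have "diag_mat (rdiag n d) = map (\<lambda>i. complex_of_real (d i)) [0..<n]" by (simp add: diag_mat_def)
    then show ?thesis
      using prod.distinct_set_conv_list[of "[0..<n]" "\<lambda>i. [:- complex_of_real (d i), 1:]"]
      by (simp add: o_def lessThan_atLeast0)
  qed
  finally show ?thesis .
qed

text \<open>This links the ordered list of \<open>K\<close> values to the spectral decomposition.
  List and spectrum differ only by zeros: the decreasing order and the bound on nonzero eigenvalues
  leave nothing but zeros beyond position \<open>K\<close>, and the padding adds zeros; a summand
  with \<open>f 0 = 0\<close> does not notice either.\<close>

lemma sum_largest_eigenvalues:
  fixes f :: "real \<Rightarrow> 'b :: comm_monoid_add"
  assumes U: "unitary n U" and A: "A = U * rdiag n d * U\<^sup>H" and d: "\<And>i. i < n \<Longrightarrow> 0 \<le> d i"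
    and K: "card {i. i < n \<and> d i \<noteq> 0} \<le> K" and f0: "f 0 = 0"
  shows "(\<Sum>j<K. f (largest_eigenvalues K A ! j)) = (\<Sum>i<n. f (d i))"
proof -
  define xs where "xs = rev (sorted_list_of_multiset (image_mset d (mset_set {..<n})))"
  have roots: "proots (char_poly A) = image_mset (\<lambda>i. complex_of_real (d i)) (mset_set {..<n})"
    unfolding A char_poly_rdiag_conj[OF U]
    by (subst proots_prod) (auto simp: sum_unfold_sum_mset)
  have L: "largest_eigenvalues K A = take K (xs @ replicate K 0)"
    unfolding largest_eigenvalues_def roots xs_def by (simp add: multiset.map_comp o_def)
  have mxs: "mset xs = image_mset d (mset_set {..<n})" by (simp add: xs_def)
  have pos: "0 \<le> x" if "x \<in> set xs" for x
  proof -
    have "x \<in># mset xs" using that by simp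
    then show ?thesis unfolding mxs using d by auto
  qed
  have desc: "sorted (rev xs)" by (simp add: xs_def)
  have lenfilter: "length (filter (\<lambda>x. x \<noteq> 0) xs) = card {i. i < n \<and> d i \<noteq> 0}"
  proof -
    have "length (filter (\<lambda>x. x \<noteq> 0) xs) = size (filter_mset (\<lambda>x. x \<noteq> 0) (mset xs))"
      by (metis mset_filter size_mset)
    also have "\<dots> = size (filter_mset (\<lambda>i. d i \<noteq> 0) (mset_set {..<n}))"
      unfolding mxs by (simp add: filter_mset_image_mset)
    also have "\<dots> = card {i. i < n \<and> d i \<noteq> 0}"
      by (simp add: filter_mset_mset_set)
    finally show ?thesis .
  qed
  \<comment> \<open>A positive value beyond position \<open>K\<close> would have \<open>K\<close>
    values at least as large before it, which makes more than \<open>K\<close> nonzero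
    eigenvalues.\<close>
  have tail: "x = 0" if x: "x \<in> set (drop K xs)" for x
  proof (rule ccontr)
    assume "x \<noteq> 0"
    have KL: "K < length xs" using x by (cases "K < length xs") auto
    then have x0: "x > 0" using pos x \<open>x \<noteq> 0\<close> in_set_dropD by (metis less_eq_real_def)
    have "sorted_wrt (\<ge>) xs" using desc by (simp add: sorted_wrt_rev)
    then have "sorted_wrt (\<ge>) (take K xs @ drop K xs)" by simp
    then have "\<And>y. y \<in> set (take K xs) \<Longrightarrow> y \<ge> x" using x unfolding sorted_wrt_append by blast
    then have "filter (\<lambda>x. x \<noteq> 0) (take K xs) = take K xs" using x0 by (intro filter_True) fastforce
    moreover have "filter (\<lambda>x. x \<noteq> 0) (drop K xs) \<noteq> []" using x \<open>x \<noteq> 0\<close> by (auto simp: filter_empty_conv)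
    moreover have "filter (\<lambda>x. x \<noteq> 0) xs = filter (\<lambda>x. x \<noteq> 0) (take K xs) @ filter (\<lambda>x. x \<noteq> 0) (drop K xs)"
      by (metis append_take_drop_id filter_append)
    ultimately have "length (filter (\<lambda>x. x \<noteq> 0) xs) > K" using KL by (cases "filter (\<lambda>x. x \<noteq> 0) (drop K xs)") auto
    then show False using lenfilter K by simp
  qed
  have z: "sum_list (map f ys) = 0" if "\<And>y. y \<in> set ys \<Longrightarrow> y = 0" for ys
  proof -
    show ?thesis using f0 by (intro sum_list_neutral) (metis (no_types, lifting) image_iff list.set_map that)
  qed
  have "length (largest_eigenvalues K A) = K" by (simp add: L)
  then have "(\<Sum>j<K. f (largest_eigenvalues K A ! j)) = sum_list (map f (largest_eigenvalues K A))"
    by (simp add: sum_list_sum_nth atLeast0LessThan)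
  also have "\<dots> = sum_list (map f (take K xs)) + sum_list (map f (take (K - length xs) (replicate K 0)))"
    by (simp add: L)
  also have "sum_list (map f (take (K - length xs) (replicate K 0))) = 0" by (rule z) (auto dest: in_set_takeD)
  also have "sum_list (map f (take K xs)) + 0 = sum_list (map f (take K xs)) + sum_list (map f (drop K xs))"
    using z[OF tail] by simp
  also have "\<dots> = sum_list (map f xs)"
    by (metis append_take_drop_id map_append sum_list_append)
  also have "\<dots> = sum_mset (image_mset f (mset xs))" by (metis mset_map sum_mset_sum_list)
  also have "\<dots> = (\<Sum>i<n. f (d i))" unfolding mxs by (simp add: multiset.map_comp o_def sum_unfold_sum_mset)
  finally show ?thesis .
qed

lemma mtrace_plus:
  assumes "A \<in> carrier_mat n n" "B \<in> carrier_mat n n"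
  shows "mtrace (A + B) = mtrace A + mtrace B"
  using assms by (auto simp: mtrace_def sum.distrib)

lemma mtrace_smult:
  assumes "A \<in> carrier_mat n n"
  shows "mtrace (c \<cdot>\<^sub>m A) = c * mtrace A"
  using assms by (auto simp: mtrace_def sum_distrib_left)

section \<open>Kronecker products\<close>

text \<open>The pair of indices (a, b) is coded as the number a * n + b. Sums over Kronecker indices
  and over stacked vectors are split into double sums by this rule.\<close>

lemma sum_div_mod:
  fixes f :: "nat \<Rightarrow> nat \<Rightarrow> 'b :: comm_monoid_add"
  shows "(\<Sum>k<m * n. f (k div n) (k mod n)) = (\<Sum>a<m. \<Sum>b<n. f a b)"
proof (induction m)
  case (Suc m)
  have "(\<Sum>k<Suc m * n. f (k div n) (k mod n)) = (\<Sum>k<m * n. f (k div n) (k mod n)) + (\<Sum>b<n. f ((m * n + b) div n) ((m * n + b) mod n))"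
    using sum.nat_group[of "\<lambda>k. f (k div n) (k mod n)" n "Suc m"] sum.nat_group[of "\<lambda>k. f (k div n) (k mod n)" n m]
    sum.shift_bounds_nat_ivl[of "\<lambda>k. f (k div n) (k mod n)" 0 "m * n" n]
    by (simp add: atLeast0LessThan add.commute)
  then show ?case using Suc by simp
qed simp

lemma div_mod_less:
  fixes k m n :: nat
  assumes "k < m * n"
  shows "k div n < m" "k mod n < n"
  using assms by (auto simp: less_mult_imp_div_less) (metis mod_less_divisor mult_0_right not_gr_zero not_less_zero)

lemma dim_kronecker [simp]:
  "dim_row (A \<otimes>\<^sub>K B) = dim_row A * dim_row B" "dim_col (A \<otimes>\<^sub>K B) = dim_col A * dim_col B"
  by (simp_all add: kronecker_def)

lemma kronecker_carrier [simp, intro]: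
  assumes "A \<in> carrier_mat l m" "B \<in> carrier_mat p q"
  shows "A \<otimes>\<^sub>K B \<in> carrier_mat (l * p) (m * q)"
  using assms by (intro carrier_matI) auto

lemma index_kronecker:
  assumes "A \<in> carrier_mat l m" "B \<in> carrier_mat p q" "i < l * p" "j < m * q"
  shows "(A \<otimes>\<^sub>K B) $$ (i, j) = A $$ (i div p, j div q) * B $$ (i mod p, j mod q)"
  using assms by (auto simp: kronecker_def)

lemma kronecker_mult:
  assumes A: "A \<in> carrier_mat l m" and B: "B \<in> carrier_mat p q"
    and C: "C \<in> carrier_mat m r" and D: "D \<in> carrier_mat q s"
  shows "(A \<otimes>\<^sub>K B) * (C \<otimes>\<^sub>K D) = (A * C) \<otimes>\<^sub>K (B * D)"
proof (rule eq_matI)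
  have AC: "A * C \<in> carrier_mat l r" and BD: "B * D \<in> carrier_mat p s" using assms by auto
  fix i j assume "i < dim_row ((A * C) \<otimes>\<^sub>K (B * D))" "j < dim_col ((A * C) \<otimes>\<^sub>K (B * D))"
  then have ij: "i < l * p" "j < r * s" using assms by auto
  note d = div_mod_less[OF ij(1)] div_mod_less[OF ij(2)]
  have "((A \<otimes>\<^sub>K B) * (C \<otimes>\<^sub>K D)) $$ (i, j) = (\<Sum>k<m * q. (A $$ (i div p, k div q) * B $$ (i mod p, k mod q)) * (C $$ (k div q, j div s) * D $$ (k mod q, j mod s)))"
    using index_mult_sum[OF kronecker_carrier[OF A B] kronecker_carrier[OF C D] ij]
    by (simp add: index_kronecker[OF A B ij(1)] index_kronecker[OF C D _ ij(2)] del: index_mult_mat(1))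
  also have "\<dots> = (\<Sum>a<m. \<Sum>b<q. (A $$ (i div p, a) * B $$ (i mod p, b)) * (C $$ (a, j div s) * D $$ (b, j mod s)))"
    by (rule sum_div_mod)
  also have "\<dots> = (\<Sum>a<m. A $$ (i div p, a) * C $$ (a, j div s)) * (\<Sum>b<q. B $$ (i mod p, b) * D $$ (b, j mod s))"
    by (simp add: sum_product mult_ac)
  also have "\<dots> = ((A * C) \<otimes>\<^sub>K (B * D)) $$ (i, j)"
    unfolding index_kronecker[OF AC BD ij] using d
    by (simp add: index_mult_sum[OF A C] index_mult_sum[OF B D] del: index_mult_mat(1))
  finally show "((A \<otimes>\<^sub>K B) * (C \<otimes>\<^sub>K D)) $$ (i, j) = ((A * C) \<otimes>\<^sub>K (B * D)) $$ (i, j)" .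
qed (use assms in auto)

lemma adjoint_kronecker: "(A \<otimes>\<^sub>K B)\<^sup>H = A\<^sup>H \<otimes>\<^sub>K B\<^sup>H"
proof (rule eq_matI)
  fix i j assume "i < dim_row (A\<^sup>H \<otimes>\<^sub>K B\<^sup>H)" "j < dim_col (A\<^sup>H \<otimes>\<^sub>K B\<^sup>H)"
  then have ij: "i < dim_col A * dim_col B" "j < dim_row A * dim_row B" by auto
  then show "(A \<otimes>\<^sub>K B)\<^sup>H $$ (i, j) = (A\<^sup>H \<otimes>\<^sub>K B\<^sup>H) $$ (i, j)"
    using div_mod_less[OF ij(1)] div_mod_less[OF ij(2)] by (simp add: kronecker_def)
qed auto

lemma kronecker_one: "1\<^sub>m m \<otimes>\<^sub>K 1\<^sub>m n = 1\<^sub>m (m * n)"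
proof (rule eq_matI)
  fix i j assume "i < dim_row (1\<^sub>m (m * n) :: complex mat)" "j < dim_col (1\<^sub>m (m * n) :: complex mat)"
  then have ij: "i < m * n" "j < m * n" by auto
  show "(1\<^sub>m m \<otimes>\<^sub>K 1\<^sub>m n) $$ (i, j) = 1\<^sub>m (m * n) $$ (i, j)"
    using ij div_mod_less[OF ij(1)] div_mod_less[OF ij(2)]
    by (simp add: index_kronecker[of _ m m _ n n]) (metis div_mult_mod_eq)
qed auto

text \<open>The Kronecker product of the square roots is a Gram factor.\<close>

lemma psd_kronecker:
  assumes "psd m A" "psd n B"
  shows "psd (m * n) (A \<otimes>\<^sub>K B)"
proof -
  let ?a = "psd_sqrt A" and ?b = "psd_sqrt B"
  have a: "?a \<in> carrier_mat m m" "?a\<^sup>H = ?a" "?a * ?a = A" and b: "?b \<in> carrier_mat n n" "?b\<^sup>H = ?b" "?b * ?b = B"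
    using psd_sqrt[OF assms(1)] psd_sqrt[OF assms(2)] by (auto simp: psd_def)
  have "(?a \<otimes>\<^sub>K ?b)\<^sup>H * (?a \<otimes>\<^sub>K ?b) = A \<otimes>\<^sub>K B"
    unfolding adjoint_kronecker a(2) b(2) kronecker_mult[OF a(1) b(1) a(1) b(1)] a(3) b(3) ..
  then show ?thesis using psd_gram[OF kronecker_carrier[OF a(1) b(1)]] by metis
qed

text \<open>In the coding of Kronecker indices the quotient by \<open>n\<close> is the block number
  and the remainder the position in the block, so \<open>rdiag m r \<otimes>\<^sub>K Q\<close> is of
  this form and its resolvent is computed block by block.\<close>

definition block_diag :: "nat \<Rightarrow> nat \<Rightarrow> (nat \<Rightarrow> complex mat) \<Rightarrow> complex mat" where
  "block_diag m n Z = Matrix.mat (m * n) (m * n)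
     (\<lambda>(p, q). if p div n = q div n then Z (p div n) $$ (p mod n, q mod n) else 0)"

lemma block_diag_carrier [simp, intro]: "block_diag m n Z \<in> carrier_mat (m * n) (m * n)"
  by (simp add: block_diag_def)

lemma index_block_diag:
  assumes "p < m * n" "q < m * n"
  shows "block_diag m n Z $$ (p, q) = (if p div n = q div n then Z (p div n) $$ (p mod n, q mod n) else 0)"
  using assms by (simp add: block_diag_def)

lemma block_diag_mult:
  assumes Z: "\<And>j. j < m \<Longrightarrow> Z j \<in> carrier_mat n n" and Y: "\<And>j. j < m \<Longrightarrow> Y j \<in> carrier_mat n n"
  shows "block_diag m n Z * block_diag m n Y = block_diag m n (\<lambda>j. Z j * Y j)"
proof (rule eq_matI)
  fix p q assume "p < dim_row (block_diag m n (\<lambda>j. Z j * Y j))" "q < dim_col (block_diag m n (\<lambda>j. Z j * Y j))"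
  then have pq: "p < m * n" "q < m * n" by (auto simp: block_diag_def)
  note d = div_mod_less[OF pq(1)] div_mod_less[OF pq(2)]
  have "(block_diag m n Z * block_diag m n Y) $$ (p, q) =
      (\<Sum>k<m * n. (if p div n = k div n then Z (p div n) $$ (p mod n, k mod n) else 0) * (if k div n = q div n then Y (k div n) $$ (k mod n, q mod n) else 0))"
    unfolding index_mult_sum[OF block_diag_carrier block_diag_carrier pq]
    by (intro sum.cong refl) (simp add: index_block_diag pq)
  also have "\<dots> = (\<Sum>a<m. \<Sum>b<n. (if p div n = a then Z (p div n) $$ (p mod n, b) else 0) * (if a = q div n then Y a $$ (b, q mod n) else 0))"
    by (rule sum_div_mod)
  also have "\<dots> = (\<Sum>a<m. if a = p div n then (if a = q div n then (\<Sum>b<n. Z (p div n) $$ (p mod n, b) * Y a $$ (b, q mod n)) else 0) else 0)"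
    by (intro sum.cong) auto
  also have "\<dots> = (if p div n = q div n then (\<Sum>b<n. Z (p div n) $$ (p mod n, b) * Y (p div n) $$ (b, q mod n)) else 0)"
    using d by simp
  also have "\<dots> = block_diag m n (\<lambda>j. Z j * Y j) $$ (p, q)"
    unfolding index_block_diag[OF pq] using d
    by (auto simp: index_mult_sum[OF Z[OF d(3)] Y[OF d(3)] d(2) d(4)] simp del: index_mult_mat(1))
  finally show "(block_diag m n Z * block_diag m n Y) $$ (p, q) = block_diag m n (\<lambda>j. Z j * Y j) $$ (p, q)" .
qed (auto simp: block_diag_def)

lemma mtrace_block_diag:
  assumes "\<And>j. j < m \<Longrightarrow> Z j \<in> carrier_mat n n"
  shows "mtrace (block_diag m n Z) = (\<Sum>j<m. mtrace (Z j))"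
proof -
  have "mtrace (block_diag m n Z) = (\<Sum>p<m * n. Z (p div n) $$ (p mod n, p mod n))"
    unfolding mtrace_def by (intro sum.cong) (auto simp: block_diag_def)
  also have "\<dots> = (\<Sum>a<m. \<Sum>b<n. Z a $$ (b, b))" by (rule sum_div_mod)
  also have "\<dots> = (\<Sum>j<m. mtrace (Z j))"
    by (intro sum.cong refl) (use assms carrier_matD in \<open>fastforce simp: mtrace_def\<close>)
  finally show ?thesis .
qed

lemma kronecker_rdiag:
  assumes "Q \<in> carrier_mat n n"
  shows "rdiag m r \<otimes>\<^sub>K Q = block_diag m n (\<lambda>j. complex_of_real (r j) \<cdot>\<^sub>m Q)"
proof (rule eq_matI)
  fix p q assume "p < dim_row (block_diag m n (\<lambda>j. complex_of_real (r j) \<cdot>\<^sub>m Q))" "q < dim_col (block_diag m n (\<lambda>j. complex_of_real (r j) \<cdot>\<^sub>m Q))"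
  then have pq: "p < m * n" "q < m * n" by (auto simp: block_diag_def)
  show "(rdiag m r \<otimes>\<^sub>K Q) $$ (p, q) = block_diag m n (\<lambda>j. complex_of_real (r j) \<cdot>\<^sub>m Q) $$ (p, q)"
    using pq assms div_mod_less[OF pq(1)] div_mod_less[OF pq(2)]
    by (simp add: index_kronecker[of _ m m _ n n] index_block_diag)
qed (use assms in \<open>auto simp: block_diag_def\<close>)

lemma block_diag_one_plus:
  assumes "\<And>j. j < m \<Longrightarrow> Z j \<in> carrier_mat n n"
  shows "1\<^sub>m (m * n) + c \<cdot>\<^sub>m block_diag m n Z = block_diag m n (\<lambda>j. 1\<^sub>m n + c \<cdot>\<^sub>m Z j)"
proof (rule eq_matI)
  fix p q assume "p < dim_row (block_diag m n (\<lambda>j. 1\<^sub>m n + c \<cdot>\<^sub>m Z j))" "q < dim_col (block_diag m n (\<lambda>j. 1\<^sub>m n + c \<cdot>\<^sub>m Z j))"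
  then have pq: "p < m * n" "q < m * n" by (auto simp: block_diag_def)
  note d = div_mod_less[OF pq(1)] div_mod_less[OF pq(2)]
  have "p = q \<longleftrightarrow> p div n = q div n \<and> p mod n = q mod n" by (metis div_mult_mod_eq)
  then show "(1\<^sub>m (m * n) + c \<cdot>\<^sub>m block_diag m n Z) $$ (p, q) = block_diag m n (\<lambda>j. 1\<^sub>m n + c \<cdot>\<^sub>m Z j) $$ (p, q)"
    using pq d assms[OF d(1)] carrier_matD[OF block_diag_carrier[of m n Z]] by (auto simp: index_block_diag)
qed (auto simp: block_diag_def)

text \<open>Only the left factor is diagonalised, by conjugation with
  \<open>U \<otimes>\<^sub>K 1\<^sub>m n\<close>. \<open>B\<close> and \<open>Q\<close> need not
  commute, so they stay as they are; the large matrix becomes block diagonal with one resolvent of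
  \<open>Q\<close> per eigenvalue \<open>r j\<close>, and the factor \<open>A\<close> in front
  contributes the weight \<open>r j\<close>.\<close>

theorem mtrace_kronecker_resolvent:
  assumes U: "unitary m U" and A: "A = U * rdiag m r * U\<^sup>H" and r: "\<And>j. j < m \<Longrightarrow> 0 \<le> r j"
    and B: "B \<in> carrier_mat n n" and Q: "psd n Q" and c: "0 \<le> c"
  shows "mtrace ((A \<otimes>\<^sub>K B) * minv (1\<^sub>m (m * n) + complex_of_real c \<cdot>\<^sub>m (A \<otimes>\<^sub>K Q))) =
    (\<Sum>j<m. complex_of_real (r j) * mtrace (B * minv (1\<^sub>m n + complex_of_real (c * r j) \<cdot>\<^sub>m Q)))"
proof -
  note UD = unitaryD[OF U]
  have Qc: "Q \<in> carrier_mat n n" using Q by (simp add: psd_def)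
  define W where "W = U \<otimes>\<^sub>K 1\<^sub>m n"
  have WH: "W\<^sup>H = U\<^sup>H \<otimes>\<^sub>K 1\<^sub>m n" by (simp add: W_def adjoint_kronecker)
  have Wc: "W \<in> carrier_mat (m * n) (m * n)" using UD by (auto simp: W_def)
  have W: "unitary (m * n) W"
    unfolding unitary_def WH using Wc UD
    by (simp add: W_def kronecker_mult[of _ m m _ n n _ m _ n] kronecker_one)
  have AX: "A \<otimes>\<^sub>K X = W * (rdiag m r \<otimes>\<^sub>K X) * W\<^sup>H" if X: "X \<in> carrier_mat n n" for X
    unfolding WH unfolding W_def A using UD(1,2) X
    by (simp add: kronecker_mult[of _ m m _ n n _ m _ n] mult_carrier_mat[of _ m m _ m])
  define Z where "Z = (\<lambda>j. minv (1\<^sub>m n + complex_of_real (c * r j) \<cdot>\<^sub>m Q))"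
  have Z: "Z j \<in> carrier_mat n n" "(1\<^sub>m n + complex_of_real (c * r j) \<cdot>\<^sub>m Q) * Z j = 1\<^sub>m n" if "j < m" for j
    using resolvent_psd[OF Q, of "c * r j"] r[OF that] c by (simp_all add: Z_def)
  have s: "complex_of_real c \<cdot>\<^sub>m (complex_of_real (r j) \<cdot>\<^sub>m Q) = complex_of_real (c * r j) \<cdot>\<^sub>m Q" for j
    by (rule eq_matI) (use Qc in auto)
  have I: "1\<^sub>m (m * n) + complex_of_real c \<cdot>\<^sub>m (A \<otimes>\<^sub>K Q) = W * block_diag m n (\<lambda>j. 1\<^sub>m n + complex_of_real (c * r j) \<cdot>\<^sub>m Q) * W\<^sup>H"
  proof -
    have "1\<^sub>m (m * n) + complex_of_real c \<cdot>\<^sub>m (A \<otimes>\<^sub>K Q) =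
        W * (1\<^sub>m (m * n) + complex_of_real c \<cdot>\<^sub>m block_diag m n (\<lambda>j. complex_of_real (r j) \<cdot>\<^sub>m Q)) * W\<^sup>H"
      unfolding AX[OF Qc] kronecker_rdiag[OF Qc]
      using unitary_conj_plus[OF W one_carrier_mat smult_carrier_mat[OF block_diag_carrier]]
        unitary_conj_smult[OF W block_diag_carrier] unitary_conj_one[OF W] by simp
    also have "1\<^sub>m (m * n) + complex_of_real c \<cdot>\<^sub>m block_diag m n (\<lambda>j. complex_of_real (r j) \<cdot>\<^sub>m Q) =
        block_diag m n (\<lambda>j. 1\<^sub>m n + complex_of_real c \<cdot>\<^sub>m (complex_of_real (r j) \<cdot>\<^sub>m Q))"
      using Qc by (intro block_diag_one_plus) simp
    finally show ?thesis unfolding s .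
  qed
  have one: "block_diag m n (\<lambda>j. 1\<^sub>m n) = 1\<^sub>m (m * n)"
    by (intro eq_matI; auto simp: block_diag_def div_mod_less; metis div_mult_mod_eq)
  have bd: "block_diag m n (\<lambda>j. (1\<^sub>m n + complex_of_real (c * r j) \<cdot>\<^sub>m Q) * Z j) = block_diag m n (\<lambda>j. 1\<^sub>m n)"
    by (rule eq_matI) (use Z(2) div_mod_less in \<open>auto simp: block_diag_def simp del: index_mult_mat(1)\<close>)
  have e: "block_diag m n (\<lambda>j. 1\<^sub>m n + complex_of_real (c * r j) \<cdot>\<^sub>m Q) * block_diag m n Z = 1\<^sub>m (m * n)"
    unfolding one[symmetric] bd[symmetric] by (rule block_diag_mult) (use Qc Z(1) in auto)
  \<comment> \<open>The inverse is assembled from the inverses of the blocks and verified by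
    multiplication.\<close>
  have inv: "minv (1\<^sub>m (m * n) + complex_of_real c \<cdot>\<^sub>m (A \<otimes>\<^sub>K Q)) = W * block_diag m n Z * W\<^sup>H"
  proof (rule minv_eqI)
    show "1\<^sub>m (m * n) + complex_of_real c \<cdot>\<^sub>m (A \<otimes>\<^sub>K Q) \<in> carrier_mat (m * n) (m * n)"
      using kronecker_carrier[OF rdiag_conj_carrier[OF U] Qc] by (simp add: A)
    show "W * block_diag m n Z * W\<^sup>H \<in> carrier_mat (m * n) (m * n)"
      using Wc by (auto intro!: mult_carrier_mat[of _ "m * n" "m * n" _ "m * n"])
    show "(1\<^sub>m (m * n) + complex_of_real c \<cdot>\<^sub>m (A \<otimes>\<^sub>K Q)) * (W * block_diag m n Z * W\<^sup>H) = 1\<^sub>m (m * n)"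
      unfolding I unitary_conj_mult[OF W block_diag_carrier block_diag_carrier]
        e unitary_conj_one[OF W] ..
  qed
  have "(A \<otimes>\<^sub>K B) * minv (1\<^sub>m (m * n) + complex_of_real c \<cdot>\<^sub>m (A \<otimes>\<^sub>K Q)) =
      W * block_diag m n (\<lambda>j. (complex_of_real (r j) \<cdot>\<^sub>m B) * Z j) * W\<^sup>H"
    unfolding inv AX[OF B] kronecker_rdiag[OF B] unitary_conj_mult[OF W block_diag_carrier block_diag_carrier]
    using B Z(1) by (subst block_diag_mult) auto
  then have "mtrace ((A \<otimes>\<^sub>K B) * minv (1\<^sub>m (m * n) + complex_of_real c \<cdot>\<^sub>m (A \<otimes>\<^sub>K Q))) =
      (\<Sum>j<m. mtrace ((complex_of_real (r j) \<cdot>\<^sub>m B) * Z j))"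
    using B Z(1) mtrace_block_diag[of m "\<lambda>j. (complex_of_real (r j) \<cdot>\<^sub>m B) * Z j" n]
    by (simp add: mtrace_unitary_conj[OF W block_diag_carrier] mult_carrier_mat[of _ n n _ n])
  also have "\<dots> = (\<Sum>j<m. complex_of_real (r j) * mtrace (B * Z j))"
  proof (intro sum.cong refl)
    fix j assume "j \<in> {..<m}"
    then have "(complex_of_real (r j) \<cdot>\<^sub>m B) * Z j = complex_of_real (r j) \<cdot>\<^sub>m (B * Z j)"
      using mult_smult_assoc_mat[OF B Z(1)] by simp
    then show "mtrace ((complex_of_real (r j) \<cdot>\<^sub>m B) * Z j) = complex_of_real (r j) * mtrace (B * Z j)"
      using mtrace_smult[OF mult_carrier_mat[OF B Z(1)]] \<open>j \<in> {..<m}\<close> by simp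
  qed
  finally show ?thesis by (simp add: Z_def)
qed

section \<open>The linear minimum mean square error\<close>

text \<open>This is the Hilbert-Schmidt inner product. Written over entries, it lets expansions of
  quadratic expressions be checked entry by entry.\<close>

lemma mtrace_mult_adjoint:
  assumes "X \<in> carrier_mat m n" "Y \<in> carrier_mat m n"
  shows "mtrace (X * Y\<^sup>H) = (\<Sum>i<m. \<Sum>j<n. X $$ (i, j) * cnj (Y $$ (i, j)))"
  unfolding mtrace_def using assms
  by (intro sum.cong) (auto simp: index_mult_sum[of _ m n _ m] simp del: index_mult_mat(1))

lemma mtrace_mult_adjoint_self:
  assumes "X \<in> carrier_mat m n"
  shows "mtrace (X * X\<^sup>H) = complex_of_real (\<Sum>i<m. \<Sum>j<n. (cmod (X $$ (i, j)))\<^sup>2)"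
  unfolding mtrace_mult_adjoint[OF assms assms] by (simp only: of_real_sum complex_norm_square)

lemma minv_adjoint:
  fixes A :: "complex mat"
  assumes A: "A \<in> carrier_mat n n" "A\<^sup>H = A" and Z: "Z \<in> carrier_mat n n" "A * Z = 1\<^sub>m n"
  shows "Z\<^sup>H = Z"
proof -
  have ZA: "Z * A = 1\<^sub>m n" using mat_mult_left_right_inverse[OF A(1) Z] .
  have "A * Z\<^sup>H = (Z * A)\<^sup>H" using A adjoint_mult[OF Z(1) A(1)] by simp
  then have "A * Z\<^sup>H = 1\<^sub>m n" by (simp add: ZA)
  then have "Z * (A * Z\<^sup>H) = Z" using Z by simp
  then show ?thesis using assoc_mult_mat[OF Z(1) A(1) adjoint_carrier[OF Z(1)]] ZA Z by simp
qed

text \<open>Completing the square around the optimal filter \<open>W0\<close>.\<close>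

lemma mse_decomposition:
  fixes B G W Z :: "complex mat"
  assumes B: "B \<in> carrier_mat d d" and G: "G \<in> carrier_mat m d" and W: "W \<in> carrier_mat d m"
    and s: "0 < s" and Z: "Z \<in> carrier_mat d d"
    and ZI: "(1\<^sub>m d + complex_of_real (1 / s) \<cdot>\<^sub>m ((G * B)\<^sup>H * (G * B))) * Z = 1\<^sub>m d"
  defines "E \<equiv> (1\<^sub>m d - W * G) * B"
    and "W0 \<equiv> complex_of_real (1 / s) \<cdot>\<^sub>m (B * Z * (G * B)\<^sup>H)"
  shows "mtrace (E * E\<^sup>H) + complex_of_real s * mtrace (W * W\<^sup>H) =
    mtrace (B * Z * B\<^sup>H) + mtrace (((W - W0) * (G * B)) * ((W - W0) * (G * B))\<^sup>H)
      + complex_of_real s * mtrace ((W - W0) * (W - W0)\<^sup>H)"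
proof -
  let ?c = "complex_of_real (1 / s)"
  define Q where "Q = G * B"
  define S where "S = Q\<^sup>H * Q"
  define A where "A = 1\<^sub>m d + ?c \<cdot>\<^sub>m S"
  define X where "X = B * Z"
  define D where "D = W - W0"
  have Q: "Q \<in> carrier_mat m d" using B G by (auto simp: Q_def)
  have S: "S \<in> carrier_mat d d" using Q by (auto simp: S_def)
  have A: "A \<in> carrier_mat d d" using S by (auto simp: A_def)
  have X: "X \<in> carrier_mat d d" using B Z by (auto simp: X_def)
  have XQ: "X * Q\<^sup>H \<in> carrier_mat d m" using X Q by auto
  have W0: "W0 \<in> carrier_mat d m" using XQ by (simp add: W0_def X_def Q_def)
  have D: "D \<in> carrier_mat d m" using minus_carrier_mat[OF W0] by (simp add: D_def)
  have DQ: "D * Q \<in> carrier_mat d d" using D Q by auto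
  have AZ: "A * Z = 1\<^sub>m d" using ZI by (simp add: A_def S_def Q_def)
  then have ZA: "Z * A = 1\<^sub>m d" using mat_mult_left_right_inverse[OF A Z] by simp
  have "S\<^sup>H = S" using Q by (simp add: S_def adjoint_mult[of _ d m _ d])
  then have hermA: "A\<^sup>H = A" using S by (simp add: A_def adjoint_plus[of _ d d] adjoint_smult)
  have hermZ: "Z\<^sup>H = Z" by (rule minv_adjoint[OF A hermA Z AZ])
  have BXA: "B = X * A" using assoc_mult_mat[OF B Z A] ZA B by (simp add: X_def)
  have XA: "X * A = X + ?c \<cdot>\<^sub>m (X * S)"
    unfolding A_def using X S by (simp add: mult_add_distrib_mat[of _ d d _ d] mult_smult_distrib[of _ d d _ d])
  have XS: "X * S = (X * Q\<^sup>H) * Q" using X Q by (simp add: S_def assoc_mult_mat[of _ d d _ m _ d])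
  \<comment> \<open>With \<open>W0\<close> itself the error matrix is \<open>X\<close>, so a
    deviation \<open>D\<close> from \<open>W0\<close> changes it by \<open>- D * Q\<close>.\<close>
  have E: "E = X - D * Q"
  proof -
    have "E = B - W * Q"
      unfolding E_def Q_def using B G W by (simp add: minus_mult_distrib_mat[of _ d d _ _ d] assoc_mult_mat[of _ d m _ d _ d])
    also have "W * Q = W0 * Q + D * Q"
    proof -
      have "W = W0 + D" using W W0 by (auto simp: D_def)
      then show ?thesis using add_mult_distrib_mat[OF W0 D Q] by simp
    qed
    also have "W0 * Q = ?c \<cdot>\<^sub>m (X * S)"
      unfolding XS W0_def X_def[symmetric] Q_def[symmetric] by (rule mult_smult_assoc_mat[OF XQ Q])
    also have "B = X + ?c \<cdot>\<^sub>m (X * S)" using BXA XA by simp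
    also have "X + ?c \<cdot>\<^sub>m (X * S) - (?c \<cdot>\<^sub>m (X * S) + D * Q) = X - D * Q"
    proof -
      have "X + Y - (Y + Y') = X - Y'" if "Y \<in> carrier_mat d d" "Y' \<in> carrier_mat d d" for Y Y'
        using X that by (intro eq_matI) auto
      then show ?thesis using X S DQ by (simp add: mult_carrier_mat[of _ d d _ d])
    qed
    finally show ?thesis .
  qed
  \<comment> \<open>The mixed terms in \<open>X\<close> and \<open>D\<close> come with a minus sign
    from the error and with a plus sign from the noise. They cancel; this is the stationarity of
    \<open>W0\<close>.\<close>
  have cross: "mtrace ((D * Q) * X\<^sup>H) = mtrace (D * (X * Q\<^sup>H)\<^sup>H)"
    using D Q X by (simp add: adjoint_mult[of _ d d _ m] assoc_mult_mat[of _ d m _ d _ d])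
  have cross': "mtrace (X * (D * Q)\<^sup>H) = mtrace ((X * Q\<^sup>H) * D\<^sup>H)"
    using D Q X by (simp add: adjoint_mult[of _ d m _ d] assoc_mult_mat[of _ d d _ m _ d])
  have "mtrace (E * E\<^sup>H) = mtrace (X * X\<^sup>H) + mtrace ((D * Q) * (D * Q)\<^sup>H) - mtrace (X * (D * Q)\<^sup>H) - mtrace ((D * Q) * X\<^sup>H)"
    unfolding E mtrace_mult_adjoint[OF minus_carrier_mat[OF DQ] minus_carrier_mat[OF DQ]] mtrace_mult_adjoint[OF X X]
      mtrace_mult_adjoint[OF X DQ] mtrace_mult_adjoint[OF DQ X] mtrace_mult_adjoint[OF DQ DQ] sum_subtractf[symmetric] sum.distrib[symmetric]
    by (intro sum.cong refl) (use X D Q in \<open>simp add: algebra_simps del: index_mult_mat(1)\<close>)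
  moreover have "complex_of_real s * mtrace (W * W\<^sup>H) = ?c * mtrace ((X * Q\<^sup>H) * (X * Q\<^sup>H)\<^sup>H) + mtrace ((X * Q\<^sup>H) * D\<^sup>H)
      + mtrace (D * (X * Q\<^sup>H)\<^sup>H) + complex_of_real s * mtrace (D * D\<^sup>H)"
  proof -
    have Wd: "W $$ (i, j) = ?c * (X * Q\<^sup>H) $$ (i, j) + D $$ (i, j)" if "i < d" "j < m" for i j
      using W X Q that unfolding D_def W0_def X_def[symmetric] Q_def[symmetric] by (simp del: index_mult_mat(1))
    have "complex_of_real s * mtrace (W * W\<^sup>H) =
      (\<Sum>i<d. \<Sum>j<m. complex_of_real s * ((?c * (X * Q\<^sup>H) $$ (i, j) + D $$ (i, j)) * cnj (?c * (X * Q\<^sup>H) $$ (i, j) + D $$ (i, j))))"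
      unfolding mtrace_mult_adjoint[OF W W] sum_distrib_left by (intro sum.cong refl) (simp add: Wd del: index_mult_mat(1))
    also have "\<dots> = (\<Sum>i<d. \<Sum>j<m. ?c * ((X * Q\<^sup>H) $$ (i, j) * cnj ((X * Q\<^sup>H) $$ (i, j))) + (X * Q\<^sup>H) $$ (i, j) * cnj (D $$ (i, j))
        + D $$ (i, j) * cnj ((X * Q\<^sup>H) $$ (i, j)) + complex_of_real s * (D $$ (i, j) * cnj (D $$ (i, j))))"
      using s by (intro sum.cong refl) (simp add: field_simps del: index_mult_mat(1))
    finally show ?thesis
      unfolding mtrace_mult_adjoint[OF XQ XQ] mtrace_mult_adjoint[OF XQ D] mtrace_mult_adjoint[OF D XQ] mtrace_mult_adjoint[OF D D]
      by (simp only: sum.distrib sum_distrib_left)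
  qed
  \<comment> \<open>What remains without \<open>D\<close> collapses because X + X S / s = X A =
    B.\<close>
  moreover have "mtrace (X * X\<^sup>H) + ?c * mtrace ((X * Q\<^sup>H) * (X * Q\<^sup>H)\<^sup>H) = mtrace (B * Z * B\<^sup>H)"
  proof -
    have XH: "X\<^sup>H = Z * B\<^sup>H" using B Z by (simp add: X_def adjoint_mult[of _ d d _ d] hermZ)
    have "(X * Q\<^sup>H) * (X * Q\<^sup>H)\<^sup>H = (X * S) * X\<^sup>H"
      using X Q by (simp add: S_def adjoint_mult[of _ d d _ m] assoc_mult_mat[of _ d d _ m _ d]
          assoc_mult_mat[of _ d m _ d _ d] assoc_mult_mat[of _ d d _ d _ d] mult_carrier_mat[of _ d m _ d])
    then have "mtrace (X * X\<^sup>H) + ?c * mtrace ((X * Q\<^sup>H) * (X * Q\<^sup>H)\<^sup>H) = mtrace (X * X\<^sup>H + (?c \<cdot>\<^sub>m (X * S)) * X\<^sup>H)"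
      using X S by (simp add: mtrace_plus[of _ d] mtrace_smult[of _ d] mult_smult_assoc_mat[of _ d d _ d] mult_carrier_mat[of _ d d _ d])
    also have "X * X\<^sup>H + (?c \<cdot>\<^sub>m (X * S)) * X\<^sup>H = B * X\<^sup>H"
      unfolding BXA XA using X S by (simp add: add_mult_distrib_mat[of _ d d _ _ d] mult_carrier_mat[of _ d d _ d])
    also have "\<dots> = B * Z * B\<^sup>H" unfolding XH using B Z by (simp add: assoc_mult_mat[of _ d d _ d _ d])
    finally show ?thesis .
  qed
  moreover have "e + w = t + q + sd"
    if "e = x + q - a - b" "w = cx + a + b + sd" "x + cx = t" for e x q a b w cx sd t :: complex
    using that(3)[symmetric] that(1,2) by (simp add: algebra_simps)
  ultimately show ?thesis
    unfolding cross cross' D_def[symmetric] Q_def[symmetric] by blast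
qed

text \<open>Uncorrelated noise splits the mean square error of a filter into an error part and a
  noise part, so \<open>mse_decomposition\<close> applies: two squares are added to a constant, and
  both vanish at \<open>W0\<close>. The second moments of \<open>h\<close> are assumed for linear
  functionals, because these are what \<open>cgauss_vec\<close> describes.\<close>

lemma lmmse_closed_form:
  fixes B G :: "complex mat" and h w y :: "'a \<Rightarrow> complex vec"
  assumes h: "\<And>\<omega>. \<omega> \<in> space M \<Longrightarrow> h \<omega> \<in> carrier_vec d" and w: "\<And>\<omega>. \<omega> \<in> space M \<Longrightarrow> w \<omega> \<in> carrier_vec m"
    and y: "\<And>\<omega>. \<omega> \<in> space M \<Longrightarrow> y \<omega> = G *\<^sub>v h \<omega> + w \<omega>"
    and B: "B \<in> carrier_mat d d" "B\<^sup>H = B" and G: "G \<in> carrier_mat m d" and s: "0 < s"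
    and hh: "\<And>a. a \<in> carrier_vec d \<Longrightarrow> has_bochner_integral M (\<lambda>\<omega>. (cmod (h \<omega> \<bullet>c a))\<^sup>2) (Re (((B * B) *\<^sub>v a) \<bullet>c a))"
    and ww: "\<And>k l. k < m \<Longrightarrow> l < m \<Longrightarrow> has_bochner_integral M (\<lambda>\<omega>. w \<omega> $ k * cnj (w \<omega> $ l)) (if k = l then complex_of_real s else 0)"
    and hw: "\<And>k l. k < d \<Longrightarrow> l < m \<Longrightarrow> has_bochner_integral M (\<lambda>\<omega>. h \<omega> $ k * cnj (w \<omega> $ l)) 0"
  shows "complex_of_real (lmmse M d m h y) = mtrace ((B * B) * minv (1\<^sub>m d + complex_of_real (1 / s) \<cdot>\<^sub>m ((G * B)\<^sup>H * (G * B))))"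
proof -
  define Z where "Z = minv (1\<^sub>m d + complex_of_real (1 / s) \<cdot>\<^sub>m ((G * B)\<^sup>H * (G * B)))"
  have Q: "G * B \<in> carrier_mat m d" using G B by auto
  have Z: "Z \<in> carrier_mat d d" "(1\<^sub>m d + complex_of_real (1 / s) \<cdot>\<^sub>m ((G * B)\<^sup>H * (G * B))) * Z = 1\<^sub>m d"
    using resolvent_psd[OF psd_gram[OF Q], of "1 / s"] s by (simp_all add: Z_def)
  define W0 where "W0 = complex_of_real (1 / s) \<cdot>\<^sub>m (B * Z * (G * B)\<^sup>H)"
  have W0: "W0 \<in> carrier_mat d m" using B Z Q by (simp add: W0_def mult_carrier_mat[of _ d d _ d] mult_carrier_mat[of _ d d _ m])
  define f where "f = (\<lambda>W. LINT \<omega>|M. (\<Sum>i<d. (cmod ((h \<omega> - W *\<^sub>v y \<omega>) $ i))\<^sup>2))"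
  have mse: "complex_of_real (f W) = mtrace (((1\<^sub>m d - W * G) * B) * ((1\<^sub>m d - W * G) * B)\<^sup>H) + complex_of_real s * mtrace (W * W\<^sup>H)"
    if W: "W \<in> carrier_mat d m" for W
  proof -
    define A where "A = 1\<^sub>m d - W * G"
    have A: "A \<in> carrier_mat d d" using W G by (simp add: A_def mult_carrier_mat[of _ d m _ d] minus_carrier_mat)
    \<comment> \<open>Conjugated row i of \<open>A\<close>, so that coordinate i of
      \<open>A *\<^sub>v h \<omega>\<close> is the functional
      \<open>h \<omega> \<bullet>c a i\<close> covered by the assumption \<open>hh\<close>.\<close>
    define a where "a i = Matrix.vec d (\<lambda>k. cnj (A $$ (i, k)))" for i
    have ac: "a i \<in> carrier_vec d" for i by (simp add: a_def)
    define v where "v i \<omega> = (\<Sum>l<m. W $$ (i, l) * w \<omega> $ l)" for i \<omega>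
    have u_sum: "h \<omega> \<bullet>c a i = (\<Sum>k<d. A $$ (i, k) * h \<omega> $ k)" if "\<omega> \<in> space M" for i \<omega>
      using cscalar_prod_sum[OF h[OF that] ac] by (simp add: a_def mult.commute)
    have ent: "(h \<omega> - W *\<^sub>v y \<omega>) $ i = h \<omega> \<bullet>c a i - v i \<omega>" if i: "i < d" and om: "\<omega> \<in> space M" for i \<omega>
    proof -
      have "W *\<^sub>v y \<omega> = (W * G) *\<^sub>v h \<omega> + W *\<^sub>v w \<omega>"
        unfolding y[OF om] using W G h[OF om] w[OF om]
        by (simp add: mult_add_distrib_mat_vec[of _ d m] assoc_mult_mat_vec[of _ d m _ d])
      moreover have "((1\<^sub>m d - W * G) *\<^sub>v h \<omega>) = h \<omega> - (W * G) *\<^sub>v h \<omega>"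
        using W G h[OF om] by (simp add: minus_mult_distrib_mat_vec[of _ d d] mult_carrier_mat[of _ d m _ d])
      ultimately have "(h \<omega> - W *\<^sub>v y \<omega>) $ i = (A *\<^sub>v h \<omega>) $ i - (W *\<^sub>v w \<omega>) $ i"
        using W G h[OF om] w[OF om] i by (simp add: A_def)
      then show ?thesis unfolding u_sum[OF om] v_def index_mult_vec_sum[OF A h[OF om] i] index_mult_vec_sum[OF W w[OF om] i] .
    qed
    have uu: "has_bochner_integral M (\<lambda>\<omega>. complex_of_real ((cmod (h \<omega> \<bullet>c a i))\<^sup>2)) (complex_of_real (Re (((B * B) *\<^sub>v a i) \<bullet>c a i)))" for i
      using hh[OF ac] by (rule has_bochner_integral_of_real)
    have vv: "has_bochner_integral M (\<lambda>\<omega>. v i \<omega> * cnj (v i \<omega>)) (complex_of_real s * (\<Sum>l<m. W $$ (i, l) * cnj (W $$ (i, l))))" for i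
    proof -
      have "has_bochner_integral M (\<lambda>\<omega>. \<Sum>k<m. \<Sum>l<m. (W $$ (i, k) * cnj (W $$ (i, l))) * (w \<omega> $ k * cnj (w \<omega> $ l)))
        (\<Sum>k<m. \<Sum>l<m. (W $$ (i, k) * cnj (W $$ (i, l))) * (if k = l then complex_of_real s else 0))"
        by (intro has_bochner_integral_sum has_bochner_integral_mult_right ww) auto
      moreover have "(\<Sum>k<m. \<Sum>l<m. (W $$ (i, k) * cnj (W $$ (i, l))) * (w \<omega> $ k * cnj (w \<omega> $ l))) = v i \<omega> * cnj (v i \<omega>)" for \<omega>
        unfolding v_def cnj_sum sum_product by (simp add: mult_ac)
      moreover have "(\<Sum>k<m. \<Sum>l<m. (W $$ (i, k) * cnj (W $$ (i, l))) * (if k = l then complex_of_real s else 0)) =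
        complex_of_real s * (\<Sum>l<m. W $$ (i, l) * cnj (W $$ (i, l)))"
        by (simp add: if_distrib[where f="\<lambda>x. _ * x"] sum_distrib_left mult_ac cong: if_cong)
      ultimately show ?thesis by simp
    qed
    have uv: "has_bochner_integral M (\<lambda>\<omega>. (\<Sum>k<d. A $$ (i, k) * h \<omega> $ k) * cnj (v i \<omega>)) 0" for i
    proof -
      have "has_bochner_integral M (\<lambda>\<omega>. \<Sum>k<d. \<Sum>l<m. (A $$ (i, k) * cnj (W $$ (i, l))) * (h \<omega> $ k * cnj (w \<omega> $ l)))
        (\<Sum>k<d. \<Sum>l<m. (A $$ (i, k) * cnj (W $$ (i, l))) * 0)"
        by (intro has_bochner_integral_sum has_bochner_integral_mult_right hw) auto
      moreover have "(\<Sum>k<d. \<Sum>l<m. (A $$ (i, k) * cnj (W $$ (i, l))) * (h \<omega> $ k * cnj (w \<omega> $ l))) = (\<Sum>k<d. A $$ (i, k) * h \<omega> $ k) * cnj (v i \<omega>)" for \<omega>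
        unfolding v_def cnj_sum sum_product by (simp add: mult_ac)
      ultimately show ?thesis by simp
    qed
    \<comment> \<open>Integrated form of |x - v|^2 = |x|^2 + |v|^2 - x cnj v - cnj (x cnj v); the
      last two terms have mean zero.\<close>
    have tot: "has_bochner_integral M (\<lambda>\<omega>. \<Sum>i<d. complex_of_real ((cmod (h \<omega> \<bullet>c a i))\<^sup>2) + v i \<omega> * cnj (v i \<omega>)
        - (\<Sum>k<d. A $$ (i, k) * h \<omega> $ k) * cnj (v i \<omega>) - cnj ((\<Sum>k<d. A $$ (i, k) * h \<omega> $ k) * cnj (v i \<omega>)))
      (\<Sum>i<d. complex_of_real (Re (((B * B) *\<^sub>v a i) \<bullet>c a i)) + complex_of_real s * (\<Sum>l<m. W $$ (i, l) * cnj (W $$ (i, l))) - 0 - cnj 0)"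
      by (intro has_bochner_integral_sum has_bochner_integral_diff has_bochner_integral_add uu vv uv has_bochner_integral_cnj)
    have "complex_of_real (f W) = (LINT \<omega>|M. complex_of_real (\<Sum>i<d. (cmod ((h \<omega> - W *\<^sub>v y \<omega>) $ i))\<^sup>2))"
      by (simp only: f_def integral_complex_of_real)
    also have "\<dots> = (LINT \<omega>|M. (\<Sum>i<d. complex_of_real ((cmod (h \<omega> \<bullet>c a i))\<^sup>2) + v i \<omega> * cnj (v i \<omega>)
        - (\<Sum>k<d. A $$ (i, k) * h \<omega> $ k) * cnj (v i \<omega>) - cnj ((\<Sum>k<d. A $$ (i, k) * h \<omega> $ k) * cnj (v i \<omega>))))"
    proof (rule Bochner_Integration.integral_cong[OF refl])
      fix \<omega> assume om: "\<omega> \<in> space M"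
      show "complex_of_real (\<Sum>i<d. (cmod ((h \<omega> - W *\<^sub>v y \<omega>) $ i))\<^sup>2) = (\<Sum>i<d. complex_of_real ((cmod (h \<omega> \<bullet>c a i))\<^sup>2) + v i \<omega> * cnj (v i \<omega>)
        - (\<Sum>k<d. A $$ (i, k) * h \<omega> $ k) * cnj (v i \<omega>) - cnj ((\<Sum>k<d. A $$ (i, k) * h \<omega> $ k) * cnj (v i \<omega>)))"
        unfolding of_real_sum u_sum[OF om, symmetric]
        by (intro sum.cong refl) (simp add: ent[OF _ om] complex_norm_square algebra_simps del: of_real_power index_minus_vec)
    qed
    also have "\<dots> = (\<Sum>i<d. complex_of_real (Re (((B * B) *\<^sub>v a i) \<bullet>c a i)) + complex_of_real s * (\<Sum>l<m. W $$ (i, l) * cnj (W $$ (i, l))))"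
      using has_bochner_integral_integral_eq[OF tot] by simp
    also have "\<dots> = (\<Sum>i<d. complex_of_real (Re (((B * B) *\<^sub>v a i) \<bullet>c a i))) + complex_of_real s * mtrace (W * W\<^sup>H)"
      unfolding mtrace_mult_adjoint[OF W W] by (simp add: sum.distrib sum_distrib_left)
    also have "(\<Sum>i<d. complex_of_real (Re (((B * B) *\<^sub>v a i) \<bullet>c a i))) = mtrace ((A * B) * (A * B)\<^sup>H)"
    proof -
      have AB: "A * B \<in> carrier_mat d d" using A B by auto
      have "((B * B) *\<^sub>v a i) \<bullet>c a i = complex_of_real (\<Sum>j<d. (cmod ((A * B) $$ (i, j)))\<^sup>2)" if i: "i < d" for i
      proof -
        have Ba: "(B *\<^sub>v a i) $ j = cnj ((A * B) $$ (i, j))" if j: "j < d" for j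
        proof -
          have Bh: "B $$ (j, k) = cnj (B $$ (k, j))" if "k < d" for k
            using arg_cong[OF B(2), of "\<lambda>X. X $$ (j, k)"] B(1) j that by simp
          show ?thesis
            unfolding index_mult_vec_sum[OF B(1) ac j] index_mult_sum[OF A B(1) i j] cnj_sum
            by (intro sum.cong refl) (simp add: a_def Bh mult.commute)
        qed
        show ?thesis unfolding quadform_gram[OF B(1) ac, of i, unfolded B(2)]
          by (intro arg_cong[where f=complex_of_real] sum.cong refl) (simp only: Ba lessThan_iff complex_mod_cnj)
      qed
      then show ?thesis unfolding mtrace_mult_adjoint_self[OF AB] by (simp del: index_mult_mat(1))
    qed
    finally show ?thesis by (simp add: A_def)
  qed
  have f_eq: "f W = Re (mtrace (B * Z * B\<^sup>H)) + (\<Sum>i<d. \<Sum>j<d. (cmod (((W - W0) * (G * B)) $$ (i, j)))\<^sup>2) + s * (\<Sum>i<d. \<Sum>j<m. (cmod ((W - W0) $$ (i, j)))\<^sup>2)"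
    and f_cplx: "complex_of_real (f W) = mtrace (B * Z * B\<^sup>H) + complex_of_real ((\<Sum>i<d. \<Sum>j<d. (cmod (((W - W0) * (G * B)) $$ (i, j)))\<^sup>2) + s * (\<Sum>i<d. \<Sum>j<m. (cmod ((W - W0) $$ (i, j)))\<^sup>2))"
    if W: "W \<in> carrier_mat d m" for W
  proof -
    have D: "W - W0 \<in> carrier_mat d m" using W W0 by (simp add: minus_carrier_mat)
    have DQ: "(W - W0) * (G * B) \<in> carrier_mat d d" using D Q by auto
    show c: "complex_of_real (f W) = mtrace (B * Z * B\<^sup>H) + complex_of_real ((\<Sum>i<d. \<Sum>j<d. (cmod (((W - W0) * (G * B)) $$ (i, j)))\<^sup>2) + s * (\<Sum>i<d. \<Sum>j<m. (cmod ((W - W0) $$ (i, j)))\<^sup>2))"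
      unfolding mse[OF W] mse_decomposition[OF B(1) G W s Z, folded W0_def]
        mtrace_mult_adjoint_self[OF D] mtrace_mult_adjoint_self[OF DQ] by (simp only: of_real_add of_real_mult add.assoc)
    show "f W = Re (mtrace (B * Z * B\<^sup>H)) + (\<Sum>i<d. \<Sum>j<d. (cmod (((W - W0) * (G * B)) $$ (i, j)))\<^sup>2) + s * (\<Sum>i<d. \<Sum>j<m. (cmod ((W - W0) $$ (i, j)))\<^sup>2)"
      using arg_cong[OF c, of Re] by (simp only: Re_complex_of_real plus_complex.sel add.assoc)
  qed
  have D0: "(W0 - W0) * (G * B) = 0\<^sub>m d d" using minus_r_inv_mat[OF W0] left_mult_zero_mat[OF Q] by simp
  have f0: "complex_of_real (f W0) = mtrace (B * Z * B\<^sup>H)"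
    unfolding f_cplx[OF W0] D0 using W0 by (simp add: minus_r_inv_mat[OF W0])
  have min: "f W0 \<le> f W" if "W \<in> carrier_mat d m" for W
  proof -
    have "f W0 = Re (mtrace (B * Z * B\<^sup>H))" using arg_cong[OF f0, of Re] by simp
    then show ?thesis unfolding f_eq[OF that] using s by (simp add: sum_nonneg)
  qed
  \<comment> \<open>The minimum is attained, so the infimum over all filters is the value at
    \<open>W0\<close>.\<close>
  have "lmmse M d m h y = f W0"
    unfolding lmmse_def f_def[symmetric] by (rule cInf_eq_minimum) (use W0 min in auto)
  then have "complex_of_real (lmmse M d m h y) = mtrace (B * Z * B)" using f0 B(2) by simp
  also have "\<dots> = mtrace (B * (B * Z))" using B Z by (intro mtrace_mult_comm[of _ d d]) auto
  also have "B * (B * Z) = (B * B) * Z" using B Z by simp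
  finally show ?thesis by (simp add: Z_def)
qed

section \<open>Complex Gaussian moments\<close>

lemma measurable_complex_pair [measurable]: "(\<lambda>(x, y). Complex x y) \<in> measurable (lborel \<Otimes>\<^sub>M lborel) borel"
  unfolding Complex_eq split_beta by measurable

text \<open>Lebesgue measure is determined by its values on boxes, and a complex box is a product of
  two intervals. Integrals over the plane thereby become double integrals over real and imaginary
  part.\<close>

lemma lborel_complex_eq: "distr (lborel \<Otimes>\<^sub>M lborel) borel (\<lambda>(x, y). Complex x y) = (lborel :: complex measure)"
proof (rule lborel_eqI[symmetric])
  fix l u :: complex assume le: "\<And>b. b \<in> Basis \<Longrightarrow> l \<bullet> b \<le> u \<bullet> b"
  have "Re l \<le> Re u" "Im l \<le> Im u" using le[of 1] le[of \<i>] by (auto simp: Basis_complex_def)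
  have "emeasure (distr (lborel \<Otimes>\<^sub>M lborel) borel (\<lambda>(x, y). Complex x y)) (box l u) =
      emeasure (lborel \<Otimes>\<^sub>M lborel) ({Re l<..<Re u} \<times> {Im l<..<Im u})"
    by (subst emeasure_distr, measurable)
      (auto intro!: arg_cong[where f="emeasure _"] simp: box_def Basis_complex_def space_pair_measure)
  also have "\<dots> = ennreal (Re u - Re l) * ennreal (Im u - Im l)"
    using \<open>Re l \<le> Re u\<close> \<open>Im l \<le> Im u\<close> by (subst lborel.emeasure_pair_measure_Times) auto
  also have "\<dots> = (\<Prod>b\<in>Basis. (u - l) \<bullet> b)"
    using \<open>Re l \<le> Re u\<close> \<open>Im l \<le> Im u\<close> by (simp add: Basis_complex_def ennreal_mult)
  finally show "emeasure (distr (lborel \<Otimes>\<^sub>M lborel) borel (\<lambda>(x, y). Complex x y)) (box l u) = (\<Prod>b\<in>Basis. (u - l) \<bullet> b)" .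
qed simp

text \<open>Centred normal law; \<open>s\<close> is the standard deviation, not the
  variance.\<close>

definition real_gauss :: "real \<Rightarrow> real measure" where
  "real_gauss s = density lborel (\<lambda>x. ennreal (normal_density 0 s x))"

lemma prob_space_real_gauss: "0 < s \<Longrightarrow> prob_space (real_gauss s)"
  unfolding real_gauss_def by (rule prob_space_normal_density)

lemma sets_real_gauss [measurable_cong]: "sets (real_gauss s) = sets borel"
  by (simp add: real_gauss_def)

text \<open>The rotation invariant density factorises, so real and imaginary part are independent
  normal variables that share the variance \<open>v\<close> equally.\<close>

lemma cgauss_eq_distr:
  assumes v: "0 < v"
  shows "cgauss v = distr (real_gauss (sqrt (v / 2)) \<Otimes>\<^sub>M real_gauss (sqrt (v / 2))) borel (\<lambda>(x, y). Complex x y)"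
proof -
  let ?s = "sqrt (v / 2)"
  let ?n = "\<lambda>x. ennreal (normal_density 0 ?s x)"
  have "prob_space (density lborel ?n)" using v by (intro prob_space_normal_density) simp
  then have sf: "sigma_finite_measure (density lborel ?n)"
    by (rule prob_space_imp_sigma_finite)
  have "real_gauss ?s \<Otimes>\<^sub>M real_gauss ?s = density (lborel \<Otimes>\<^sub>M lborel) (\<lambda>(x, y). ?n x * ?n y)"
    unfolding real_gauss_def by (rule pair_measure_density) (auto simp: sf lborel.sigma_finite_measure_axioms)
  also have "(\<lambda>(x, y). ?n x * ?n y) = (\<lambda>z. ennreal (exp (- (cmod (case z of (x, y) \<Rightarrow> Complex x y))\<^sup>2 / v) / (pi * v)))"
  proof (rule ext, clarify)
    fix x y :: real
    have "normal_density 0 ?s x * normal_density 0 ?s y = exp (- (x\<^sup>2 + y\<^sup>2) / v) / (pi * v)"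
      using v by (simp add: normal_density_def exp_add[symmetric] field_simps real_sqrt_mult[symmetric])
    then show "?n x * ?n y = ennreal (exp (- (cmod (Complex x y))\<^sup>2 / v) / (pi * v))"
      by (simp add: ennreal_mult[symmetric] cmod_def)
  qed
  finally show ?thesis
    using v unfolding cgauss_def lborel_complex_eq[symmetric]
    by (simp add: density_distr)
qed

lemma integral_cgauss_product:
  fixes f g :: "real \<Rightarrow> real"
  assumes v: "0 < v"
    and f: "has_bochner_integral (real_gauss (sqrt (v / 2))) f a" and g: "has_bochner_integral (real_gauss (sqrt (v / 2))) g b"
  shows "has_bochner_integral (cgauss v) (\<lambda>z. f (Re z) * g (Im z)) (a * b)"
proof -
  let ?N = "real_gauss (sqrt (v / 2))"
  interpret N: prob_space ?N using v by (intro prob_space_real_gauss) simp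
  interpret P: pair_sigma_finite ?N ?N ..
  have fm [measurable]: "f \<in> borel_measurable ?N" and gm [measurable]: "g \<in> borel_measurable ?N"
    using f g by (auto simp: has_bochner_integral_iff)
  have [measurable]: "f \<in> borel_measurable borel" "g \<in> borel_measurable borel"
    using fm gm by (simp_all add: measurable_cong_sets[OF sets_real_gauss refl])
  have fi: "integrable ?N f" "integrable ?N g" using f g by (auto simp: has_bochner_integral_iff)
  have int: "integrable (?N \<Otimes>\<^sub>M ?N) (\<lambda>(x, y). f x * g y)"
    by (rule P.Fubini_integrable) (use fi in \<open>auto simp: abs_mult\<close>)
  have "(\<integral>z. (case z of (x, y) \<Rightarrow> f x * g y) \<partial>(?N \<Otimes>\<^sub>M ?N)) = (\<integral>x. \<integral>y. f x * g y \<partial>?N \<partial>?N)"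
    using P.integral_fst'[OF int] by simp
  also have "\<dots> = a * b" using f g by (simp add: has_bochner_integral_iff)
  finally have "has_bochner_integral (?N \<Otimes>\<^sub>M ?N) (\<lambda>(x, y). f x * g y) (a * b)"
    using int by (simp add: has_bochner_integral_iff)
  moreover have cm: "(\<lambda>(x, y). Complex x y) \<in> measurable (?N \<Otimes>\<^sub>M ?N) borel"
    unfolding Complex_eq split_beta by measurable
  ultimately show ?thesis
    unfolding cgauss_eq_distr[OF v] has_bochner_integral_iff
    by (simp add: integrable_distr_eq integral_distr case_prod_unfold)
qed

lemma real_gauss_integral:
  fixes f :: "real \<Rightarrow> real"
  assumes "has_bochner_integral lborel (\<lambda>x. normal_density 0 s x * f x) a" "f \<in> borel_measurable borel"
  shows "has_bochner_integral (real_gauss s) f a"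
  unfolding real_gauss_def using assms
  by (intro has_bochner_integral_density) auto

text \<open>For even k this is s^k times the product of the odd numbers below k, in the form in
  which \<open>normal_moment_even\<close> states it.\<close>

definition gauss_moment :: "real \<Rightarrow> nat \<Rightarrow> real" where
  "gauss_moment s k = (if even k then fact k / ((2 / s\<^sup>2) ^ (k div 2) * fact (k div 2)) else 0)"

lemma real_gauss_power:
  assumes "0 < s"
  shows "has_bochner_integral (real_gauss s) (\<lambda>x. x ^ k) (gauss_moment s k)"
proof (rule real_gauss_integral)
  show "has_bochner_integral lborel (\<lambda>x. normal_density 0 s x * x ^ k) (gauss_moment s k)"
    using normal_moment_even[OF assms, of 0 "k div 2"] normal_moment_odd[OF assms, of 0 "k div 2"]
    by (cases "even k") (auto simp: gauss_moment_def odd_two_times_div_two_succ)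
qed simp

text \<open>Tilting a normal density by an exponential shifts its mean to
  \<open>b * s\<^sup>2\<close> and leaves a constant factor; the shifted density has mass 1.\<close>

lemma real_gauss_exp:
  assumes s: "0 < s"
  shows "has_bochner_integral (real_gauss s) (\<lambda>x. exp (b * x)) (exp (b\<^sup>2 * s\<^sup>2 / 2))"
proof (rule real_gauss_integral)
  have "normal_density 0 s x * exp (b * x) = exp (b\<^sup>2 * s\<^sup>2 / 2) * normal_density (b * s\<^sup>2) s x" for x
  proof -
    have "- x\<^sup>2 / (2 * s\<^sup>2) + b * x = b\<^sup>2 * s\<^sup>2 / 2 - (x - b * s\<^sup>2)\<^sup>2 / (2 * s\<^sup>2)"
      using s by (simp add: field_simps power2_eq_square)
    then have "exp (- x\<^sup>2 / (2 * s\<^sup>2)) * exp (b * x) = exp (b\<^sup>2 * s\<^sup>2 / 2) * exp (- (x - b * s\<^sup>2)\<^sup>2 / (2 * s\<^sup>2))"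
      unfolding exp_add[symmetric] by simp
    then show ?thesis by (simp add: normal_density_def)
  qed
  moreover have "has_bochner_integral lborel (normal_density (b * s\<^sup>2) s) 1"
    using normal_moment_even[OF s, of "b * s\<^sup>2" 0] by simp
  ultimately show "has_bochner_integral lborel (\<lambda>x. normal_density 0 s x * exp (b * x)) (exp (b\<^sup>2 * s\<^sup>2 / 2))"
    using has_bochner_integral_mult_right[of "exp (b\<^sup>2 * s\<^sup>2 / 2)" lborel "normal_density (b * s\<^sup>2) s" 1] by simp
qed simp

text \<open>The real-linear functional Re (a z) is normal with variance |a|^2 v / 2. These
  exponential moments later dominate the polynomial ones.\<close>

lemma cgauss_exp:
  assumes v: "0 < v"
  shows "has_bochner_integral (cgauss v) (\<lambda>z. exp (Re (a * z))) (exp ((cmod a)\<^sup>2 * v / 4))"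
proof -
  have "has_bochner_integral (cgauss v) (\<lambda>z. exp (Re a * Re z) * exp (- Im a * Im z))
      (exp ((Re a)\<^sup>2 * (sqrt (v / 2))\<^sup>2 / 2) * exp ((- Im a)\<^sup>2 * (sqrt (v / 2))\<^sup>2 / 2))"
    using v by (intro integral_cgauss_product real_gauss_exp) auto
  then have "has_bochner_integral (cgauss v) (\<lambda>z. exp (Re a * Re z + - Im a * Im z))
      (exp ((Re a)\<^sup>2 * (sqrt (v / 2))\<^sup>2 / 2 + (- Im a)\<^sup>2 * (sqrt (v / 2))\<^sup>2 / 2))"
    by (simp only: exp_add)
  moreover have "Re (a * z) = Re a * Re z + - Im a * Im z" for z by simp
  moreover have "(Re a)\<^sup>2 * (sqrt (v / 2))\<^sup>2 / 2 + (- Im a)\<^sup>2 * (sqrt (v / 2))\<^sup>2 / 2 = (cmod a)\<^sup>2 * v / 4"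
    using v by (simp add: cmod_power2 algebra_simps)
  ultimately show ?thesis by (simp only:)
qed

lemma cgauss_monomial:
  assumes v: "0 < v"
  shows "has_bochner_integral (cgauss v) (\<lambda>z. complex_of_real (Re z ^ j * Im z ^ k))
    (complex_of_real (gauss_moment (sqrt (v / 2)) j * gauss_moment (sqrt (v / 2)) k))"
  using v by (intro has_bochner_integral_of_real integral_cgauss_product real_gauss_power) auto

lemma gauss_moment_values:
  assumes "0 < v"
  shows "gauss_moment (sqrt (v / 2)) 0 = 1" "gauss_moment (sqrt (v / 2)) (Suc 0) = 0" "gauss_moment (sqrt (v / 2)) 2 = v / 2"
    "gauss_moment (sqrt (v / 2)) 3 = 0" "gauss_moment (sqrt (v / 2)) 4 = 3 * v\<^sup>2 / 4"
  using assms by (simp_all add: gauss_moment_def fact_numeral power2_eq_square power_divide)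

lemma cgauss_moment_cnj:
  assumes "has_bochner_integral (cgauss v) (\<lambda>z. z ^ a * cnj z ^ b) (complex_of_real c)"
  shows "has_bochner_integral (cgauss v) (\<lambda>z. z ^ b * cnj z ^ a) (complex_of_real c)"
  using has_bochner_integral_cnj[OF assms] by (simp add: mult.commute)

text \<open>Circular symmetry leaves only a = b. Exponents up to 2 suffice, since a product of two
  variables and two conjugated variables never contains one of them more often. Six of the nine
  cases are expanded in real and imaginary part, the other three are conjugates.\<close>

lemma cgauss_moment:
  assumes v: "0 < v" and ab: "a \<le> 2" "b \<le> 2"
  shows "has_bochner_integral (cgauss v) (\<lambda>z. z ^ a * cnj z ^ b) (complex_of_real (if a = b then fact a * v ^ a else 0))"
proof -
  note m = cgauss_monomial[OF v] and mv = gauss_moment_values[OF v]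
  have zz: "z = complex_of_real (Re z) + \<i> * complex_of_real (Im z)" "cnj z = complex_of_real (Re z) - \<i> * complex_of_real (Im z)" for z
    by (simp_all add: complex_eq_iff)
  have mr: "has_bochner_integral (cgauss v) (\<lambda>z. c * f z) (c * x)"
    if "has_bochner_integral (cgauss v) f x" for c x :: complex and f
    using that by (rule has_bochner_integral_mult_right)
  have 00: "has_bochner_integral (cgauss v) (\<lambda>z. z ^ 0 * cnj z ^ 0) (complex_of_real 1)"
    using m[of 0 0] by (simp add: mv)
  have 10: "has_bochner_integral (cgauss v) (\<lambda>z. z ^ 1 * cnj z ^ 0) (complex_of_real 0)"
  proof -
    have eq: "z ^ 1 * cnj z ^ 0 = complex_of_real (Re z ^ 1 * Im z ^ 0) + \<i> * complex_of_real (Re z ^ 0 * Im z ^ 1)" for z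
      by (simp add: complex_eq_iff)
    show ?thesis unfolding eq
      using has_bochner_integral_add[OF m[of 1 0] mr[OF m[of 0 1], of \<i>]] by (simp add: mv)
  qed
  have 20: "has_bochner_integral (cgauss v) (\<lambda>z. z ^ 2 * cnj z ^ 0) (complex_of_real 0)"
  proof -
    have eq: "z ^ 2 * cnj z ^ 0 = complex_of_real (Re z ^ 2 * Im z ^ 0) - complex_of_real (Re z ^ 0 * Im z ^ 2) + 2 * \<i> * complex_of_real (Re z ^ 1 * Im z ^ 1)" for z
      by (simp add: complex_eq_iff power2_eq_square)
    show ?thesis unfolding eq
      using has_bochner_integral_add[OF has_bochner_integral_diff[OF m[of 2 0] m[of 0 2]] mr[OF m[of 1 1], of "2 * \<i>"]] by (simp add: mv)
  qed
  have 11: "has_bochner_integral (cgauss v) (\<lambda>z. z ^ 1 * cnj z ^ 1) (complex_of_real v)"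
  proof -
    have eq: "z ^ 1 * cnj z ^ 1 = complex_of_real (Re z ^ 2 * Im z ^ 0) + complex_of_real (Re z ^ 0 * Im z ^ 2)" for z
      by (simp add: complex_eq_iff power2_eq_square)
    show ?thesis unfolding eq
      using has_bochner_integral_add[OF m[of 2 0] m[of 0 2]] by (simp add: mv flip: of_real_add)
  qed
  have 21: "has_bochner_integral (cgauss v) (\<lambda>z. z ^ 2 * cnj z ^ 1) (complex_of_real 0)"
  proof -
    have eq: "z ^ 2 * cnj z ^ 1 = complex_of_real (Re z ^ 3 * Im z ^ 0) + complex_of_real (Re z ^ 1 * Im z ^ 2) +
      \<i> * complex_of_real (Re z ^ 2 * Im z ^ 1) + \<i> * complex_of_real (Re z ^ 0 * Im z ^ 3)" for z
      by (simp add: complex_eq_iff power2_eq_square power3_eq_cube algebra_simps)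
    show ?thesis unfolding eq
      using has_bochner_integral_add[OF has_bochner_integral_add[OF has_bochner_integral_add[OF m[of 3 0] m[of 1 2]]
            mr[OF m[of 2 1], of \<i>]] mr[OF m[of 0 3], of \<i>]] by (simp add: mv)
  qed
  have 22: "has_bochner_integral (cgauss v) (\<lambda>z. z ^ 2 * cnj z ^ 2) (complex_of_real (2 * v ^ 2))"
  proof -
    have eq: "z ^ 2 * cnj z ^ 2 = complex_of_real (Re z ^ 4 * Im z ^ 0) + complex_of_real (Re z ^ 2 * Im z ^ 2) +
      complex_of_real (Re z ^ 2 * Im z ^ 2) + complex_of_real (Re z ^ 0 * Im z ^ 4)" for z
      by (simp add: complex_eq_iff power2_eq_square power4_eq_xxxx algebra_simps)
    let ?m = "\<lambda>j k. complex_of_real (gauss_moment (sqrt (v / 2)) j * gauss_moment (sqrt (v / 2)) k)"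
    have "?m 4 0 + ?m 2 2 + ?m 2 2 + ?m 0 4 = complex_of_real (2 * v ^ 2)"
      by (simp add: mv power2_eq_square complex_eq_iff)
    then show ?thesis unfolding eq
      using has_bochner_integral_add[OF has_bochner_integral_add[OF has_bochner_integral_add[OF m[of 4 0] m[of 2 2]]
            m[of 2 2]] m[of 0 4]] by (simp only:)
  qed
  have "a \<in> {0, 1, 2}" "b \<in> {0, 1, 2}" using ab by auto
  then consider "a = 0" "b = 0" | "a = 1" "b = 0" | "a = 2" "b = 0" | "a = 0" "b = 1" | "a = 1" "b = 1" | "a = 2" "b = 1"
    | "a = 0" "b = 2" | "a = 1" "b = 2" | "a = 2" "b = 2" by blast
  then show ?thesis
  proof cases
    case 4 then show ?thesis using cgauss_moment_cnj[OF 10] by simp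
  next
    case 7 then show ?thesis using cgauss_moment_cnj[OF 20] by simp
  next
    case 8 then show ?thesis using cgauss_moment_cnj[OF 21] by simp
  qed (use 00 10 20 11 21 22 in simp_all)
qed

text \<open>The case \<open>v = 0\<close>, a point mass, is included because a singular covariance
  gives some functionals variance zero.\<close>

lemma cgauss_second_moment:
  assumes "0 \<le> v"
  shows "has_bochner_integral (cgauss v) (\<lambda>z. (cmod z)\<^sup>2) v"
proof (cases "v = 0")
  case True
  have "integrable (return borel (0::complex)) (\<lambda>z. (cmod z)\<^sup>2)"
    by (rule integrableI_bounded) (auto simp: nn_integral_return)
  then show ?thesis using True by (simp add: cgauss_def has_bochner_integral_iff integral_return)
next
  case False
  have "has_bochner_integral (cgauss v) (\<lambda>z. Re (z ^ 1 * cnj z ^ 1)) (Re (complex_of_real (fact 1 * v ^ 1)))"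
    using cgauss_moment[of v 1 1] assms False by (intro has_bochner_integral_Re) auto
  moreover have "Re (z ^ 1 * cnj z ^ 1) = (cmod z)\<^sup>2" for z
    unfolding cmod_power2 by (simp add: power2_eq_square)
  ultimately show ?thesis by (simp only: fact_1 power_one_right mult_1 Re_complex_of_real)
qed

section \<open>Random matrices: entries, independence and stacking\<close>

lemma space_mat_space [simp]: "space (mat_space r c) = carrier_mat r c"
  by (simp add: mat_space_def)

lemma measurable_mat_entry:
  assumes "i < r" "j < c"
  shows "(\<lambda>A. A $$ (i, j)) \<in> borel_measurable (mat_space r c)"
proof -
  have "(\<lambda>A. \<lambda>p \<in> {..<r} \<times> {..<c}. A $$ p) \<in> measurable (mat_space r c) (Pi\<^sub>M ({..<r} \<times> {..<c}) (\<lambda>_. borel))"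
    unfolding mat_space_def by (rule measurable_vimage_algebra1) (auto simp: space_PiM)
  then have "(\<lambda>A. (\<lambda>p \<in> {..<r} \<times> {..<c}. A $$ p) (i, j)) \<in> borel_measurable (mat_space r c)"
    by (rule measurable_compose[OF _ measurable_component_singleton]) (use assms in auto)
  then show ?thesis using assms by simp
qed

lemma has_bochner_integral_of_distr:
  fixes f :: "complex \<Rightarrow> 'b :: {banach, second_countable_topology}"
  assumes X: "X \<in> borel_measurable M" and d: "distr M borel X = D" and f: "has_bochner_integral D f a"
  shows "has_bochner_integral M (\<lambda>\<omega>. f (X \<omega>)) a"
proof -
  have f': "has_bochner_integral (distr M borel X) f a" using d f by simp
  then have "f \<in> borel_measurable (distr M borel X)" by (auto simp: has_bochner_integral_iff)
  then have fm: "f \<in> borel_measurable borel" by simp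
  show ?thesis using f' integrable_distr_eq[OF X fm] integral_distr[OF X fm] by (simp add: has_bochner_integral_iff)
qed

lemma (in prob_space) indep_vars_pair:
  assumes "indep_vars M' X I" "i \<in> I" "j \<in> I" "i \<noteq> j"
  shows "indep_var (M' i) (X i) (M' j) (X j)"
proof -
  have "indep_var (PiM {i} M') (\<lambda>\<omega>. \<lambda>i\<in>{i}. X i \<omega>) (PiM {j} M') (\<lambda>\<omega>. \<lambda>i\<in>{j}. X i \<omega>)"
    using assms by (intro indep_var_restrict[where I=I]) auto
  then have "indep_var (M' i) ((\<lambda>f. f i) \<circ> (\<lambda>\<omega>. \<lambda>i\<in>{i}. X i \<omega>)) (M' j) ((\<lambda>f. f j) \<circ> (\<lambda>\<omega>. \<lambda>i\<in>{j}. X i \<omega>))"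
    by (rule indep_var_compose) (auto intro: measurable_component_singleton)
  then show ?thesis by (simp add: o_def)
qed

lemma (in prob_space) has_bochner_integral_indep_mult:
  fixes X Y :: "'a \<Rightarrow> complex"
  assumes "indep_var borel X borel Y" "has_bochner_integral M X a" "has_bochner_integral M Y b"
  shows "has_bochner_integral M (\<lambda>\<omega>. X \<omega> * Y \<omega>) (a * b)"
  using indep_var_integrable[OF assms(1)] indep_var_lebesgue_integral[OF assms(1)] assms(2,3)
  by (auto simp: has_bochner_integral_iff)

text \<open>Column stacking turns left multiplication into a Kronecker product with the identity as
  left factor. This is how the matrix channel becomes a linear model for the stacked vector.\<close>

lemma vectorize_mult:
  assumes X: "X \<in> carrier_mat p q" and Y: "Y \<in> carrier_mat q r"
  shows "vectorize (X * Y) = (1\<^sub>m r \<otimes>\<^sub>K X) *\<^sub>v vectorize Y"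
proof (rule eq_vecI)
  have V: "vectorize Y \<in> carrier_vec (r * q)" using Y by (intro carrier_vecI) (simp add: vectorize_def)
  have K: "1\<^sub>m r \<otimes>\<^sub>K X \<in> carrier_mat (r * p) (r * q)" using X by auto
  fix k assume "k < dim_vec ((1\<^sub>m r \<otimes>\<^sub>K X) *\<^sub>v vectorize Y)"
  then have k: "k < r * p" using X by simp
  note d = div_mod_less[OF k]
  have "((1\<^sub>m r \<otimes>\<^sub>K X) *\<^sub>v vectorize Y) $ k = (\<Sum>l<r * q. (if k div p = l div q then X $$ (k mod p, l mod q) else 0) * Y $$ (l mod q, l div q))"
    unfolding index_mult_vec_sum[OF K V k] using X Y k d
    by (intro sum.cong refl) (auto simp: index_kronecker[of _ r r _ p q] vectorize_def mult.commute div_mod_less[of _ r q])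
  also have "\<dots> = (\<Sum>a<r. \<Sum>b<q. (if k div p = a then X $$ (k mod p, b) else 0) * Y $$ (b, a))"
    by (rule sum_div_mod)
  also have "\<dots> = (\<Sum>a<r. if a = k div p then (\<Sum>b<q. X $$ (k mod p, b) * Y $$ (b, a)) else 0)"
    by (intro sum.cong) auto
  also have "\<dots> = vectorize (X * Y) $ k"
    using d k X Y by (simp add: vectorize_def index_mult_sum[OF X Y] mult.commute del: index_mult_mat(1))
  finally show "vectorize (X * Y) $ k = ((1\<^sub>m r \<otimes>\<^sub>K X) *\<^sub>v vectorize Y) $ k" by simp
qed (use assms in \<open>auto simp: vectorize_def mult.commute\<close>)

lemma vectorize_add:
  assumes "X \<in> carrier_mat p q" "Y \<in> carrier_mat p q"
  shows "vectorize (X + Y) = vectorize X + vectorize Y"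
  by (rule eq_vecI) (use assms div_mod_less[of _ q p] in \<open>auto simp: vectorize_def mult.commute\<close>)

lemma index_vectorize_adjoint:
  fixes X :: "complex mat"
  assumes "X \<in> carrier_mat r c" "k < r * c"
  shows "vectorize (X\<^sup>H) $ k = cnj (X $$ (k div c, k mod c))"
  using assms div_mod_less[OF assms(2)] by (auto simp: vectorize_def mult.commute)

lemma vectorize_adjoint_carrier:
  assumes "X \<in> carrier_mat r c"
  shows "vectorize (X\<^sup>H) \<in> carrier_vec (r * c)"
  using assms by (intro carrier_vecI) (simp add: vectorize_def)

text \<open>Taking adjoints turns the observation into \<open>X\<close> times the adjoint channel
  plus the adjoint noise, with \<open>X = (F * s)\<^sup>H\<close>; after stacking this is a linear
  model with matrix \<open>1\<^sub>m N\<^sub>R \<otimes>\<^sub>K X\<close>. The covariance has the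
  Kronecker square root \<open>P \<otimes>\<^sub>K L\<close>, so the Gram matrix in the closed form
  is again a Kronecker product with left factor \<open>R\<^sub>R\<close>.\<close>

theorem lmmse_kronecker_channel:
  fixes M :: "'a measure" and S H N :: "'a \<Rightarrow> complex mat"
  assumes M: "prob_space M" and \<sigma>: "0 < \<sigma>"
    and F: "F \<in> carrier_mat N\<^sub>T N\<^sub>T" and R\<^sub>R: "psd N\<^sub>R R\<^sub>R" and R\<^sub>T: "psd N\<^sub>T R\<^sub>T"
    and N: "iid_cgauss_mat M N\<^sub>R N\<^sub>S (\<sigma>\<^sup>2) N"
    and H: "cgauss_vec M (N\<^sub>R * N\<^sub>T) (R\<^sub>R \<otimes>\<^sub>K R\<^sub>T) (\<lambda>\<omega>. vectorize ((H \<omega>)\<^sup>H))"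
    and indep: "indep_mats3 M (N\<^sub>T, N\<^sub>S) S (N\<^sub>R, N\<^sub>T) H (N\<^sub>R, N\<^sub>S) N"
    and s: "s \<in> carrier_mat N\<^sub>T N\<^sub>S"
  shows "complex_of_real (lmmse M (N\<^sub>R * N\<^sub>T) (N\<^sub>R * N\<^sub>S) (\<lambda>\<omega>. vectorize ((H \<omega>)\<^sup>H))
      (\<lambda>\<omega>. vectorize ((H \<omega> * (F * s) + N \<omega>)\<^sup>H))) =
    mtrace ((R\<^sub>R \<otimes>\<^sub>K R\<^sub>T) * minv (1\<^sub>m (N\<^sub>R * N\<^sub>T) + complex_of_real (1 / \<sigma>\<^sup>2) \<cdot>\<^sub>m
      (R\<^sub>R \<otimes>\<^sub>K (psd_sqrt R\<^sub>T * F * s * s\<^sup>H * F\<^sup>H * psd_sqrt R\<^sub>T))))"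
proof -
  interpret prob_space M by fact
  define P where "P = psd_sqrt R\<^sub>R"
  define L where "L = psd_sqrt R\<^sub>T"
  have P: "P \<in> carrier_mat N\<^sub>R N\<^sub>R" "P\<^sup>H = P" "P * P = R\<^sub>R" and L: "L \<in> carrier_mat N\<^sub>T N\<^sub>T" "L\<^sup>H = L" "L * L = R\<^sub>T"
    using psd_sqrt[OF R\<^sub>R] psd_sqrt[OF R\<^sub>T] by (auto simp: psd_def P_def L_def)
  define X where "X = (F * s)\<^sup>H"
  have Fs: "F * s \<in> carrier_mat N\<^sub>T N\<^sub>S" using F s by auto
  have X: "X \<in> carrier_mat N\<^sub>S N\<^sub>T" using Fs by (auto simp: X_def)
  define B where "B = P \<otimes>\<^sub>K L"
  define G where "G = 1\<^sub>m N\<^sub>R \<otimes>\<^sub>K X"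
  have B: "B \<in> carrier_mat (N\<^sub>R * N\<^sub>T) (N\<^sub>R * N\<^sub>T)" "B\<^sup>H = B" "B * B = R\<^sub>R \<otimes>\<^sub>K R\<^sub>T"
    using P L by (auto simp: B_def adjoint_kronecker kronecker_mult[of _ N\<^sub>R N\<^sub>R _ N\<^sub>T N\<^sub>T _ N\<^sub>R _ N\<^sub>T])
  have G: "G \<in> carrier_mat (N\<^sub>R * N\<^sub>S) (N\<^sub>R * N\<^sub>T)" using X by (auto simp: G_def)
  have XL: "X * L \<in> carrier_mat N\<^sub>S N\<^sub>T" using X L by auto
  have GB: "G * B = P \<otimes>\<^sub>K (X * L)"
    unfolding G_def B_def kronecker_mult[OF one_carrier_mat X P(1) L(1)] using P by simp
  have "(G * B)\<^sup>H * (G * B) = R\<^sub>R \<otimes>\<^sub>K ((X * L)\<^sup>H * (X * L))"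
    unfolding GB adjoint_kronecker P(2) kronecker_mult[OF P(1) adjoint_carrier[OF XL] P(1) XL] P(3) ..
  also have "(X * L)\<^sup>H * (X * L) = L * F * s * s\<^sup>H * F\<^sup>H * L"
    unfolding adjoint_mult[OF X L(1)] L(2) unfolding X_def adjoint_adjoint unfolding adjoint_mult[OF F s] using F s L(1)
    by (simp add: assoc_mult_mat[of _ N\<^sub>T N\<^sub>T _ N\<^sub>S _ N\<^sub>T] assoc_mult_mat[of _ N\<^sub>T N\<^sub>S _ N\<^sub>T _ N\<^sub>T] assoc_mult_mat[of _ N\<^sub>T N\<^sub>T _ N\<^sub>T _ N\<^sub>T]
      assoc_mult_mat[of _ N\<^sub>S N\<^sub>T _ N\<^sub>T _ N\<^sub>T] assoc_mult_mat[of _ N\<^sub>T N\<^sub>T _ N\<^sub>T _ N\<^sub>S]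
      mult_carrier_mat[of _ N\<^sub>T N\<^sub>T _ N\<^sub>S] mult_carrier_mat[of _ N\<^sub>T N\<^sub>S _ N\<^sub>T] mult_carrier_mat[of _ N\<^sub>T N\<^sub>T _ N\<^sub>T] mult_carrier_mat[of _ N\<^sub>S N\<^sub>T _ N\<^sub>T])
  finally have GBGB: "(G * B)\<^sup>H * (G * B) = R\<^sub>R \<otimes>\<^sub>K (L * F * s * s\<^sup>H * F\<^sup>H * L)" .
  have iv: "indep_vars (\<lambda>i. case_prod mat_space ([(N\<^sub>T, N\<^sub>S), (N\<^sub>R, N\<^sub>T), (N\<^sub>R, N\<^sub>S)] ! i)) (\<lambda>i. [S, H, N] ! i) {..<3::nat}"
    using indep by (simp add: indep_mats3_def)
  have HN: "indep_var (mat_space N\<^sub>R N\<^sub>T) H (mat_space N\<^sub>R N\<^sub>S) N"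
    using indep_vars_pair[OF iv, of 1 2] by (simp add: numeral_2_eq_2)
  have Hm: "H \<in> measurable M (mat_space N\<^sub>R N\<^sub>T)" and Nm: "N \<in> measurable M (mat_space N\<^sub>R N\<^sub>S)"
    using HN by (auto simp: indep_var_rv1 indep_var_rv2)
  have Hc: "H \<omega> \<in> carrier_mat N\<^sub>R N\<^sub>T" and Nc: "N \<omega> \<in> carrier_mat N\<^sub>R N\<^sub>S" if "\<omega> \<in> space M" for \<omega>
    using measurable_space[OF Hm that] measurable_space[OF Nm that] by auto
  have hcov: "has_bochner_integral M (\<lambda>\<omega>. (cmod (vectorize ((H \<omega>)\<^sup>H) \<bullet>c a))\<^sup>2) (Re (((B * B) *\<^sub>v a) \<bullet>c a))"
    if a: "a \<in> carrier_vec (N\<^sub>R * N\<^sub>T)" for a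
  proof (rule has_bochner_integral_of_distr[of _ M])
    show "(\<lambda>\<omega>. vectorize ((H \<omega>)\<^sup>H) \<bullet>c a) \<in> borel_measurable M"
      "distr M borel (\<lambda>\<omega>. vectorize ((H \<omega>)\<^sup>H) \<bullet>c a) = cgauss (Re (((R\<^sub>R \<otimes>\<^sub>K R\<^sub>T) *\<^sub>v a) \<bullet>c a))"
      using H a by (auto simp: cgauss_vec_def)
    show "has_bochner_integral (cgauss (Re (((R\<^sub>R \<otimes>\<^sub>K R\<^sub>T) *\<^sub>v a) \<bullet>c a))) (\<lambda>z. (cmod z)\<^sup>2) (Re (((B * B) *\<^sub>v a) \<bullet>c a))"
      unfolding B(3) using psd_kronecker[OF R\<^sub>R R\<^sub>T] a by (intro cgauss_second_moment) (auto simp: psd_def)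
  qed
  have Nmom: "has_bochner_integral M (\<lambda>\<omega>. f (N \<omega> $$ p)) x" if "p \<in> {..<N\<^sub>R} \<times> {..<N\<^sub>S}" "has_bochner_integral (cgauss (\<sigma>\<^sup>2)) f x" for p f and x :: complex
    using that N measurable_compose[OF Nm measurable_mat_entry[of "fst p" N\<^sub>R "snd p" N\<^sub>S]]
    by (intro has_bochner_integral_of_distr[of _ M]) (auto simp: iid_cgauss_mat_def)
  have s2: "0 < \<sigma>\<^sup>2" using \<sigma> by simp
  have N10: "has_bochner_integral M (\<lambda>\<omega>. N \<omega> $$ p) 0" and N01: "has_bochner_integral M (\<lambda>\<omega>. cnj (N \<omega> $$ p)) 0"
    and N11: "has_bochner_integral M (\<lambda>\<omega>. cnj (N \<omega> $$ p) * N \<omega> $$ p) (complex_of_real (\<sigma>\<^sup>2))" if "p \<in> {..<N\<^sub>R} \<times> {..<N\<^sub>S}" for p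
    using Nmom[OF that cgauss_moment[OF s2, of 1 0]] Nmom[OF that cgauss_moment[OF s2, of 0 1]] Nmom[OF that cgauss_moment[OF s2, of 1 1]]
    by (simp_all add: mult.commute)
  have Nind: "indep_var borel (\<lambda>\<omega>. cnj (N \<omega> $$ p)) borel (\<lambda>\<omega>. N \<omega> $$ q)"
    if "p \<in> {..<N\<^sub>R} \<times> {..<N\<^sub>S}" "q \<in> {..<N\<^sub>R} \<times> {..<N\<^sub>S}" "p \<noteq> q" for p q
  proof -
    have "indep_var borel (\<lambda>\<omega>. N \<omega> $$ p) borel (\<lambda>\<omega>. N \<omega> $$ q)"
      using indep_vars_pair[of "\<lambda>_. borel" "\<lambda>p \<omega>. N \<omega> $$ p" "{..<N\<^sub>R} \<times> {..<N\<^sub>S}" p q] N that by (auto simp: iid_cgauss_mat_def)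
    then have "indep_var borel (cnj \<circ> (\<lambda>\<omega>. N \<omega> $$ p)) borel (id \<circ> (\<lambda>\<omega>. N \<omega> $$ q))"
      by (rule indep_var_compose) (auto intro: borel_measurable_continuous_onI continuous_intros)
    then show ?thesis by (simp add: o_def)
  qed
  show ?thesis
    unfolding B(3)[symmetric] L_def[symmetric] GBGB[symmetric]
  proof (rule lmmse_closed_form[where w = "\<lambda>\<omega>. vectorize ((N \<omega>)\<^sup>H)"])
    fix \<omega> assume om: "\<omega> \<in> space M"
    show "vectorize ((H \<omega>)\<^sup>H) \<in> carrier_vec (N\<^sub>R * N\<^sub>T)" by (rule vectorize_adjoint_carrier[OF Hc[OF om]])
    show "vectorize ((N \<omega>)\<^sup>H) \<in> carrier_vec (N\<^sub>R * N\<^sub>S)" by (rule vectorize_adjoint_carrier[OF Nc[OF om]])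
    have "(H \<omega> * (F * s) + N \<omega>)\<^sup>H = X * (H \<omega>)\<^sup>H + (N \<omega>)\<^sup>H"
      using adjoint_plus[OF mult_carrier_mat[OF Hc[OF om] Fs] Nc[OF om]] adjoint_mult[OF Hc[OF om] Fs] by (simp add: X_def)
    then show "vectorize ((H \<omega> * (F * s) + N \<omega>)\<^sup>H) = G *\<^sub>v vectorize ((H \<omega>)\<^sup>H) + vectorize ((N \<omega>)\<^sup>H)"
      using vectorize_add[OF mult_carrier_mat[OF X adjoint_carrier[OF Hc[OF om]]] adjoint_carrier[OF Nc[OF om]]]
        vectorize_mult[OF X adjoint_carrier[OF Hc[OF om]]] by (simp add: G_def)
  next
    show "has_bochner_integral M (\<lambda>\<omega>. vectorize ((N \<omega>)\<^sup>H) $ k * cnj (vectorize ((N \<omega>)\<^sup>H) $ l)) (if k = l then complex_of_real (\<sigma>\<^sup>2) else 0)"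
      if kl: "k < N\<^sub>R * N\<^sub>S" "l < N\<^sub>R * N\<^sub>S" for k l
    proof -
      let ?p = "(k div N\<^sub>S, k mod N\<^sub>S)" and ?q = "(l div N\<^sub>S, l mod N\<^sub>S)"
      have pq: "?p \<in> {..<N\<^sub>R} \<times> {..<N\<^sub>S}" "?q \<in> {..<N\<^sub>R} \<times> {..<N\<^sub>S}"
        using div_mod_less[OF kl(1)] div_mod_less[OF kl(2)] by auto
      have "has_bochner_integral M (\<lambda>\<omega>. cnj (N \<omega> $$ ?p) * N \<omega> $$ ?q) (if k = l then complex_of_real (\<sigma>\<^sup>2) else 0)"
      proof (cases "k = l")
        case False
        then have "?p \<noteq> ?q" by (metis div_mult_mod_eq prod.inject)
        then show ?thesis using has_bochner_integral_indep_mult[OF Nind[OF pq] N01[OF pq(1)] N10[OF pq(2)]] False by simp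
      qed (use N11[OF pq(1)] in simp)
      then show ?thesis
        by (rule has_bochner_integral_cong[THEN iffD1, rotated -1]) (auto simp: index_vectorize_adjoint[OF Nc] kl)
    qed
  next
    show "has_bochner_integral M (\<lambda>\<omega>. vectorize ((H \<omega>)\<^sup>H) $ k * cnj (vectorize ((N \<omega>)\<^sup>H) $ l)) 0"
      if kl: "k < N\<^sub>R * N\<^sub>T" "l < N\<^sub>R * N\<^sub>S" for k l
    proof -
      let ?p = "(k div N\<^sub>T, k mod N\<^sub>T)" and ?q = "(l div N\<^sub>S, l mod N\<^sub>S)"
      have pq: "?p \<in> {..<N\<^sub>R} \<times> {..<N\<^sub>T}" "?q \<in> {..<N\<^sub>R} \<times> {..<N\<^sub>S}"
        using div_mod_less[OF kl(1)] div_mod_less[OF kl(2)] by auto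
      \<comment> \<open>Unit vectors recover single entries of the channel from the functionals in
        \<open>cgauss_vec\<close>; the conjugate comes from the adjoint.\<close>
      have eq: "vectorize ((H \<omega>)\<^sup>H) \<bullet>c unit_vec (N\<^sub>R * N\<^sub>T) k = cnj (H \<omega> $$ ?p)" if "\<omega> \<in> space M" for \<omega>
        unfolding cscalar_prod_sum[OF vectorize_adjoint_carrier[OF Hc[OF that]] unit_vec_carrier]
        using kl by (simp add: unit_vec_def if_distrib[where f="\<lambda>x. _ * x"] if_distrib[where f=cnj] index_vectorize_adjoint[OF Hc[OF that]] cong: if_cong)
      have "integrable M (\<lambda>\<omega>. (cmod (vectorize ((H \<omega>)\<^sup>H) \<bullet>c unit_vec (N\<^sub>R * N\<^sub>T) k))\<^sup>2)"
        using hcov[of "unit_vec (N\<^sub>R * N\<^sub>T) k"] by (simp add: has_bochner_integral_iff)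
      then have i2: "integrable M (\<lambda>\<omega>. (cmod (H \<omega> $$ ?p))\<^sup>2)"
        by (rule Bochner_Integration.integrable_cong[THEN iffD1, rotated -1]) (auto simp: eq)
      have hm: "(\<lambda>\<omega>. H \<omega> $$ ?p) \<in> borel_measurable M"
        using measurable_compose[OF Hm measurable_mat_entry[of "fst ?p" N\<^sub>R "snd ?p" N\<^sub>T]] pq by simp
      \<comment> \<open>On a probability space square integrability gives integrability.\<close>
      have "cmod z \<le> 1 + (cmod z)\<^sup>2" for z :: complex
      proof -
        have "2 * cmod z \<le> 1 + (cmod z)\<^sup>2" using zero_le_power2[of "cmod z - 1"] by (simp add: power2_diff)
        then show ?thesis using norm_ge_zero[of z] by linarith
      qed
      then have "integrable M (\<lambda>\<omega>. H \<omega> $$ ?p)"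
        by (intro Bochner_Integration.integrable_bound[OF Bochner_Integration.integrable_add[OF integrable_const[of "1::real"] i2] hm]) auto
      \<comment> \<open>The mean of the channel entry is left unevaluated: independence multiplies
        it by the zero mean of the noise.\<close>
      then have i1: "has_bochner_integral M (\<lambda>\<omega>. cnj (H \<omega> $$ ?p)) (LINT \<omega>|M. cnj (H \<omega> $$ ?p))"
        by (intro has_bochner_integral_integrable) simp
      have "indep_var borel ((\<lambda>A. cnj (A $$ ?p)) \<circ> H) borel ((\<lambda>A. A $$ ?q) \<circ> N)"
        using pq measurable_mat_entry by (intro indep_var_compose[OF HN]) (auto intro!: measurable_compose[OF measurable_mat_entry] borel_measurable_continuous_onI continuous_intros)
      then have ind: "indep_var borel (\<lambda>\<omega>. cnj (H \<omega> $$ ?p)) borel (\<lambda>\<omega>. N \<omega> $$ ?q)" by (simp add: o_def)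
      have "has_bochner_integral M (\<lambda>\<omega>. cnj (H \<omega> $$ ?p) * N \<omega> $$ ?q) 0"
        using has_bochner_integral_indep_mult[OF ind i1 N10[OF pq(2)]] by simp
      then show ?thesis
        by (rule has_bochner_integral_cong[THEN iffD1, rotated -1]) (auto simp: index_vectorize_adjoint[OF Nc] index_vectorize_adjoint[OF Hc] kl)
    qed
  qed (use B G s2 hcov in auto)
qed

section \<open>Random variables with absolute moments of all orders\<close>

definition all_moments :: "'a measure \<Rightarrow> ('a \<Rightarrow> 'b :: {real_normed_field, banach, second_countable_topology}) \<Rightarrow> bool" where
  "all_moments M X \<longleftrightarrow> X \<in> borel_measurable M \<and> (\<forall>p. integrable M (\<lambda>\<omega>. norm (X \<omega>) ^ p))"

lemma all_moments_integrable: "all_moments M X \<Longrightarrow> integrable M X"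
  unfolding all_moments_def using integrable_norm_iff[of X M] by (metis (no_types, lifting) Bochner_Integration.integrable_cong power_one_right)

lemma all_moments_norm_power: "all_moments M X \<Longrightarrow> integrable M (\<lambda>\<omega>. norm (X \<omega>) ^ p)"
  by (simp add: all_moments_def)

lemma power_add_le:
  fixes a b :: real
  assumes "0 \<le> a" "0 \<le> b"
  shows "(a + b) ^ p \<le> 2 ^ p * (a ^ p + b ^ p)"
proof -
  have "(a + b) ^ p \<le> (2 * max a b) ^ p" using assms by (intro power_mono) auto
  also have "\<dots> = 2 ^ p * max a b ^ p" by (simp add: power_mult_distrib)
  also have "\<dots> \<le> 2 ^ p * (a ^ p + b ^ p)" using assms by (intro mult_left_mono) (auto simp: max_def)
  finally show ?thesis .
qed

lemma all_moments_add [intro]: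
  assumes "all_moments M X" "all_moments M Y"
  shows "all_moments M (\<lambda>\<omega>. X \<omega> + Y \<omega>)"
proof -
  have m: "X \<in> borel_measurable M" "Y \<in> borel_measurable M" using assms by (auto simp: all_moments_def)
  have "integrable M (\<lambda>\<omega>. norm (X \<omega> + Y \<omega>) ^ p)" for p
  proof (rule Bochner_Integration.integrable_bound)
    show "integrable M (\<lambda>\<omega>. 2 ^ p * (norm (X \<omega>) ^ p + norm (Y \<omega>) ^ p))"
      using assms by (auto simp: all_moments_def)
    show "(\<lambda>\<omega>. norm (X \<omega> + Y \<omega>) ^ p) \<in> borel_measurable M" using m by measurable
    have "norm (X \<omega> + Y \<omega>) ^ p \<le> 2 ^ p * (norm (X \<omega>) ^ p + norm (Y \<omega>) ^ p)" for \<omega>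
      by (rule order_trans[OF power_mono[OF norm_triangle_ineq] power_add_le]) auto
    then show "AE \<omega> in M. norm (norm (X \<omega> + Y \<omega>) ^ p) \<le> norm (2 ^ p * (norm (X \<omega>) ^ p + norm (Y \<omega>) ^ p))"
      by (simp add: abs_of_nonneg)
  qed
  then show ?thesis using m by (auto simp: all_moments_def)
qed

text \<open>By u v <= u^2 + v^2 a moment of the product is controlled by moments of twice the order.
  Requiring all orders at once therefore gives a class closed under the ring operations, and
  integrability of polynomials in the entries follows from their structure.\<close>

lemma all_moments_mult [intro]:
  assumes "all_moments M X" "all_moments M Y"
  shows "all_moments M (\<lambda>\<omega>. X \<omega> * Y \<omega>)"
proof -
  have m: "X \<in> borel_measurable M" "Y \<in> borel_measurable M" using assms by (auto simp: all_moments_def)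
  have "integrable M (\<lambda>\<omega>. norm (X \<omega> * Y \<omega>) ^ p)" for p
  proof (rule Bochner_Integration.integrable_bound)
    show "integrable M (\<lambda>\<omega>. norm (X \<omega>) ^ (2 * p) + norm (Y \<omega>) ^ (2 * p))"
      using assms by (auto simp: all_moments_def)
    show "(\<lambda>\<omega>. norm (X \<omega> * Y \<omega>) ^ p) \<in> borel_measurable M" using m by measurable
    have "norm (X \<omega> * Y \<omega>) ^ p \<le> norm (X \<omega>) ^ (2 * p) + norm (Y \<omega>) ^ (2 * p)" for \<omega>
    proof -
      have "u * v \<le> u\<^sup>2 + v\<^sup>2" if "0 \<le> u" "0 \<le> v" for u v :: real
        using zero_le_power2[of "u - v"] mult_nonneg_nonneg[OF that] by (simp only: power2_diff)
      from this[of "norm (X \<omega>) ^ p" "norm (Y \<omega>) ^ p"] show ?thesis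
        by (simp add: norm_mult power_mult_distrib power_mult[symmetric] mult.commute)
    qed
    then show "AE \<omega> in M. norm (norm (X \<omega> * Y \<omega>) ^ p) \<le> norm (norm (X \<omega>) ^ (2 * p) + norm (Y \<omega>) ^ (2 * p))"
      by (simp add: abs_of_nonneg)
  qed
  then show ?thesis using m by (auto simp: all_moments_def)
qed

lemma (in prob_space) all_moments_const [intro]: "all_moments M (\<lambda>_. c)"
  by (simp add: all_moments_def)

lemma all_moments_cnj [intro]: "all_moments M X \<Longrightarrow> all_moments M (\<lambda>\<omega>. cnj (X \<omega>))"
  using measurable_compose[of X M borel cnj borel, OF _ borel_measurable_continuous_onI[OF continuous_on_cnj[OF continuous_on_id]]]
  by (auto simp: all_moments_def)

lemma all_moments_norm_le:
  assumes "all_moments M X" "Y \<in> borel_measurable M" "\<And>\<omega>. norm (Y \<omega>) \<le> norm (X \<omega>)"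
  shows "all_moments M Y"
proof -
  have "integrable M (\<lambda>\<omega>. norm (Y \<omega>) ^ p)" for p
  proof (rule Bochner_Integration.integrable_bound[OF all_moments_norm_power[OF assms(1), of p]])
    show "(\<lambda>\<omega>. norm (Y \<omega>) ^ p) \<in> borel_measurable M" using assms(2) by measurable
    show "AE \<omega> in M. norm (norm (Y \<omega>) ^ p) \<le> norm (norm (X \<omega>) ^ p)" using assms(3) by (simp add: power_mono)
  qed
  then show ?thesis using assms(2) by (simp add: all_moments_def)
qed

lemma all_moments_Re [intro]: "all_moments M X \<Longrightarrow> all_moments M (\<lambda>\<omega>. Re (X \<omega>))"
  by (rule all_moments_norm_le) (auto simp: abs_Re_le_cmod all_moments_def)

lemma all_moments_Im [intro]: "all_moments M X \<Longrightarrow> all_moments M (\<lambda>\<omega>. Im (X \<omega>))"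
  by (rule all_moments_norm_le) (auto simp: abs_Im_le_cmod all_moments_def)

lemma (in prob_space) all_moments_sum [intro]:
  "(\<And>i. i \<in> I \<Longrightarrow> all_moments M (X i)) \<Longrightarrow> all_moments M (\<lambda>\<omega>. \<Sum>i\<in>I. X i \<omega>)"
  by (induction I rule: infinite_finite_induct) auto

lemma (in prob_space) all_moments_power [intro]:
  "all_moments M X \<Longrightarrow> all_moments M (\<lambda>\<omega>. X \<omega> ^ p)"
  by (induction p) auto

lemma (in prob_space) all_moments_diff [intro]:
  assumes "all_moments M X" "all_moments M Y"
  shows "all_moments M (\<lambda>\<omega>. X \<omega> - Y \<omega>)"
  using all_moments_add[OF assms(1) all_moments_mult[OF all_moments_const[of "-1"] assms(2)]] by simp

text \<open>Only the moments of the standard complex normal law that enter the second-order expansion;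
  the exponential moments control all the others.\<close>

definition std_gauss_rv :: "'a measure \<Rightarrow> ('a \<Rightarrow> complex) \<Rightarrow> bool" where
  "std_gauss_rv M Z \<longleftrightarrow> Z \<in> borel_measurable M \<and>
    (\<forall>a\<le>2. \<forall>b\<le>2. has_bochner_integral M (\<lambda>\<omega>. Z \<omega> ^ a * cnj (Z \<omega>) ^ b) (if a = b then fact a else 0)) \<and>
    (\<forall>c. has_bochner_integral M (\<lambda>\<omega>. exp (Re (c * Z \<omega>))) (exp ((cmod c)\<^sup>2 / 4)))"

text \<open>Multiplying by sqrt n brings the variance to 1, so that the constants below do not
  depend on \<open>n\<close>.\<close>

lemma std_gauss_rv_scaled:
  assumes X: "X \<in> borel_measurable M" and d: "distr M borel X = cgauss (1 / real n)" and n: "0 < n"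
  shows "std_gauss_rv M (\<lambda>\<omega>. complex_of_real (sqrt (real n)) * X \<omega>)"
  unfolding std_gauss_rv_def
proof (intro conjI allI impI)
  let ?r = "complex_of_real (sqrt (real n))"
  have v: "0 < 1 / real n" using n by simp
  show "(\<lambda>\<omega>. ?r * X \<omega>) \<in> borel_measurable M" using X by measurable
  fix a b :: nat assume ab: "a \<le> 2" "b \<le> 2"
  have "has_bochner_integral M (\<lambda>\<omega>. (?r ^ a * ?r ^ b) * (X \<omega> ^ a * cnj (X \<omega>) ^ b))
      ((?r ^ a * ?r ^ b) * complex_of_real (if a = b then fact a * (1 / real n) ^ a else 0))"
    using has_bochner_integral_of_distr[OF X d cgauss_moment[OF v ab]] by (rule has_bochner_integral_mult_right)
  moreover have "(?r ^ a * ?r ^ b) * complex_of_real (if a = b then fact a * (1 / real n) ^ a else 0) = (if a = b then fact a else 0)"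
  proof (cases "a = b")
    case True
    have "?r ^ a * ?r ^ a = complex_of_real (real n) ^ a"
      by (simp add: power_mult_distrib[symmetric] flip: of_real_mult)
    then show ?thesis using True n by (simp add: power_divide)
  qed simp
  moreover have "(?r ^ a * ?r ^ b) * (X \<omega> ^ a * cnj (X \<omega>) ^ b) = (?r * X \<omega>) ^ a * cnj (?r * X \<omega>) ^ b" for \<omega>
    by (simp add: power_mult_distrib)
  ultimately show "has_bochner_integral M (\<lambda>\<omega>. (?r * X \<omega>) ^ a * cnj (?r * X \<omega>) ^ b) (if a = b then fact a else 0)"
    by (simp only:)
next
  fix c
  have v: "0 < 1 / real n" using n by simp
  have "has_bochner_integral M (\<lambda>\<omega>. exp (Re ((c * complex_of_real (sqrt (real n))) * X \<omega>)))
    (exp ((cmod (c * complex_of_real (sqrt (real n))))\<^sup>2 * (1 / real n) / 4))"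
    by (rule has_bochner_integral_of_distr[OF X d cgauss_exp[OF v]])
  moreover have "(cmod (c * complex_of_real (sqrt (real n))))\<^sup>2 * (1 / real n) = (cmod c)\<^sup>2"
    using n by (simp add: norm_mult power_mult_distrib)
  ultimately show "has_bochner_integral M (\<lambda>\<omega>. exp (Re (c * (complex_of_real (sqrt (real n)) * X \<omega>)))) (exp ((cmod c)\<^sup>2 / 4))"
    by (simp only: mult.assoc)
qed

text \<open>A power is, up to the factorial, a single term of the exponential series.\<close>

lemma power_le_fact_exp:
  fixes x :: real
  shows "\<bar>x\<bar> ^ p \<le> fact p * (exp x + exp (- x))"
proof -
  have *: "y ^ p \<le> fact p * exp y" if "0 \<le> y" for y :: real
  proof -
    have "(\<Sum>k\<in>{p}. inverse (fact k) * y ^ k) \<le> (\<Sum>k. inverse (fact k) * y ^ k)"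
      using that summable_exp[of y] by (intro sum_le_suminf) auto
    then have "inverse (fact p) * y ^ p \<le> exp y" by (simp add: exp_def)
    then show ?thesis by (simp add: field_simps)
  qed
  have "\<bar>x\<bar> ^ p \<le> fact p * exp \<bar>x\<bar>" by (rule *) simp
  also have "\<dots> \<le> fact p * (exp x + exp (- x))" by (intro mult_left_mono) (auto simp: abs_if)
  finally show ?thesis .
qed

text \<open>The four exponentials are exp (Re (c z)) for c = 1, -1, -i and i, whose means are known
  explicitly for Gaussian linear forms.\<close>

lemma cmod_power_le_exp:
  "cmod z ^ p \<le> 2 ^ p * fact p * (exp (Re z) + exp (- Re z) + exp (Im z) + exp (- Im z))"
proof -
  have "cmod z ^ p \<le> (\<bar>Re z\<bar> + \<bar>Im z\<bar>) ^ p" by (intro power_mono cmod_le) auto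
  also have "\<dots> \<le> 2 ^ p * (\<bar>Re z\<bar> ^ p + \<bar>Im z\<bar> ^ p)" by (rule power_add_le) auto
  also have "\<dots> \<le> 2 ^ p * (fact p * (exp (Re z) + exp (- Re z)) + fact p * (exp (Im z) + exp (- Im z)))"
    by (intro mult_left_mono add_mono power_le_fact_exp) auto
  finally show ?thesis by (simp add: algebra_simps)
qed

section \<open>Linear forms and mixed moments of independent Gaussian variables\<close>

context prob_space
begin

text \<open>Independence turns the mean of a product into a product of means; the result depends on
  the coefficients only through the sum of their squared moduli.\<close>

lemma linear_form_exp:
  assumes ind: "indep_vars (\<lambda>_. borel) Z I" and fin: "finite I" and Z: "\<And>k. k \<in> I \<Longrightarrow> std_gauss_rv M (Z k)"
  shows "has_bochner_integral M (\<lambda>\<omega>. exp (Re (a * (\<Sum>k\<in>I. c k * Z k \<omega>)))) (exp ((cmod a)\<^sup>2 * (\<Sum>k\<in>I. (cmod (c k))\<^sup>2) / 4))"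
proof (cases "I = {}")
  case True then show ?thesis by (simp add: has_bochner_integral_iff prob_space)
next
  case False
  let ?f = "\<lambda>k \<omega>. exp (Re (a * c k * Z k \<omega>))"
  have "indep_vars (\<lambda>_. borel) (\<lambda>k. (\<lambda>z. exp (Re (a * c k * z))) \<circ> Z k) I"
    by (rule indep_vars_compose[OF ind]) measurable
  then have ind': "indep_vars (\<lambda>_. borel) ?f I" by (simp add: o_def)
  have f: "has_bochner_integral M (?f k) (exp ((cmod (a * c k))\<^sup>2 / 4))" if "k \<in> I" for k
    using Z[OF that] unfolding std_gauss_rv_def by blast
  have int: "\<And>k. k \<in> I \<Longrightarrow> integrable M (?f k)" using f by (auto simp: has_bochner_integral_iff)
  have "has_bochner_integral M (\<lambda>\<omega>. \<Prod>k\<in>I. ?f k \<omega>) (\<Prod>k\<in>I. exp ((cmod (a * c k))\<^sup>2 / 4))"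
    using indep_vars_integrable[OF fin ind' int] indep_vars_lebesgue_integral[OF fin ind' int] f
    by (auto simp: has_bochner_integral_iff intro!: prod.cong)
  moreover have "(\<Prod>k\<in>I. ?f k \<omega>) = exp (Re (a * (\<Sum>k\<in>I. c k * Z k \<omega>)))" for \<omega>
    by (simp only: exp_sum[OF fin, symmetric] sum_distrib_left mult.assoc Re_sum)
  moreover have "(\<Prod>k\<in>I. exp ((cmod (a * c k))\<^sup>2 / 4)) = exp ((cmod a)\<^sup>2 * (\<Sum>k\<in>I. (cmod (c k))\<^sup>2) / 4)"
    by (simp only: exp_sum[OF fin, symmetric] norm_mult power_mult_distrib sum_distrib_left sum_divide_distrib)
  ultimately show ?thesis by (simp only:)
qed

text \<open>The bound does not involve the number of variables as long as the squared coefficients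
  sum to at most 1. This uniformity matters because the number of transmit antennas tends to
  infinity.\<close>

lemma linear_form_moments:
  fixes c :: "'i \<Rightarrow> complex"
  assumes ind: "indep_vars (\<lambda>_. borel) Z I" and fin: "finite I" and Z: "\<And>k. k \<in> I \<Longrightarrow> std_gauss_rv M (Z k)"
  defines "W \<equiv> (\<lambda>\<omega>. \<Sum>k\<in>I. c k * Z k \<omega>)"
  shows "all_moments M W"
    and "(\<Sum>k\<in>I. (cmod (c k))\<^sup>2) \<le> 1 \<Longrightarrow> expectation (\<lambda>\<omega>. cmod (W \<omega>) ^ p) \<le> 2 ^ p * fact p * (4 * exp (1 / 4))"
proof -
  define q where "q = (\<Sum>k\<in>I. (cmod (c k))\<^sup>2)"
  have E: "has_bochner_integral M (\<lambda>\<omega>. exp (Re (a * W \<omega>))) (exp ((cmod a)\<^sup>2 * q / 4))" for a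
    unfolding W_def q_def by (rule linear_form_exp[OF ind fin Z])
  have Wm: "W \<in> borel_measurable M"
    unfolding W_def using Z unfolding std_gauss_rv_def
    by (intro borel_measurable_sum borel_measurable_times borel_measurable_const) blast
  have e: "has_bochner_integral M (\<lambda>\<omega>. exp (Re (W \<omega>))) (exp (q / 4))" "has_bochner_integral M (\<lambda>\<omega>. exp (- Re (W \<omega>))) (exp (q / 4))"
    "has_bochner_integral M (\<lambda>\<omega>. exp (Im (W \<omega>))) (exp (q / 4))" "has_bochner_integral M (\<lambda>\<omega>. exp (- Im (W \<omega>))) (exp (q / 4))"
    using E[of 1] E[of "-1"] E[of "-\<i>"] E[of \<i>] by simp_all
  have b: "has_bochner_integral M (\<lambda>\<omega>. 2 ^ p * fact p * (exp (Re (W \<omega>)) + exp (- Re (W \<omega>)) + exp (Im (W \<omega>)) + exp (- Im (W \<omega>))))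
      (2 ^ p * fact p * (exp (q / 4) + exp (q / 4) + exp (q / 4) + exp (q / 4)))" for p
    by (intro has_bochner_integral_mult_right has_bochner_integral_add e)
  have int: "integrable M (\<lambda>\<omega>. cmod (W \<omega>) ^ p)" for p
  proof (rule Bochner_Integration.integrable_bound)
    show "integrable M (\<lambda>\<omega>. 2 ^ p * fact p * (exp (Re (W \<omega>)) + exp (- Re (W \<omega>)) + exp (Im (W \<omega>)) + exp (- Im (W \<omega>))))"
      using b by (auto simp: has_bochner_integral_iff)
    show "(\<lambda>\<omega>. cmod (W \<omega>) ^ p) \<in> borel_measurable M" using Wm by measurable
    show "AE \<omega> in M. norm (cmod (W \<omega>) ^ p) \<le> norm (2 ^ p * fact p * (exp (Re (W \<omega>)) + exp (- Re (W \<omega>)) + exp (Im (W \<omega>)) + exp (- Im (W \<omega>))))"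
      by (intro AE_I2) (rule order_trans[OF _ abs_ge_self[THEN order_trans[OF cmod_power_le_exp]], folded real_norm_def], simp)
  qed
  then show "all_moments M W" using Wm by (auto simp: all_moments_def)
  assume q1: "(\<Sum>k\<in>I. (cmod (c k))\<^sup>2) \<le> 1"
  have "expectation (\<lambda>\<omega>. cmod (W \<omega>) ^ p) \<le> expectation (\<lambda>\<omega>. 2 ^ p * fact p * (exp (Re (W \<omega>)) + exp (- Re (W \<omega>)) + exp (Im (W \<omega>)) + exp (- Im (W \<omega>))))"
    using b by (intro integral_mono int cmod_power_le_exp) (auto simp: has_bochner_integral_iff)
  also have "\<dots> = 2 ^ p * fact p * (4 * exp (q / 4))" using b by (auto simp: has_bochner_integral_iff)
  also have "\<dots> \<le> 2 ^ p * fact p * (4 * exp (1 / 4))" using q1 by (simp add: q_def)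
  finally show "expectation (\<lambda>\<omega>. cmod (W \<omega>) ^ p) \<le> 2 ^ p * fact p * (4 * exp (1 / 4))" .
qed

lemma mixed_moment:
  assumes ind: "indep_vars (\<lambda>_. borel) Z I" and fin: "finite I" and Z: "\<And>k. k \<in> I \<Longrightarrow> std_gauss_rv M (Z k)"
    and \<alpha>: "\<And>i. \<alpha> i \<le> 2" and \<beta>: "\<And>i. \<beta> i \<le> (2::nat)"
  shows "has_bochner_integral M (\<lambda>\<omega>. (\<Prod>i\<in>I. Z i \<omega> ^ \<alpha> i) * (\<Prod>i\<in>I. cnj (Z i \<omega>) ^ \<beta> i))
    (\<Prod>i\<in>I. if \<alpha> i = \<beta> i then fact (\<alpha> i) else 0)"
proof (cases "I = {}")
  case True then show ?thesis by (simp add: has_bochner_integral_iff prob_space)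
next
  case False
  let ?f = "\<lambda>k \<omega>. Z k \<omega> ^ \<alpha> k * cnj (Z k \<omega>) ^ \<beta> k"
  have "indep_vars (\<lambda>_. borel) (\<lambda>k. (\<lambda>z. z ^ \<alpha> k * cnj z ^ \<beta> k) \<circ> Z k) I"
    by (rule indep_vars_compose[OF ind]) (intro borel_measurable_continuous_onI continuous_intros)
  then have ind': "indep_vars (\<lambda>_. borel) ?f I" by (simp add: o_def)
  have f: "has_bochner_integral M (?f k) (if \<alpha> k = \<beta> k then fact (\<alpha> k) else 0)" if "k \<in> I" for k
    using Z[OF that] \<alpha> \<beta> by (simp add: std_gauss_rv_def)
  have int: "\<And>k. k \<in> I \<Longrightarrow> integrable M (?f k)" using f by (auto simp: has_bochner_integral_iff)
  have "has_bochner_integral M (\<lambda>\<omega>. \<Prod>k\<in>I. ?f k \<omega>) (\<Prod>i\<in>I. if \<alpha> i = \<beta> i then fact (\<alpha> i) else 0)"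
    using indep_vars_integrable[OF fin ind' int] indep_vars_lebesgue_integral[OF fin ind' int] f
    by (auto simp: has_bochner_integral_iff intro!: prod.cong)
  then show ?thesis by (simp only: prod.distrib)
qed

lemma second_mixed_moment:
  assumes ind: "indep_vars (\<lambda>_. borel) Z I" and fin: "finite I" and Z: "\<And>k. k \<in> I \<Longrightarrow> std_gauss_rv M (Z k)"
    and kl: "k \<in> I" "l \<in> I"
  shows "has_bochner_integral M (\<lambda>\<omega>. Z k \<omega> * cnj (Z l \<omega>)) (if k = l then 1 else 0)"
proof -
  let ?\<delta> = "\<lambda>k i. if i = k then 1 else (0::nat)"
  have pw: "(\<Prod>i\<in>I. (x i :: complex) ^ ?\<delta> k i) = x k" if "k \<in> I" for x k
    using fin that by (simp add: if_distrib cong: if_cong)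
  have "(\<Prod>i\<in>I. if ?\<delta> k i = ?\<delta> l i then fact (?\<delta> k i) else 0) = (if k = l then 1 else (0::complex))"
    using fin kl by (cases "k = l") (auto intro!: prod.neutral simp: prod_zero_iff)
  moreover have "has_bochner_integral M (\<lambda>\<omega>. (\<Prod>i\<in>I. Z i \<omega> ^ ?\<delta> k i) * (\<Prod>i\<in>I. cnj (Z i \<omega>) ^ ?\<delta> l i))
      (\<Prod>i\<in>I. if ?\<delta> k i = ?\<delta> l i then fact (?\<delta> k i) else 0)"
    by (rule mixed_moment[OF ind fin Z]) auto
  ultimately show ?thesis by (simp only: pw[OF kl(1)] pw[OF kl(2)])
qed

text \<open>Wick's formula: each of the two pairings of a variable with a conjugate contributes 1.
  If all four indices agree both contribute, which gives the value 2 of the fourth absolute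
  moment.\<close>

lemma fourth_mixed_moment:
  assumes ind: "indep_vars (\<lambda>_. borel) Z I" and fin: "finite I" and Z: "\<And>k. k \<in> I \<Longrightarrow> std_gauss_rv M (Z k)"
    and I: "k \<in> I" "l \<in> I" "m \<in> I" "n \<in> I"
  shows "has_bochner_integral M (\<lambda>\<omega>. Z k \<omega> * cnj (Z l \<omega>) * (Z m \<omega> * cnj (Z n \<omega>)))
    ((if k = l \<and> m = n then 1 else 0) + (if k = n \<and> m = l then 1 else 0))"
proof -
  let ?\<delta> = "\<lambda>k i. if i = k then 1 else (0::nat)"
  let ?e = "\<lambda>i. if ?\<delta> k i + ?\<delta> m i = ?\<delta> l i + ?\<delta> n i then fact (?\<delta> k i + ?\<delta> m i) else (0::complex)"
  have pw: "(\<Prod>i\<in>I. (x i :: complex) ^ ?\<delta> k i) = x k" if "k \<in> I" for x k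
    using fin that by (simp add: if_distrib cong: if_cong)
  have pw2: "(\<Prod>i\<in>I. (x i :: complex) ^ (?\<delta> k i + ?\<delta> m i)) = x k * x m" if "k \<in> I" "m \<in> I" for x k m
    unfolding power_add prod.distrib using pw that by simp
  \<comment> \<open>Indices other than the four contribute the factor 1; what remains is a finite
    case distinction on coincidences.\<close>
  have "(\<Prod>i\<in>I. ?e i) = (\<Prod>i\<in>{k, l, m, n}. ?e i)"
    using fin I by (intro prod.mono_neutral_right) auto
  also have "\<dots> = (if k = l \<and> m = n then 1 else 0) + (if k = n \<and> m = l then 1 else 0)"
    by (cases "k = l"; cases "k = m"; cases "k = n"; cases "l = m"; cases "l = n"; cases "m = n") (auto simp: fact_numeral)
  finally have e: "(\<Prod>i\<in>I. ?e i) = (if k = l \<and> m = n then 1 else 0) + (if k = n \<and> m = l then 1 else 0)" .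
  have "has_bochner_integral M (\<lambda>\<omega>. (\<Prod>i\<in>I. Z i \<omega> ^ (?\<delta> k i + ?\<delta> m i)) * (\<Prod>i\<in>I. cnj (Z i \<omega>) ^ (?\<delta> l i + ?\<delta> n i))) (\<Prod>i\<in>I. ?e i)"
    by (rule mixed_moment[OF ind fin Z]) auto
  moreover have "(\<Prod>i\<in>I. Z i \<omega> ^ (?\<delta> k i + ?\<delta> m i)) * (\<Prod>i\<in>I. cnj (Z i \<omega>) ^ (?\<delta> l i + ?\<delta> n i)) = Z k \<omega> * cnj (Z l \<omega>) * (Z m \<omega> * cnj (Z n \<omega>))" for \<omega>
    by (simp only: pw2[OF I(1,3)] pw2[OF I(2,4)] mult_ac)
  ultimately show ?thesis unfolding e by (simp only:)
qed

text \<open>The blocks before \<open>m\<close> and block \<open>m\<close> are disjoint parts of an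
  independent family. The moment inductions draw on independence between summands only through this
  rule.\<close>

lemma expectation_split_prefix:
  fixes f g :: "_ \<Rightarrow> 'b :: {real_normed_field, banach, second_countable_topology}" and m n :: nat
  assumes ind: "indep_vars N Y {..<n}" and m: "m < n"
    and f: "f \<in> borel_measurable (PiM {..<m} N)" and g: "g \<in> borel_measurable (N m)"
    and If: "integrable M (\<lambda>\<omega>. f (\<lambda>i\<in>{..<m}. Y i \<omega>))" and Ig: "integrable M (\<lambda>\<omega>. g (Y m \<omega>))"
  shows "expectation (\<lambda>\<omega>. f (\<lambda>i\<in>{..<m}. Y i \<omega>) * g (Y m \<omega>)) =
    expectation (\<lambda>\<omega>. f (\<lambda>i\<in>{..<m}. Y i \<omega>)) * expectation (\<lambda>\<omega>. g (Y m \<omega>))"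
proof -
  have "indep_var (PiM {..<m} N) (\<lambda>\<omega>. \<lambda>i\<in>{..<m}. Y i \<omega>) (PiM {m} N) (\<lambda>\<omega>. \<lambda>i\<in>{m}. Y i \<omega>)"
    using m by (intro indep_var_restrict[OF ind]) auto
  then have "indep_var borel (f \<circ> (\<lambda>\<omega>. \<lambda>i\<in>{..<m}. Y i \<omega>)) borel ((\<lambda>h. g (h m)) \<circ> (\<lambda>\<omega>. \<lambda>i\<in>{m}. Y i \<omega>))"
    by (rule indep_var_compose) (use f g in \<open>auto intro!: measurable_compose[OF measurable_component_singleton]\<close>)
  then have iv: "indep_var borel (\<lambda>\<omega>. f (\<lambda>i\<in>{..<m}. Y i \<omega>)) borel (\<lambda>\<omega>. g (Y m \<omega>))"
    by (simp add: o_def)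
  show ?thesis by (rule indep_var_lebesgue_integral[OF iv If Ig])
qed

end

section \<open>Moments of the Wishart deviation\<close>

context prob_space
begin

text \<open>The summand is kept as a function \<open>a s\<close> of the block \<open>Y s\<close>,
  not as a random variable, because independence of the blocks is what is known; the number
  \<open>m\<close> of terms is the induction variable.\<close>

definition prefix_sum :: "(nat \<Rightarrow> 'c \<Rightarrow> 'b::comm_monoid_add) \<Rightarrow> (nat \<Rightarrow> 'a \<Rightarrow> 'c) \<Rightarrow> nat \<Rightarrow> 'a \<Rightarrow> 'b" where
  "prefix_sum a Y m \<omega> = (\<Sum>s<m. a s (Y s \<omega>))"

lemma prefix_sum_0 [simp]: "prefix_sum a Y 0 \<omega> = 0"
  and prefix_sum_Suc: "prefix_sum a Y (Suc m) \<omega> = prefix_sum a Y m \<omega> + a m (Y m \<omega>)"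
  by (simp_all add: prefix_sum_def)

lemma prefix_sum_restrict: "prefix_sum a Y m \<omega> = (\<Sum>s<m. a s ((\<lambda>i\<in>{..<m}. Y i \<omega>) s))"
  by (simp add: prefix_sum_def)

lemma prefix_sum_measurable:
  fixes a :: "nat \<Rightarrow> 'c \<Rightarrow> 'b :: {real_normed_field, banach, second_countable_topology}"
  assumes "\<And>s. s < m \<Longrightarrow> a s \<in> borel_measurable (N s)"
  shows "(\<lambda>h. \<Sum>s<m. a s (h s)) \<in> borel_measurable (PiM {..<m} N)"
  using assms by (intro borel_measurable_sum measurable_compose[OF measurable_component_singleton]) auto

lemma all_moments_prefix_sum:
  assumes "\<And>s. s < m \<Longrightarrow> all_moments M (\<lambda>\<omega>. a s (Y s \<omega>))"
  shows "all_moments M (prefix_sum a Y m)"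
  using assms unfolding prefix_sum_def[abs_def] by (intro all_moments_sum) auto

lemma expectation_prefix_sum:
  assumes "\<And>s. s < m \<Longrightarrow> all_moments M (\<lambda>\<omega>. a s (Y s \<omega>))"
  shows "expectation (prefix_sum a Y m) = (\<Sum>s<m. expectation (\<lambda>\<omega>. a s (Y s \<omega>)))"
  unfolding prefix_sum_def[abs_def] using assms by (intro Bochner_Integration.integral_sum all_moments_integrable) auto

text \<open>Two different families are allowed, since different entries of the deviation matrix get
  multiplied. Adding term \<open>m\<close> creates mixed products of an old sum with a centred new
  factor, which have mean zero.\<close>

lemma expectation_prefix_product2:
  fixes a b :: "nat \<Rightarrow> 'c \<Rightarrow> 'b :: {real_normed_field, banach, second_countable_topology}"
  assumes ind: "indep_vars N Y {..<n}" and m: "m \<le> n"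
    and meas: "\<And>s. s < n \<Longrightarrow> a s \<in> borel_measurable (N s)" "\<And>s. s < n \<Longrightarrow> b s \<in> borel_measurable (N s)"
    and mom: "\<And>s. s < n \<Longrightarrow> all_moments M (\<lambda>\<omega>. a s (Y s \<omega>))" "\<And>s. s < n \<Longrightarrow> all_moments M (\<lambda>\<omega>. b s (Y s \<omega>))"
    and zero: "\<And>s. s < n \<Longrightarrow> expectation (\<lambda>\<omega>. a s (Y s \<omega>)) = 0" "\<And>s. s < n \<Longrightarrow> expectation (\<lambda>\<omega>. b s (Y s \<omega>)) = 0"
  shows "expectation (\<lambda>\<omega>. prefix_sum a Y m \<omega> * prefix_sum b Y m \<omega>) = (\<Sum>s<m. expectation (\<lambda>\<omega>. a s (Y s \<omega>) * b s (Y s \<omega>)))"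
  using m
proof (induction m)
  case (Suc m)
  then have m: "m < n" by simp
  let ?A = "prefix_sum a Y m" and ?B = "prefix_sum b Y m"
  let ?a = "\<lambda>\<omega>. a m (Y m \<omega>)" and ?b = "\<lambda>\<omega>. b m (Y m \<omega>)"
  have AB: "all_moments M ?A" "all_moments M ?B" using m mom by (auto intro!: all_moments_prefix_sum)
  have ab: "all_moments M ?a" "all_moments M ?b" using m mom by auto
  note intg = all_moments_integrable all_moments_mult AB ab
  have pm: "(\<lambda>h. \<Sum>s<m. a s (h s)) \<in> borel_measurable (PiM {..<m} N)" "(\<lambda>h. \<Sum>s<m. b s (h s)) \<in> borel_measurable (PiM {..<m} N)"
    using m meas by (auto intro!: prefix_sum_measurable)
  have Ab: "expectation (\<lambda>\<omega>. ?A \<omega> * ?b \<omega>) = 0" "expectation (\<lambda>\<omega>. ?B \<omega> * ?a \<omega>) = 0"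
    unfolding prefix_sum_restrict
    by (subst expectation_split_prefix[OF ind m]; use pm meas m zero in \<open>simp add: prefix_sum_restrict[symmetric] intg del: restrict_apply\<close>)+
  have "expectation (\<lambda>\<omega>. prefix_sum a Y (Suc m) \<omega> * prefix_sum b Y (Suc m) \<omega>) =
      expectation (\<lambda>\<omega>. ?A \<omega> * ?B \<omega> + ?A \<omega> * ?b \<omega> + ?B \<omega> * ?a \<omega> + ?a \<omega> * ?b \<omega>)"
    by (intro Bochner_Integration.integral_cong) (auto simp: prefix_sum_Suc algebra_simps)
  also have "\<dots> = expectation (\<lambda>\<omega>. ?A \<omega> * ?B \<omega>) + expectation (\<lambda>\<omega>. ?A \<omega> * ?b \<omega>) + expectation (\<lambda>\<omega>. ?B \<omega> * ?a \<omega>) + expectation (\<lambda>\<omega>. ?a \<omega> * ?b \<omega>)"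
    by (simp add: intg)
  finally show ?case using Suc Ab by simp
qed simp

text \<open>In a product of three centred sums a term survives only if all three indices agree;
  otherwise one index occurs alone. Hence the mean grows linearly in \<open>m\<close>, and after
  division by n^3 the third moment is of order 1 / n^2, where the size of the factors alone would
  suggest n^(-3/2).\<close>

lemma expectation_prefix_product3:
  fixes a b c :: "nat \<Rightarrow> 'c \<Rightarrow> 'b :: {real_normed_field, banach, second_countable_topology}"
  assumes ind: "indep_vars N Y {..<n}" and m: "m \<le> n"
    and meas: "\<And>s. s < n \<Longrightarrow> a s \<in> borel_measurable (N s)" "\<And>s. s < n \<Longrightarrow> b s \<in> borel_measurable (N s)" "\<And>s. s < n \<Longrightarrow> c s \<in> borel_measurable (N s)"
    and mom: "\<And>s. s < n \<Longrightarrow> all_moments M (\<lambda>\<omega>. a s (Y s \<omega>))" "\<And>s. s < n \<Longrightarrow> all_moments M (\<lambda>\<omega>. b s (Y s \<omega>))" "\<And>s. s < n \<Longrightarrow> all_moments M (\<lambda>\<omega>. c s (Y s \<omega>))"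
    and zero: "\<And>s. s < n \<Longrightarrow> expectation (\<lambda>\<omega>. a s (Y s \<omega>)) = 0" "\<And>s. s < n \<Longrightarrow> expectation (\<lambda>\<omega>. b s (Y s \<omega>)) = 0" "\<And>s. s < n \<Longrightarrow> expectation (\<lambda>\<omega>. c s (Y s \<omega>)) = 0"
  shows "expectation (\<lambda>\<omega>. prefix_sum a Y m \<omega> * prefix_sum b Y m \<omega> * prefix_sum c Y m \<omega>) =
    (\<Sum>s<m. expectation (\<lambda>\<omega>. a s (Y s \<omega>) * b s (Y s \<omega>) * c s (Y s \<omega>)))"
  using m
proof (induction m)
  case (Suc m)
  then have m: "m < n" by simp
  let ?A = "prefix_sum a Y m" and ?B = "prefix_sum b Y m" and ?C = "prefix_sum c Y m"
  let ?a = "\<lambda>\<omega>. a m (Y m \<omega>)" and ?b = "\<lambda>\<omega>. b m (Y m \<omega>)" and ?c = "\<lambda>\<omega>. c m (Y m \<omega>)"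
  have AB: "all_moments M ?A" "all_moments M ?B" "all_moments M ?C" using m mom by (auto intro!: all_moments_prefix_sum)
  have ab: "all_moments M ?a" "all_moments M ?b" "all_moments M ?c" using m mom by auto
  note intg = all_moments_integrable all_moments_mult AB ab
  have pm: "(\<lambda>h. \<Sum>s<m. a s (h s)) \<in> borel_measurable (PiM {..<m} N)" "(\<lambda>h. \<Sum>s<m. b s (h s)) \<in> borel_measurable (PiM {..<m} N)"
      "(\<lambda>h. \<Sum>s<m. c s (h s)) \<in> borel_measurable (PiM {..<m} N)"
    using m meas by (auto intro!: prefix_sum_measurable)
  have EA: "expectation ?A = 0" "expectation ?B = 0" "expectation ?C = 0"
    using m mom zero by (simp_all add: expectation_prefix_sum)
  have two: "expectation (\<lambda>\<omega>. ?A \<omega> * ?B \<omega> * ?c \<omega>) = 0" "expectation (\<lambda>\<omega>. ?A \<omega> * ?C \<omega> * ?b \<omega>) = 0" "expectation (\<lambda>\<omega>. ?B \<omega> * ?C \<omega> * ?a \<omega>) = 0"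
    unfolding prefix_sum_restrict
    by (subst expectation_split_prefix[OF ind m, where f="\<lambda>h. (\<Sum>s<m. a s (h s)) * (\<Sum>s<m. b s (h s))"]
        expectation_split_prefix[OF ind m, where f="\<lambda>h. (\<Sum>s<m. a s (h s)) * (\<Sum>s<m. c s (h s))"]
        expectation_split_prefix[OF ind m, where f="\<lambda>h. (\<Sum>s<m. b s (h s)) * (\<Sum>s<m. c s (h s))"];
        use pm meas m zero in \<open>simp add: prefix_sum_restrict[symmetric] intg del: restrict_apply\<close>)+
  have one: "expectation (\<lambda>\<omega>. ?A \<omega> * (?b \<omega> * ?c \<omega>)) = 0" "expectation (\<lambda>\<omega>. ?B \<omega> * (?a \<omega> * ?c \<omega>)) = 0" "expectation (\<lambda>\<omega>. ?C \<omega> * (?a \<omega> * ?b \<omega>)) = 0"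
    unfolding prefix_sum_restrict
    by (subst expectation_split_prefix[OF ind m, where g="\<lambda>y. b m y * c m y"]
        expectation_split_prefix[OF ind m, where g="\<lambda>y. a m y * c m y"]
        expectation_split_prefix[OF ind m, where g="\<lambda>y. a m y * b m y"];
        use pm meas m EA in \<open>simp add: prefix_sum_restrict[symmetric] intg del: restrict_apply\<close>)+
  have "expectation (\<lambda>\<omega>. prefix_sum a Y (Suc m) \<omega> * prefix_sum b Y (Suc m) \<omega> * prefix_sum c Y (Suc m) \<omega>) =
      expectation (\<lambda>\<omega>. ?A \<omega> * ?B \<omega> * ?C \<omega> + ?A \<omega> * ?B \<omega> * ?c \<omega> + ?A \<omega> * ?C \<omega> * ?b \<omega> + ?B \<omega> * ?C \<omega> * ?a \<omega>
        + ?A \<omega> * (?b \<omega> * ?c \<omega>) + ?B \<omega> * (?a \<omega> * ?c \<omega>) + ?C \<omega> * (?a \<omega> * ?b \<omega>) + ?a \<omega> * ?b \<omega> * ?c \<omega>)"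
    by (intro Bochner_Integration.integral_cong) (auto simp: prefix_sum_Suc algebra_simps)
  also have "\<dots> = expectation (\<lambda>\<omega>. ?A \<omega> * ?B \<omega> * ?C \<omega>) + expectation (\<lambda>\<omega>. ?A \<omega> * ?B \<omega> * ?c \<omega>) + expectation (\<lambda>\<omega>. ?A \<omega> * ?C \<omega> * ?b \<omega>)
      + expectation (\<lambda>\<omega>. ?B \<omega> * ?C \<omega> * ?a \<omega>) + expectation (\<lambda>\<omega>. ?A \<omega> * (?b \<omega> * ?c \<omega>)) + expectation (\<lambda>\<omega>. ?B \<omega> * (?a \<omega> * ?c \<omega>))
      + expectation (\<lambda>\<omega>. ?C \<omega> * (?a \<omega> * ?b \<omega>)) + expectation (\<lambda>\<omega>. ?a \<omega> * ?b \<omega> * ?c \<omega>)"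
    by (simp add: intg)
  finally show ?case using Suc one two by simp
qed simp

text \<open>In the fourth power pairs of equal indices survive as well, so the growth is quadratic.
  It is stated for real summands, where even powers are nonnegative; complex deviations are treated
  through real and imaginary part.\<close>

lemma expectation_prefix_fourth:
  fixes x :: "nat \<Rightarrow> 'c \<Rightarrow> real"
  assumes ind: "indep_vars N Y {..<n}" and m: "m \<le> n"
    and meas: "\<And>s. s < n \<Longrightarrow> x s \<in> borel_measurable (N s)"
    and mom: "\<And>s. s < n \<Longrightarrow> all_moments M (\<lambda>\<omega>. x s (Y s \<omega>))"
    and zero: "\<And>s. s < n \<Longrightarrow> expectation (\<lambda>\<omega>. x s (Y s \<omega>)) = 0"
    and b2: "\<And>s. s < n \<Longrightarrow> expectation (\<lambda>\<omega>. x s (Y s \<omega>) ^ 2) \<le> \<mu>"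
    and b4: "\<And>s. s < n \<Longrightarrow> expectation (\<lambda>\<omega>. x s (Y s \<omega>) ^ 4) \<le> \<mu>" and \<mu>: "1 \<le> \<mu>"
  shows "expectation (\<lambda>\<omega>. prefix_sum x Y m \<omega> ^ 4) \<le> 3 * (real m)\<^sup>2 * \<mu>\<^sup>2 + real m * \<mu>"
  using m
proof (induction m)
  case (Suc m)
  then have m: "m < n" by simp
  let ?A = "prefix_sum x Y m"
  let ?x = "\<lambda>\<omega>. x m (Y m \<omega>)"
  have A: "all_moments M ?A" using m mom by (auto intro!: all_moments_prefix_sum)
  have a: "all_moments M ?x" using m mom by auto
  note intg = all_moments_integrable all_moments_mult all_moments_power A a
  have pm: "(\<lambda>h. \<Sum>s<m. x s (h s)) \<in> borel_measurable (PiM {..<m} N)"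
    using m meas by (auto intro!: prefix_sum_measurable)
  have EA: "expectation ?A = 0" using m mom zero by (simp add: expectation_prefix_sum)
  have EA2: "expectation (\<lambda>\<omega>. ?A \<omega> ^ 2) \<le> real m * \<mu>"
  proof -
    have "expectation (\<lambda>\<omega>. ?A \<omega> ^ 2) = (\<Sum>s<m. expectation (\<lambda>\<omega>. x s (Y s \<omega>) ^ 2))"
      unfolding power2_eq_square using m by (intro expectation_prefix_product2[OF ind _ meas meas mom mom zero zero]) auto
    also have "\<dots> \<le> (\<Sum>s<m. \<mu>)" using m b2 by (intro sum_mono) auto
    finally show ?thesis by simp
  qed
  have split: "expectation (\<lambda>\<omega>. ?A \<omega> ^ p * ?x \<omega> ^ q) = expectation (\<lambda>\<omega>. ?A \<omega> ^ p) * expectation (\<lambda>\<omega>. ?x \<omega> ^ q)" for p q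
    unfolding prefix_sum_restrict
    by (subst expectation_split_prefix[OF ind m, where f="\<lambda>h. (\<Sum>s<m. x s (h s)) ^ p" and g="\<lambda>y. x m y ^ q"];
        use pm meas m in \<open>simp add: prefix_sum_restrict[symmetric] intg del: restrict_apply\<close>)
  have "expectation (\<lambda>\<omega>. prefix_sum x Y (Suc m) \<omega> ^ 4) =
      expectation (\<lambda>\<omega>. ?A \<omega> ^ 4 + 4 * (?A \<omega> ^ 3 * ?x \<omega> ^ 1) + 6 * (?A \<omega> ^ 2 * ?x \<omega> ^ 2) + 4 * (?A \<omega> ^ 1 * ?x \<omega> ^ 3) + ?x \<omega> ^ 4)"
    by (intro Bochner_Integration.integral_cong) (auto simp: prefix_sum_Suc power2_eq_square power3_eq_cube power4_eq_xxxx algebra_simps)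
  also have "\<dots> = expectation (\<lambda>\<omega>. ?A \<omega> ^ 4) + 4 * expectation (\<lambda>\<omega>. ?A \<omega> ^ 3 * ?x \<omega> ^ 1) + 6 * expectation (\<lambda>\<omega>. ?A \<omega> ^ 2 * ?x \<omega> ^ 2)
      + 4 * expectation (\<lambda>\<omega>. ?A \<omega> ^ 1 * ?x \<omega> ^ 3) + expectation (\<lambda>\<omega>. ?x \<omega> ^ 4)"
    by (simp add: intg del: power_one_right)
  also have "\<dots> = expectation (\<lambda>\<omega>. ?A \<omega> ^ 4) + 6 * (expectation (\<lambda>\<omega>. ?A \<omega> ^ 2) * expectation (\<lambda>\<omega>. ?x \<omega> ^ 2)) + expectation (\<lambda>\<omega>. ?x \<omega> ^ 4)"
    unfolding split using zero[OF m] EA by simp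
  also have "\<dots> \<le> (3 * (real m)\<^sup>2 * \<mu>\<^sup>2 + real m * \<mu>) + 6 * (real m * \<mu> * \<mu>) + \<mu>"
  proof (intro add_mono mult_left_mono mult_mono)
    show "expectation (\<lambda>\<omega>. ?A \<omega> ^ 4) \<le> 3 * (real m)\<^sup>2 * \<mu>\<^sup>2 + real m * \<mu>" using Suc by simp
  qed (use EA2 b2 b4 m \<mu> in auto)
  \<comment> \<open>The 6 m from the mixed squares fits because 3 (m + 1)^2 exceeds 3 m^2 by 6 m +
    3.\<close>
  also have "\<dots> \<le> 3 * (real (Suc m))\<^sup>2 * \<mu>\<^sup>2 + real (Suc m) * \<mu>"
    by (simp add: power2_eq_square algebra_simps)
  finally show ?case .
qed simp

end

text \<open>Meant for the fourth moment of one centred product of two linear forms: the factor with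
  \<open>fact 8\<close> bounds the eighth moment of each form, 16 = 2^4 comes from splitting the
  fourth power of a sum, and the leading 1 leaves room for bounding a second moment by 1 plus the
  fourth.\<close>

definition gauss_form_bound :: real where
  "gauss_form_bound = 1 + 16 * (2 * (2 ^ 8 * fact 8 * (4 * exp (1 / 4))) + 1)"

text \<open>128 = 16 * (4 + 4): 16 from splitting into real and imaginary part, 4 from the
  fourth-moment bound of each. It also covers the three terms of the third-moment bound.\<close>

definition wishart_bound :: real where
  "wishart_bound = 128 * gauss_form_bound\<^sup>2"

lemma gauss_form_bound_ge_1: "1 \<le> gauss_form_bound"
  by (simp add: gauss_form_bound_def)

lemma wishart_bound_ge: "3 * gauss_form_bound \<le> wishart_bound" "0 \<le> wishart_bound"
proof -
  have "3 * gauss_form_bound \<le> 128 * (gauss_form_bound * gauss_form_bound)"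
    using mult_mono[OF gauss_form_bound_ge_1 order_refl[of gauss_form_bound]] gauss_form_bound_ge_1 by simp
  then show "3 * gauss_form_bound \<le> wishart_bound" by (simp add: wishart_bound_def power2_eq_square)
qed (simp add: wishart_bound_def)

text \<open>Orthogonality of the coefficient rows makes the linear forms of one column uncorrelated,
  \<open>p i \<le> 1\<close> bounds the variances after rescaling, and the columns are independent;
  so \<open>X\<close> is an average of \<open>n\<close> independent centred products. The bounds are
  free of the dimension \<open>r\<close>.\<close>

theorem (in prob_space) wishart_deviation_moments:
  fixes c :: "nat \<Rightarrow> nat \<Rightarrow> complex" and p :: "nat \<Rightarrow> real"
  assumes S: "iid_cgauss_mat M r n (1 / real n) S" and n: "0 < n"
    and orth: "\<And>i j. i \<in> J \<Longrightarrow> j \<in> J \<Longrightarrow> (\<Sum>k<r. c i k * cnj (c j k)) = (if i = j then complex_of_real (p i) else 0)"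
    and p: "\<And>i. i \<in> J \<Longrightarrow> p i \<le> 1"
  defines "w \<equiv> (\<lambda>i s \<omega>. \<Sum>k<r. c i k * S \<omega> $$ (k, s))"
  defines "X \<equiv> (\<lambda>i j \<omega>. (\<Sum>s<n. w i s \<omega> * cnj (w j s \<omega>)) - (if i = j then complex_of_real (p i) else 0))"
  shows "\<And>i j. i \<in> J \<Longrightarrow> j \<in> J \<Longrightarrow> all_moments M (X i j)"
    and "\<And>i j. i \<in> J \<Longrightarrow> j \<in> J \<Longrightarrow> expectation (X i j) = 0"
    and "\<And>i j k. i \<in> J \<Longrightarrow> j \<in> J \<Longrightarrow> k \<in> J \<Longrightarrow> expectation (\<lambda>\<omega>. X i k \<omega> * X k j \<omega>) = (if i = j then complex_of_real (p i * p k / real n) else 0)"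
    and "\<And>i j k l. i \<in> J \<Longrightarrow> j \<in> J \<Longrightarrow> k \<in> J \<Longrightarrow> l \<in> J \<Longrightarrow> cmod (expectation (\<lambda>\<omega>. X i k \<omega> * X k l \<omega> * X l j \<omega>)) \<le> wishart_bound / (real n)\<^sup>2"
    and "\<And>i j. i \<in> J \<Longrightarrow> j \<in> J \<Longrightarrow> expectation (\<lambda>\<omega>. cmod (X i j \<omega>) ^ 4) \<le> wishart_bound / (real n)\<^sup>2"
proof -
  \<comment> \<open>Rescaling by sqrt n moves the variance 1 / n out of the entries and in front of
    the sum over columns.\<close>
  define rn where "rn = complex_of_real (sqrt (real n))"
  define Z where "Z = (\<lambda>q \<omega>. rn * S \<omega> $$ q)"
  \<comment> \<open>Index set of column s. The columns, as functions on \<open>K s\<close>, are the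
    independent blocks.\<close>
  define K where "K = (\<lambda>s :: nat. {..<r} \<times> {s})"
  define W where "W = (\<lambda>i s \<omega>. \<Sum>q\<in>K s. c i (fst q) * Z q \<omega>)"
  define \<delta> where "\<delta> = (\<lambda>i j. if i = j then complex_of_real (p i) else 0)"
  \<comment> \<open>The centred product as a function of the entries of one column, the form that
    the moment inductions require; evaluated at the random column it is
    \<open>\<xi>\<close>.\<close>
  define g where "g = (\<lambda>i j s h. (\<Sum>q\<in>K s. c i (fst q) * h q) * cnj (\<Sum>q\<in>K s. c j (fst q) * h q) - \<delta> i j)"
  define N where "N = (\<lambda>s. Pi\<^sub>M (K s) (\<lambda>_. borel :: complex measure))"
  define Y where "Y = (\<lambda>s \<omega>. \<lambda>q\<in>K s. Z q \<omega>)"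
  define \<xi> where "\<xi> = (\<lambda>i j s \<omega>. W i s \<omega> * cnj (W j s \<omega>) - \<delta> i j)"
  have sumK: "(\<Sum>q\<in>K s. f q) = (\<Sum>k<r. f (k, s))" for f :: "nat \<times> nat \<Rightarrow> complex" and s
    unfolding K_def using sum.cartesian_product[of "\<lambda>k s. f (k, s)" "{s}" "{..<r}"] by simp
  have finK [simp]: "finite (K s)" for s by (simp add: K_def)
  have rn2: "rn * cnj rn = complex_of_real (real n)"
    by (simp add: rn_def flip: of_real_mult)
  have indS: "indep_vars (\<lambda>_. borel) (\<lambda>q \<omega>. S \<omega> $$ q) ({..<r} \<times> {..<n})"
    and dS: "\<And>q. q \<in> {..<r} \<times> {..<n} \<Longrightarrow> distr M borel (\<lambda>\<omega>. S \<omega> $$ q) = cgauss (1 / real n)"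
    using S by (auto simp: iid_cgauss_mat_def)
  have mS: "(\<lambda>\<omega>. S \<omega> $$ q) \<in> borel_measurable M" if "q \<in> {..<r} \<times> {..<n}" for q
    using indS that by (auto simp: indep_vars_def)
  have Zg: "std_gauss_rv M (Z q)" if "q \<in> {..<r} \<times> {..<n}" for q
    unfolding Z_def rn_def by (rule std_gauss_rv_scaled[OF mS[OF that] dS[OF that] n])
  have "indep_vars (\<lambda>_. borel) (\<lambda>q. (\<lambda>z. rn * z) \<circ> (\<lambda>\<omega>. S \<omega> $$ q)) ({..<r} \<times> {..<n})"
    by (rule indep_vars_compose[OF indS]) measurable
  then have indZ: "indep_vars (\<lambda>_. borel) Z ({..<r} \<times> {..<n})" by (simp add: o_def Z_def)
  have Ksub: "K s \<subseteq> {..<r} \<times> {..<n}" if "s < n" for s using that by (auto simp: K_def)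
  have indY: "indep_vars N Y {..<n}"
    unfolding N_def Y_def by (rule indep_vars_restrict[OF indZ]) (auto simp: Ksub disjoint_family_on_def K_def)
  have indK: "indep_vars (\<lambda>_. borel) Z (K s)" if "s < n" for s
    by (rule indep_vars_subset[OF indZ Ksub[OF that]])
  have ZK: "std_gauss_rv M (Z q)" if "s < n" "q \<in> K s" for s q using Zg Ksub that by blast
  have gY: "g i j s (Y s \<omega>) = \<xi> i j s \<omega>" for i j s \<omega>
    by (simp add: g_def Y_def \<xi>_def W_def)
  have gm: "g i j s \<in> borel_measurable (N s)" for i j s
  proof -
    have "(\<lambda>h. \<Sum>q\<in>K s. c i (fst q) * h q) \<in> borel_measurable (N s)" for i
      unfolding N_def by (intro borel_measurable_sum borel_measurable_times borel_measurable_const measurable_component_singleton)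
    moreover from this have "(\<lambda>h. cnj (\<Sum>q\<in>K s. c j (fst q) * h q)) \<in> borel_measurable (N s)"
      by (rule measurable_compose[OF _ borel_measurable_continuous_onI[OF continuous_on_cnj[OF continuous_on_id]]])
    ultimately show ?thesis unfolding g_def by (intro borel_measurable_diff borel_measurable_times) auto
  qed
  have Wmom: "all_moments M (W i s)" if "s < n" for i s
    unfolding W_def by (rule linear_form_moments(1)[OF indK[OF that] finK ZK[OF that]])
  have psum: "(\<Sum>q\<in>K s. (cmod (c i (fst q)))\<^sup>2) \<le> 1" if "i \<in> J" for i s
  proof -
    have "complex_of_real (\<Sum>q\<in>K s. (cmod (c i (fst q)))\<^sup>2) = (\<Sum>k<r. c i k * cnj (c i k))"
      by (simp only: of_real_sum complex_norm_square sumK fst_conv)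
    also have "\<dots> = complex_of_real (p i)" using orth[OF that that] by simp
    finally show ?thesis using p[OF that] by (simp only: of_real_eq_iff)
  qed
  have W8: "expectation (\<lambda>\<omega>. cmod (W i s \<omega>) ^ 8) \<le> 2 ^ 8 * fact 8 * (4 * exp (1 / 4))" if "s < n" "i \<in> J" for i s
    unfolding W_def by (rule linear_form_moments(2)[OF indK[OF that(1)] finK ZK[OF that(1)] psum[OF that(2)]])
  have \<xi>mom: "all_moments M (\<xi> i j s)" if "s < n" for i j s
    unfolding \<xi>_def using Wmom[OF that] by (intro all_moments_diff all_moments_mult all_moments_cnj) auto
  have \<delta>1: "cmod (\<delta> i j) \<le> 1" if "i \<in> J" for i j
  proof -
    have "0 \<le> p i"
    proof -
      have "complex_of_real (p i) = complex_of_real (\<Sum>k<r. (cmod (c i k))\<^sup>2)"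
        using orth[OF that that] by (simp only: of_real_sum complex_norm_square if_True refl)
      then show ?thesis by (simp only: of_real_eq_iff) (simp add: sum_nonneg)
    qed
    then show ?thesis using p[OF that] by (auto simp: \<delta>_def)
  qed
  have \<xi>4: "expectation (\<lambda>\<omega>. cmod (\<xi> i j s \<omega>) ^ 4) \<le> gauss_form_bound - 1" if s: "s < n" and ij: "i \<in> J" "j \<in> J" for i j s
  proof -
    have pt: "cmod (\<xi> i j s \<omega>) ^ 4 \<le> 16 * (cmod (W i s \<omega>) ^ 8 + cmod (W j s \<omega>) ^ 8 + 1)" for \<omega>
    proof -
      have "cmod (\<xi> i j s \<omega>) \<le> cmod (W i s \<omega>) * cmod (W j s \<omega>) + 1"
        unfolding \<xi>_def using norm_triangle_ineq4[of "W i s \<omega> * cnj (W j s \<omega>)" "\<delta> i j"] \<delta>1[OF ij(1), of j] by (simp add: norm_mult)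
      then have "cmod (\<xi> i j s \<omega>) ^ 4 \<le> (cmod (W i s \<omega>) * cmod (W j s \<omega>) + 1) ^ 4" by (intro power_mono) auto
      also have "\<dots> \<le> 2 ^ 4 * ((cmod (W i s \<omega>) * cmod (W j s \<omega>)) ^ 4 + 1 ^ 4)" by (rule power_add_le) auto
      also have "(cmod (W i s \<omega>) * cmod (W j s \<omega>)) ^ 4 \<le> cmod (W i s \<omega>) ^ 8 + cmod (W j s \<omega>) ^ 8"
      proof -
        have "u * v \<le> u\<^sup>2 + v\<^sup>2" if "0 \<le> u" "0 \<le> v" for u v :: real
          using zero_le_power2[of "u - v"] mult_nonneg_nonneg[OF that] by (simp only: power2_diff)
        from this[of "cmod (W i s \<omega>) ^ 4" "cmod (W j s \<omega>) ^ 4"] show ?thesis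
          by (simp add: power_mult_distrib flip: power_mult)
      qed
      finally show ?thesis by simp
    qed
    have i8: "integrable M (\<lambda>\<omega>. cmod (W i s \<omega>) ^ 8)" for i by (rule all_moments_norm_power[OF Wmom[OF s]])
    have "expectation (\<lambda>\<omega>. cmod (\<xi> i j s \<omega>) ^ 4) \<le> expectation (\<lambda>\<omega>. 16 * (cmod (W i s \<omega>) ^ 8 + cmod (W j s \<omega>) ^ 8 + 1))"
      by (intro integral_mono pt all_moments_norm_power[OF \<xi>mom[OF s]]) (simp add: i8)
    also have "\<dots> = 16 * (expectation (\<lambda>\<omega>. cmod (W i s \<omega>) ^ 8) + expectation (\<lambda>\<omega>. cmod (W j s \<omega>) ^ 8) + 1)"
      by (simp add: i8 prob_space)
    also have "\<dots> \<le> gauss_form_bound - 1"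
      using W8[OF s ij(1)] W8[OF s ij(2)] by (simp add: gauss_form_bound_def)
    finally show ?thesis .
  qed
  have EWW: "expectation (\<lambda>\<omega>. W i s \<omega> * cnj (W j s \<omega>)) = \<delta> i j" if s: "s < n" and ij: "i \<in> J" "j \<in> J" for i j s
  proof -
    have "has_bochner_integral M (\<lambda>\<omega>. \<Sum>a\<in>K s. \<Sum>b\<in>K s. (c i (fst a) * cnj (c j (fst b))) * (Z a \<omega> * cnj (Z b \<omega>)))
      (\<Sum>a\<in>K s. \<Sum>b\<in>K s. (c i (fst a) * cnj (c j (fst b))) * (if a = b then 1 else 0))"
      by (intro has_bochner_integral_sum has_bochner_integral_mult_right second_mixed_moment[OF indK[OF s] finK ZK[OF s]])
    moreover have "(\<Sum>a\<in>K s. \<Sum>b\<in>K s. (c i (fst a) * cnj (c j (fst b))) * (Z a \<omega> * cnj (Z b \<omega>))) = W i s \<omega> * cnj (W j s \<omega>)" for \<omega>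
      unfolding W_def cnj_sum sum_product by (simp add: mult_ac)
    moreover have "(\<Sum>a\<in>K s. \<Sum>b\<in>K s. (c i (fst a) * cnj (c j (fst b))) * (if a = b then 1 else 0)) = \<delta> i j"
      using orth[OF ij] by (simp add: if_distrib[where f="\<lambda>x. _ * x"] sumK \<delta>_def cong: if_cong)
    ultimately show ?thesis by (simp add: has_bochner_integral_iff)
  qed
  have E\<xi>: "expectation (\<xi> i j s) = 0" if s: "s < n" and ij: "i \<in> J" "j \<in> J" for i j s
  proof -
    have "integrable M (\<lambda>\<omega>. W i s \<omega> * cnj (W j s \<omega>))"
      using Wmom[OF s] by (intro all_moments_integrable all_moments_mult all_moments_cnj)
    then show ?thesis unfolding \<xi>_def using EWW[OF s ij] by (simp add: prob_space)
  qed
  \<comment> \<open>Of the two pairings in Wick's formula, the first is the product of means and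
    cancels in the centred version; the second yields
    \<open>\<delta> i j * \<delta> k k\<close>.\<close>
  have E4: "expectation (\<lambda>\<omega>. (W i s \<omega> * cnj (W k s \<omega>)) * (W k s \<omega> * cnj (W j s \<omega>))) = \<delta> i k * \<delta> k j + \<delta> i j * \<delta> k k"
    if s: "s < n" and J: "i \<in> J" "j \<in> J" "k \<in> J" for i j k s
  proof -
    let ?C = "\<lambda>a b d e. (c i (fst a) * cnj (c k (fst b))) * (c k (fst d) * cnj (c j (fst e)))"
    have "has_bochner_integral M (\<lambda>\<omega>. \<Sum>a\<in>K s. \<Sum>b\<in>K s. \<Sum>d\<in>K s. \<Sum>e\<in>K s. ?C a b d e * (Z a \<omega> * cnj (Z b \<omega>) * (Z d \<omega> * cnj (Z e \<omega>))))
      (\<Sum>a\<in>K s. \<Sum>b\<in>K s. \<Sum>d\<in>K s. \<Sum>e\<in>K s. ?C a b d e * ((if a = b \<and> d = e then 1 else 0) + (if a = e \<and> d = b then 1 else 0)))"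
      by (intro has_bochner_integral_sum has_bochner_integral_mult_right fourth_mixed_moment[OF indK[OF s] finK ZK[OF s]])
    moreover have "(\<Sum>a\<in>K s. \<Sum>b\<in>K s. \<Sum>d\<in>K s. \<Sum>e\<in>K s. ?C a b d e * (Z a \<omega> * cnj (Z b \<omega>) * (Z d \<omega> * cnj (Z e \<omega>))))
        = (W i s \<omega> * cnj (W k s \<omega>)) * (W k s \<omega> * cnj (W j s \<omega>))" for \<omega>
    proof -
      have WW: "W i s \<omega> * cnj (W k s \<omega>) = (\<Sum>a\<in>K s. \<Sum>b\<in>K s. (c i (fst a) * cnj (c k (fst b))) * (Z a \<omega> * cnj (Z b \<omega>)))" for i k
        unfolding W_def cnj_sum sum_product by (simp add: mult_ac)
      show ?thesis unfolding WW sum_distrib_right unfolding sum_distrib_left by (simp only: mult_ac)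
    qed
    moreover have "(\<Sum>a\<in>K s. \<Sum>b\<in>K s. \<Sum>d\<in>K s. \<Sum>e\<in>K s. ?C a b d e * ((if a = b \<and> d = e then 1 else 0) + (if a = e \<and> d = b then 1 else 0)))
        = \<delta> i k * \<delta> k j + \<delta> i j * \<delta> k k"
    proof -
      have dl: "(\<Sum>a\<in>K s. c i (fst a) * cnj (c j (fst a))) = \<delta> i j" if "i \<in> J" "j \<in> J" for i j
        using orth[OF that] by (simp add: sumK \<delta>_def)
      have s1: "(\<Sum>e\<in>K s. ?C a b d e * (if a = b \<and> d = e then 1 else 0)) = (if a = b then ?C a b d d else 0)" if "d \<in> K s" for a b d
        using that by (cases "a = b") (simp_all add: if_distrib[where f="\<lambda>x. _ * x"] cong: if_cong)
      have s2: "(\<Sum>e\<in>K s. ?C a b d e * (if a = e \<and> d = b then 1 else 0)) = (if d = b then ?C a b d a else 0)" if "a \<in> K s" for a b d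
        using that by (cases "d = b") (simp_all add: if_distrib[where f="\<lambda>x. _ * x"] cong: if_cong)
      have "(\<Sum>a\<in>K s. \<Sum>b\<in>K s. \<Sum>d\<in>K s. \<Sum>e\<in>K s. ?C a b d e * ((if a = b \<and> d = e then 1 else 0) + (if a = e \<and> d = b then 1 else 0)))
        = (\<Sum>a\<in>K s. \<Sum>b\<in>K s. \<Sum>d\<in>K s. (if a = b then ?C a b d d else 0) + (if d = b then ?C a b d a else 0))"
        by (intro sum.cong refl) (simp only: distrib_left sum.distrib s1 s2)
      also have "\<dots> = (\<Sum>a\<in>K s. \<Sum>d\<in>K s. ?C a a d d) + (\<Sum>a\<in>K s. \<Sum>b\<in>K s. ?C a b b a)"
      proof -
        have "(\<Sum>b\<in>K s. \<Sum>d\<in>K s. (if a = b then ?C a b d d else 0)) = (\<Sum>d\<in>K s. ?C a a d d)" if "a \<in> K s" for a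
          using that by (subst sum.swap) simp
        moreover have "(\<Sum>d\<in>K s. (if d = b then ?C a b d a else 0)) = ?C a b b a" if "b \<in> K s" for a b
          using that by simp
        ultimately show ?thesis by (simp add: sum.distrib)
      qed
      also have "(\<Sum>a\<in>K s. \<Sum>d\<in>K s. ?C a a d d) =
          (\<Sum>a\<in>K s. c i (fst a) * cnj (c k (fst a))) * (\<Sum>d\<in>K s. c k (fst d) * cnj (c j (fst d)))"
        by (rule sum_product[symmetric])
      also have "(\<Sum>a\<in>K s. \<Sum>b\<in>K s. ?C a b b a) =
          (\<Sum>a\<in>K s. c i (fst a) * cnj (c j (fst a))) * (\<Sum>b\<in>K s. c k (fst b) * cnj (c k (fst b)))"
        unfolding sum_product by (intro sum.cong refl) (simp only: mult_ac)
      finally show ?thesis unfolding dl[OF J(1,3)] dl[OF J(3,2)] dl[OF J(1,2)] dl[OF J(3,3)] .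
    qed
    ultimately show ?thesis unfolding has_bochner_integral_iff by (simp only:)
  qed
  have E\<xi>2: "expectation (\<lambda>\<omega>. \<xi> i k s \<omega> * \<xi> k j s \<omega>) = \<delta> i j * \<delta> k k" if s: "s < n" and J: "i \<in> J" "j \<in> J" "k \<in> J" for i j k s
  proof -
    have int: "integrable M (\<lambda>\<omega>. W i s \<omega> * cnj (W k s \<omega>))" "integrable M (\<lambda>\<omega>. W k s \<omega> * cnj (W j s \<omega>))"
      "integrable M (\<lambda>\<omega>. (W i s \<omega> * cnj (W k s \<omega>)) * (W k s \<omega> * cnj (W j s \<omega>)))"
      using Wmom[OF s] by (intro all_moments_integrable all_moments_mult all_moments_cnj; blast)+
    have "expectation (\<lambda>\<omega>. \<xi> i k s \<omega> * \<xi> k j s \<omega>) = expectation (\<lambda>\<omega>. (W i s \<omega> * cnj (W k s \<omega>)) * (W k s \<omega> * cnj (W j s \<omega>))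
        - \<delta> k j * (W i s \<omega> * cnj (W k s \<omega>)) - \<delta> i k * (W k s \<omega> * cnj (W j s \<omega>)) + \<delta> i k * \<delta> k j)"
      unfolding \<xi>_def by (intro Bochner_Integration.integral_cong refl) (simp add: algebra_simps)
    also have "\<dots> = (\<delta> i k * \<delta> k j + \<delta> i j * \<delta> k k) - \<delta> k j * \<delta> i k - \<delta> i k * \<delta> k j + \<delta> i k * \<delta> k j"
      using int by (simp add: prob_space E4[OF s J] EWW[OF s J(1,3)] EWW[OF s J(3,2)])
    finally show ?thesis by simp
  qed
  have X_eq: "X i j \<omega> = prefix_sum (g i j) Y n \<omega> / complex_of_real (real n)" for i j \<omega>
  proof -
    have "W i s \<omega> = rn * w i s \<omega>" for i s by (simp add: W_def Z_def w_def sumK sum_distrib_left mult_ac)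
    then have "W i s \<omega> * cnj (W j s \<omega>) = complex_of_real (real n) * (w i s \<omega> * cnj (w j s \<omega>))" for s
      using rn2 by (simp add: mult_ac)
    then have "prefix_sum (g i j) Y n \<omega> = complex_of_real (real n) * (\<Sum>s<n. w i s \<omega> * cnj (w j s \<omega>)) - complex_of_real (real n) * \<delta> i j"
      unfolding prefix_sum_def gY \<xi>_def by (simp add: sum_subtractf sum_distrib_left)
    then show ?thesis using n by (simp add: X_def \<delta>_def field_simps)
  qed
  have Smom: "all_moments M (prefix_sum (g i j) Y n)" for i j
    by (rule all_moments_prefix_sum) (simp add: gY \<xi>mom)
  show Xmom: "all_moments M (X i j)" if "i \<in> J" "j \<in> J" for i j
    unfolding X_eq divide_inverse by (intro all_moments_mult Smom all_moments_const)
  have gmom: "s < n \<Longrightarrow> all_moments M (\<lambda>\<omega>. g i j s (Y s \<omega>))" for i j s by (simp add: gY \<xi>mom)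
  have gzero: "s < n \<Longrightarrow> i \<in> J \<Longrightarrow> j \<in> J \<Longrightarrow> expectation (\<lambda>\<omega>. g i j s (Y s \<omega>)) = 0" for i j s
    using E\<xi> by (simp add: gY)
  show "expectation (X i j) = 0" if J: "i \<in> J" "j \<in> J" for i j
  proof -
    have "expectation (prefix_sum (g i j) Y n) = 0"
      using expectation_prefix_sum[of n "g i j" Y] gmom gzero J by simp
    then show ?thesis unfolding X_eq[abs_def] by simp
  qed
  show "expectation (\<lambda>\<omega>. X i k \<omega> * X k j \<omega>) = (if i = j then complex_of_real (p i * p k / real n) else 0)" if J: "i \<in> J" "j \<in> J" "k \<in> J" for i j k
  proof -
    have "expectation (\<lambda>\<omega>. prefix_sum (g i k) Y n \<omega> * prefix_sum (g k j) Y n \<omega>) = (\<Sum>s<n. expectation (\<lambda>\<omega>. g i k s (Y s \<omega>) * g k j s (Y s \<omega>)))"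
      using J by (intro expectation_prefix_product2[OF indY] gm gmom gzero) auto
    also have "\<dots> = of_nat n * (\<delta> i j * \<delta> k k)" using E\<xi>2 J by (simp add: gY)
    finally show ?thesis unfolding X_eq[abs_def] using n by (simp add: \<delta>_def field_simps)
  qed
  show "cmod (expectation (\<lambda>\<omega>. X i k \<omega> * X k l \<omega> * X l j \<omega>)) \<le> wishart_bound / (real n)\<^sup>2"
    if J: "i \<in> J" "j \<in> J" "k \<in> J" "l \<in> J" for i j k l
  proof -
    have b: "cmod (expectation (\<lambda>\<omega>. \<xi> i k s \<omega> * \<xi> k l s \<omega> * \<xi> l j s \<omega>)) \<le> wishart_bound" if s: "s < n" for s
    proof -
      \<comment> \<open>The maximum u of the three moduli satisfies u^3 <= 1 + u^4, so fourth
        moments control the product.\<close>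
      have pt: "cmod (x * y * z) \<le> 1 + cmod x ^ 4 + cmod y ^ 4 + cmod z ^ 4" for x y z :: complex
      proof -
        define u where "u = max (max (cmod x) (cmod y)) (cmod z)"
        have u: "0 \<le> u" "cmod x \<le> u" "cmod y \<le> u" "cmod z \<le> u" by (auto simp: u_def max_def)
        have "cmod (x * y * z) \<le> u * u * u" unfolding norm_mult using u by (intro mult_mono) auto
        also have "\<dots> \<le> 1 + u ^ 4"
        proof (cases "u \<le> 1")
          case True
          then have "u * u * u \<le> 1 * 1 * 1" using u by (intro mult_mono) auto
          then show ?thesis using zero_le_power[OF u(1), of 4] by linarith
        next
          case False
          then have "u * u * u * 1 \<le> u * u * u * u" by (intro mult_left_mono) auto
          then show ?thesis by (simp add: power4_eq_xxxx)
        qed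
        also have "u ^ 4 \<le> cmod x ^ 4 + cmod y ^ 4 + cmod z ^ 4" by (auto simp: u_def max_def)
        finally show ?thesis by simp
      qed
      have i4: "integrable M (\<lambda>\<omega>. cmod (\<xi> i k s \<omega>) ^ 4)" for i k by (rule all_moments_norm_power[OF \<xi>mom[OF s]])
      have "cmod (expectation (\<lambda>\<omega>. \<xi> i k s \<omega> * \<xi> k l s \<omega> * \<xi> l j s \<omega>)) \<le> expectation (\<lambda>\<omega>. cmod (\<xi> i k s \<omega> * \<xi> k l s \<omega> * \<xi> l j s \<omega>))"
        by (rule integral_norm_bound)
      also have "\<dots> \<le> expectation (\<lambda>\<omega>. 1 + cmod (\<xi> i k s \<omega>) ^ 4 + cmod (\<xi> k l s \<omega>) ^ 4 + cmod (\<xi> l j s \<omega>) ^ 4)"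
        by (intro integral_mono pt) (use \<xi>mom[OF s] in \<open>auto simp: i4 intro!: all_moments_integrable integrable_norm all_moments_mult\<close>)
      also have "\<dots> \<le> 3 * gauss_form_bound"
        using \<xi>4[OF s J(1,3)] \<xi>4[OF s J(3,4)] \<xi>4[OF s J(4,2)] by (simp add: i4 prob_space)
      finally show ?thesis using wishart_bound_ge(1) by linarith
    qed
    have "expectation (\<lambda>\<omega>. prefix_sum (g i k) Y n \<omega> * prefix_sum (g k l) Y n \<omega> * prefix_sum (g l j) Y n \<omega>) =
        (\<Sum>s<n. expectation (\<lambda>\<omega>. g i k s (Y s \<omega>) * g k l s (Y s \<omega>) * g l j s (Y s \<omega>)))"
      using J by (intro expectation_prefix_product3[OF indY] gm gmom gzero) auto
    then have P: "cmod (expectation (\<lambda>\<omega>. prefix_sum (g i k) Y n \<omega> * prefix_sum (g k l) Y n \<omega> * prefix_sum (g l j) Y n \<omega>)) \<le> (\<Sum>s<n. wishart_bound)"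
      unfolding gY by (simp only:) (intro order_trans[OF norm_sum] sum_mono b; simp)
    have "expectation (\<lambda>\<omega>. X i k \<omega> * X k l \<omega> * X l j \<omega>) =
      expectation (\<lambda>\<omega>. prefix_sum (g i k) Y n \<omega> * prefix_sum (g k l) Y n \<omega> * prefix_sum (g l j) Y n \<omega>) / complex_of_real (real n ^ 3)"
      unfolding X_eq[abs_def] by (simp add: power3_eq_cube mult_ac)
    then have "cmod (expectation (\<lambda>\<omega>. X i k \<omega> * X k l \<omega> * X l j \<omega>)) =
      cmod (expectation (\<lambda>\<omega>. prefix_sum (g i k) Y n \<omega> * prefix_sum (g k l) Y n \<omega> * prefix_sum (g l j) Y n \<omega>)) / real n ^ 3"
      by (simp only: norm_divide norm_of_real) simp
    also have "\<dots> \<le> (\<Sum>s<n. wishart_bound) / real n ^ 3" by (rule divide_right_mono[OF P]) simp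
    also have "\<dots> = wishart_bound / (real n)\<^sup>2" using n by (simp add: power2_eq_square power3_eq_cube)
    finally show ?thesis .
  qed
  show "expectation (\<lambda>\<omega>. cmod (X i j \<omega>) ^ 4) \<le> wishart_bound / (real n)\<^sup>2" if J: "i \<in> J" "j \<in> J" for i j
  proof -
    let ?G = gauss_form_bound
    \<comment> \<open>Real and imaginary part of the centred products; the linear term n G is
      absorbed into n^2 G^2, which turns the factor 3 into 4.\<close>
    have part: "expectation (\<lambda>\<omega>. prefix_sum (\<lambda>s y. f (g i j s y)) Y n \<omega> ^ 4) \<le> 4 * (real n)\<^sup>2 * ?G\<^sup>2"
      "all_moments M (prefix_sum (\<lambda>s y. f (g i j s y)) Y n)"
      if f: "f = Re \<or> f = Im" for f :: "complex \<Rightarrow> real"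
    proof -
      have fle: "\<bar>f z\<bar> \<le> cmod z" for z using f abs_Re_le_cmod abs_Im_le_cmod by blast
      have fm: "all_moments M (\<lambda>\<omega>. f (g i j s (Y s \<omega>)))" if "s < n" for s
        using f gmom[OF that, of i j] by auto
      have f0: "expectation (\<lambda>\<omega>. f (g i j s (Y s \<omega>))) = 0" if "s < n" for s
        using f gzero[OF that J] all_moments_integrable[OF gmom[OF that, of i j]] by (auto simp: integral_Re integral_Im)
      have f4: "expectation (\<lambda>\<omega>. f (g i j s (Y s \<omega>)) ^ 4) \<le> ?G - 1" if s: "s < n" for s
      proof -
        have "expectation (\<lambda>\<omega>. f (g i j s (Y s \<omega>)) ^ 4) \<le> expectation (\<lambda>\<omega>. cmod (\<xi> i j s \<omega>) ^ 4)"
        proof (intro integral_mono)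
          show "integrable M (\<lambda>\<omega>. f (g i j s (Y s \<omega>)) ^ 4)" using fm[OF s] by (intro all_moments_integrable all_moments_power)
          show "integrable M (\<lambda>\<omega>. cmod (\<xi> i j s \<omega>) ^ 4)" by (rule all_moments_norm_power[OF \<xi>mom[OF s]])
          show "f (g i j s (Y s \<omega>)) ^ 4 \<le> cmod (\<xi> i j s \<omega>) ^ 4" for \<omega>
            using power_mono[OF fle[of "\<xi> i j s \<omega>"], of 4] by (simp add: gY power_even_abs)
        qed
        then show ?thesis using \<xi>4[OF s J] by simp
      qed
      have f2: "expectation (\<lambda>\<omega>. f (g i j s (Y s \<omega>)) ^ 2) \<le> ?G" if s: "s < n" for s
      proof -
        have i4: "integrable M (\<lambda>\<omega>. f (g i j s (Y s \<omega>)) ^ 4)" using fm[OF s] by (intro all_moments_integrable all_moments_power)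
        have "expectation (\<lambda>\<omega>. f (g i j s (Y s \<omega>)) ^ 2) \<le> expectation (\<lambda>\<omega>. 1 + f (g i j s (Y s \<omega>)) ^ 4)"
        proof (intro integral_mono)
          show "integrable M (\<lambda>\<omega>. f (g i j s (Y s \<omega>)) ^ 2)" using fm[OF s] by (intro all_moments_integrable all_moments_power)
          show "integrable M (\<lambda>\<omega>. 1 + f (g i j s (Y s \<omega>)) ^ 4)" using i4 by simp
          have "y \<le> 1 + y\<^sup>2" if "0 \<le> y" for y :: real
            using zero_le_power2[of "y - 1"] that by (simp only: power2_diff) simp
          from this[of "f (g i j s (Y s \<omega>)) ^ 2" for \<omega>] show "f (g i j s (Y s \<omega>)) ^ 2 \<le> 1 + f (g i j s (Y s \<omega>)) ^ 4" for \<omega>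
            by (simp flip: power_mult)
        qed
        also have "\<dots> \<le> ?G" using f4[OF s] i4 by (simp add: prob_space)
        finally show ?thesis .
      qed
      have "f \<in> borel_measurable borel" using f by auto
      then have meas: "(\<lambda>y. f (g i j s y)) \<in> borel_measurable (N s)" for s using measurable_compose[OF gm] by blast
      have "expectation (\<lambda>\<omega>. prefix_sum (\<lambda>s y. f (g i j s y)) Y n \<omega> ^ 4) \<le> 3 * (real n)\<^sup>2 * ?G\<^sup>2 + real n * ?G"
      proof (rule expectation_prefix_fourth[OF indY order_refl, where x = "\<lambda>s y. f (g i j s y)" and \<mu> = ?G])
        show "expectation (\<lambda>\<omega>. f (g i j s (Y s \<omega>)) ^ 4) \<le> ?G" if "s < n" for s using f4[OF that] by linarith
      qed (use meas fm f0 f2 gauss_form_bound_ge_1 in auto)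
      also have "real n * ?G \<le> (real n)\<^sup>2 * ?G\<^sup>2"
        unfolding power2_eq_square using n gauss_form_bound_ge_1 by (intro mult_mono) (auto simp: mult_le_cancel_left1)
      finally show "expectation (\<lambda>\<omega>. prefix_sum (\<lambda>s y. f (g i j s y)) Y n \<omega> ^ 4) \<le> 4 * (real n)\<^sup>2 * ?G\<^sup>2" by linarith
      show "all_moments M (prefix_sum (\<lambda>s y. f (g i j s y)) Y n)" by (intro all_moments_prefix_sum fm)
    qed
    let ?P = "\<lambda>f. prefix_sum (\<lambda>s y. f (g i j s y)) Y n"
    have pi: "integrable M (\<lambda>\<omega>. ?P Re \<omega> ^ 4)" "integrable M (\<lambda>\<omega>. ?P Im \<omega> ^ 4)"
      using part(2)[of Re] part(2)[of Im] by (auto intro!: all_moments_integrable all_moments_power)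
    have pt: "cmod (X i j \<omega>) ^ 4 \<le> 16 * (?P Re \<omega> ^ 4 + ?P Im \<omega> ^ 4) / real n ^ 4" for \<omega>
    proof -
      have "cmod (prefix_sum (g i j) Y n \<omega>) \<le> \<bar>?P Re \<omega>\<bar> + \<bar>?P Im \<omega>\<bar>"
        using cmod_le[of "prefix_sum (g i j) Y n \<omega>"] by (simp add: prefix_sum_def)
      then have "cmod (prefix_sum (g i j) Y n \<omega>) ^ 4 \<le> (\<bar>?P Re \<omega>\<bar> + \<bar>?P Im \<omega>\<bar>) ^ 4" by (intro power_mono) auto
      also have "\<dots> \<le> 2 ^ 4 * (\<bar>?P Re \<omega>\<bar> ^ 4 + \<bar>?P Im \<omega>\<bar> ^ 4)" by (rule power_add_le) auto
      finally show ?thesis unfolding X_eq using n by (simp add: norm_divide power_divide divide_right_mono)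
    qed
    have "expectation (\<lambda>\<omega>. cmod (X i j \<omega>) ^ 4) \<le> expectation (\<lambda>\<omega>. 16 * (?P Re \<omega> ^ 4 + ?P Im \<omega> ^ 4) / real n ^ 4)"
      using pi by (intro integral_mono pt all_moments_norm_power[OF Xmom[OF J]]) auto
    also have "\<dots> = 16 * (expectation (\<lambda>\<omega>. ?P Re \<omega> ^ 4) + expectation (\<lambda>\<omega>. ?P Im \<omega> ^ 4)) / real n ^ 4" using pi by simp
    also have "\<dots> \<le> 16 * (4 * (real n)\<^sup>2 * ?G\<^sup>2 + 4 * (real n)\<^sup>2 * ?G\<^sup>2) / real n ^ 4"
      using part(1)[of Re] part(1)[of Im] by (intro divide_right_mono mult_left_mono add_mono) auto
    also have "\<dots> = wishart_bound / (real n)\<^sup>2" using n by (simp add: wishart_bound_def field_simps power2_eq_square power4_eq_xxxx)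
    finally show ?thesis .
  qed
qed

section \<open>Resolvent expansion\<close>

text \<open>This norm is submultiplicative, dominates single entries and is explicit in the entries,
  so its fourth moment reduces to fourth moments of entries.\<close>

definition fro_norm :: "complex mat \<Rightarrow> real" where
  "fro_norm A = L2_set (\<lambda>p. cmod (A $$ p)) ({..<dim_row A} \<times> {..<dim_col A})"

lemma fro_norm_nonneg [simp]: "0 \<le> fro_norm A"
  by (simp add: fro_norm_def L2_set_nonneg)

lemma fro_norm_square:
  assumes "A \<in> carrier_mat m n"
  shows "(fro_norm A)\<^sup>2 = (\<Sum>i<m. \<Sum>j<n. (cmod (A $$ (i, j)))\<^sup>2)"
  using assms by (simp add: fro_norm_def L2_set_def sum_nonneg sum.cartesian_product split_beta)

lemma entry_le_fro_norm:
  assumes "A \<in> carrier_mat m n" "i < m" "j < n"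
  shows "cmod (A $$ (i, j)) \<le> fro_norm A"
  using assms member_le_L2_set[of "{..<m} \<times> {..<n}" "(i, j)" "\<lambda>p. cmod (A $$ p)"]
  by (simp add: fro_norm_def)

lemma fro_norm_minus_le:
  assumes "A \<in> carrier_mat m n" "B \<in> carrier_mat m n"
  shows "fro_norm (A - B) \<le> fro_norm A + fro_norm B"
proof -
  let ?I = "{..<m} \<times> {..<n}"
  have "fro_norm (A - B) \<le> L2_set (\<lambda>p. cmod (A $$ p) + cmod (B $$ p)) ?I"
    unfolding fro_norm_def using assms by (auto simp: split_beta norm_triangle_ineq4 intro!: L2_set_mono)
  also have "\<dots> \<le> L2_set (\<lambda>p. cmod (A $$ p)) ?I + L2_set (\<lambda>p. cmod (B $$ p)) ?I"
    by (rule L2_set_triangle_ineq)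
  finally show ?thesis using assms by (simp add: fro_norm_def split_beta)
qed

text \<open>Cauchy-Schwarz in each entry, summed over all entries.\<close>

lemma fro_norm_mult_le:
  assumes A: "A \<in> carrier_mat l m" and B: "B \<in> carrier_mat m n"
  shows "fro_norm (A * B) \<le> fro_norm A * fro_norm B"
proof -
  have AB: "A * B \<in> carrier_mat l n" using A B by auto
  have entry: "(cmod ((A * B) $$ (i, j)))\<^sup>2 \<le> (\<Sum>k<m. (cmod (A $$ (i, k)))\<^sup>2) * (\<Sum>k<m. (cmod (B $$ (k, j)))\<^sup>2)"
    if "i < l" "j < n" for i j
  proof -
    have "cmod ((A * B) $$ (i, j)) \<le> (\<Sum>k<m. \<bar>cmod (A $$ (i, k))\<bar> * \<bar>cmod (B $$ (k, j))\<bar>)"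
      unfolding index_mult_sum[OF A B that] by (rule order_trans[OF norm_sum]) (simp add: norm_mult)
    also have "\<dots> \<le> L2_set (\<lambda>k. cmod (A $$ (i, k))) {..<m} * L2_set (\<lambda>k. cmod (B $$ (k, j))) {..<m}"
      by (rule L2_set_mult_ineq)
    finally have "(cmod ((A * B) $$ (i, j)))\<^sup>2 \<le> (L2_set (\<lambda>k. cmod (A $$ (i, k))) {..<m} * L2_set (\<lambda>k. cmod (B $$ (k, j))) {..<m})\<^sup>2"
      by (intro power_mono) auto
    then show ?thesis by (simp add: power_mult_distrib L2_set_def sum_nonneg)
  qed
  have "(fro_norm (A * B))\<^sup>2 \<le> (\<Sum>i<l. \<Sum>j<n. (\<Sum>k<m. (cmod (A $$ (i, k)))\<^sup>2) * (\<Sum>k<m. (cmod (B $$ (k, j)))\<^sup>2))"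
    unfolding fro_norm_square[OF AB] by (intro sum_mono entry) auto
  also have "\<dots> = (\<Sum>i<l. \<Sum>k<m. (cmod (A $$ (i, k)))\<^sup>2) * (\<Sum>j<n. \<Sum>k<m. (cmod (B $$ (k, j)))\<^sup>2)"
    by (rule sum_product[symmetric])
  also have "(\<Sum>j<n. \<Sum>k<m. (cmod (B $$ (k, j)))\<^sup>2) = (fro_norm B)\<^sup>2"
    unfolding fro_norm_square[OF B] by (rule sum.swap)
  finally have "(fro_norm (A * B))\<^sup>2 \<le> (fro_norm A * fro_norm B)\<^sup>2"
    by (simp add: fro_norm_square[OF A] power_mult_distrib)
  then show ?thesis by (rule power2_le_imp_le) simp
qed

text \<open>The remainder is exactly X^4 Z. The norm of \<open>Z\<close> itself is of the order of
  the square root of the dimension, so \<open>Z\<close> is not estimated alone: it commutes with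
  \<open>X\<close>, and V = Z X^2 satisfies V = X^2 - X V, which bounds its norm by twice that of
  X^2 when \<open>X\<close> is small.\<close>

lemma neumann_remainder:
  assumes X: "X \<in> carrier_mat d d" and Z: "Z \<in> carrier_mat d d" and XZ: "(1\<^sub>m d + X) * Z = 1\<^sub>m d"
    and small: "fro_norm X \<le> 1 / 2" and ij: "i < d" "j < d"
  shows "cmod (Z $$ (i, j) - (1\<^sub>m d $$ (i, j) - X $$ (i, j) + (X * X) $$ (i, j) - (X * X * X) $$ (i, j))) \<le> 2 * fro_norm X ^ 4"
proof -
  note simps = assoc_mult_mat[of _ d d _ d _ d] mult_carrier_mat[of _ d d _ d]
  have XX: "X * X \<in> carrier_mat d d" and XXX: "X * X * X \<in> carrier_mat d d" and XpZ: "X * Z \<in> carrier_mat d d" using X Z by auto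
  have IX: "1\<^sub>m d + X \<in> carrier_mat d d" using X by simp
  have ZX: "Z * (1\<^sub>m d + X) = 1\<^sub>m d" by (rule mat_mult_left_right_inverse[OF IX Z XZ])
  have e1: "Z + X * Z = 1\<^sub>m d" using XZ add_mult_distrib_mat[OF one_carrier_mat X Z] Z by simp
  have e2: "Z + Z * X = 1\<^sub>m d" using ZX mult_add_distrib_mat[OF Z one_carrier_mat X] Z by simp
  have d1: "Z $$ (i, j) = 1\<^sub>m d $$ (i, j) - (X * Z) $$ (i, j)" if "i < d" "j < d" for i j
    using arg_cong[OF e1, of "\<lambda>A. A $$ (i, j)"] that X Z by (simp add: eq_diff_eq del: index_mult_mat(1))
  \<comment> \<open>One step of the Neumann expansion with an arbitrary left factor; used for X, X^2
    and X^3.\<close>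
  have step: "(P * Z) $$ (i, j) = P $$ (i, j) - (P * X * Z) $$ (i, j)" if P: "P \<in> carrier_mat d d" and ij: "i < d" "j < d" for P i j
  proof -
    have "P * Z + P * (X * Z) = P"
      using mult_add_distrib_mat[OF P Z XpZ] e1 P by simp
    then have "(P * Z + P * (X * Z)) $$ (i, j) = P $$ (i, j)" by simp
    then show ?thesis using ij P X Z by (simp add: assoc_mult_mat[OF P X Z] del: index_mult_mat(1)) (simp add: algebra_simps)
  qed
  define V where "V = Z * (X * X)"
  have V: "V \<in> carrier_mat d d" using Z XX by (auto simp: V_def)
  have "X * Z = Z * X"
  proof -
    have "X * Z = (Z + Z * X) * X * Z" using e2 X by simp
    also have "\<dots> = Z * X * (Z + X * Z)" using X Z by (simp add: simps add_mult_distrib_mat[of _ d d _ _ d] mult_add_distrib_mat[of _ d d _ d])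
    also have "\<dots> = Z * X" unfolding e1 using X Z by simp
    finally show ?thesis .
  qed
  then have "X * (X * Z) = V"
    unfolding V_def using assoc_mult_mat[OF X Z X] assoc_mult_mat[OF Z X X] by simp
  then have comm: "X * X * X * X * Z = (X * X) * V"
    using X Z V by (simp add: simps)
  have "V = X * X - X * V"
  proof (rule eq_matI)
    fix i j assume "i < dim_row (X * X - X * V)" "j < dim_col (X * X - X * V)"
    then have ij: "i < d" "j < d" using X V by auto
    have "V + X * V = X * X"
      unfolding V_def using add_mult_distrib_mat[OF Z XpZ XX] e1 XX X Z assoc_mult_mat[OF X Z XX] by simp
    then have "(V + X * V) $$ (i, j) = (X * X) $$ (i, j)" by simp
    then show "V $$ (i, j) = (X * X - X * V) $$ (i, j)"
      using ij X V by (simp del: index_mult_mat(1)) (simp add: algebra_simps)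
  qed (use X V in auto)
  then have "fro_norm V \<le> fro_norm (X * X) + fro_norm (X * V)"
    using fro_norm_minus_le[OF XX mult_carrier_mat[OF X V]] by simp
  also have "fro_norm (X * V) \<le> fro_norm X * fro_norm V" by (rule fro_norm_mult_le[OF X V])
  also have "\<dots> \<le> 1 / 2 * fro_norm V" using small by (intro mult_right_mono) auto
  finally have V2: "fro_norm V \<le> 2 * fro_norm (X * X)" by simp
  have X2: "fro_norm (X * X) \<le> fro_norm X * fro_norm X" by (rule fro_norm_mult_le[OF X X])
  have "Z $$ (i, j) - (1\<^sub>m d $$ (i, j) - X $$ (i, j) + (X * X) $$ (i, j) - (X * X * X) $$ (i, j)) = (X * X * X * X * Z) $$ (i, j)"
    using d1[OF ij] step[OF X ij] step[OF XX ij] step[OF XXX ij] by simp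
  then have "cmod (Z $$ (i, j) - (1\<^sub>m d $$ (i, j) - X $$ (i, j) + (X * X) $$ (i, j) - (X * X * X) $$ (i, j))) \<le> fro_norm ((X * X) * V)"
    unfolding comm using entry_le_fro_norm[OF mult_carrier_mat[OF XX V] ij] by simp
  also have "\<dots> \<le> fro_norm (X * X) * fro_norm V" by (rule fro_norm_mult_le[OF XX V])
  also have "\<dots> \<le> (fro_norm X * fro_norm X) * (2 * (fro_norm X * fro_norm X))"
    using V2 X2 by (intro mult_mono order_trans[OF V2]) auto
  also have "\<dots> = 2 * fro_norm X ^ 4" by (simp add: power4_eq_xxxx)
  finally show ?thesis .
qed

text \<open>The resolvent of a positive matrix has eigenvalues in (0, 1], and the rows of the
  eigenvector matrix have length 1, so Cauchy-Schwarz applies.\<close>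

lemma resolvent_entry_le_1:
  assumes "psd d Y" "i < d" "j < d"
  shows "cmod (minv (1\<^sub>m d + Y) $$ (i, j)) \<le> 1"
proof -
  obtain U y where U: "unitary d U" and YU: "Y = U * rdiag d y * U\<^sup>H" and y: "\<And>i. i < d \<Longrightarrow> 0 \<le> y i"
    using psd_spectral[OF assms(1)] by blast
  note UD = unitaryD[OF U]
  have "1\<^sub>m d + complex_of_real 1 \<cdot>\<^sub>m Y = 1\<^sub>m d + Y" by (rule eq_matI) auto
  then have eq: "minv (1\<^sub>m d + Y) = U * rdiag d (\<lambda>i. 1 / (1 + 1 * y i)) * U\<^sup>H"
    using resolvent_rdiag_conj(1)[OF U, where q = y and t = 1] y unfolding YU[symmetric] by simp
  have row: "(\<Sum>k<d. (cmod (U $$ (i, k)))\<^sup>2) = 1" if i: "i < d" for i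
  proof -
    have "(U * U\<^sup>H) $$ (i, i) = (\<Sum>k<d. U $$ (i, k) * cnj (U $$ (i, k)))"
      using UD i by (subst index_mult_sum[OF UD(1,2)]) auto
    then have "complex_of_real (\<Sum>k<d. (cmod (U $$ (i, k)))\<^sup>2) = 1"
      unfolding UD(4) using i by (simp only: of_real_sum complex_norm_square) simp
    then show ?thesis by (metis of_real_eq_1_iff)
  qed
  have "cmod (minv (1\<^sub>m d + Y) $$ (i, j)) \<le> (\<Sum>k<d. \<bar>cmod (U $$ (i, k))\<bar> * \<bar>cmod (U $$ (j, k))\<bar>)"
    unfolding eq rdiag_conj_index[OF UD(1) assms(2,3)]
  proof (rule order_trans[OF norm_sum], rule sum_mono)
    fix k assume "k \<in> {..<d}"
    then have "0 \<le> y k" using y by simp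
    then have "\<bar>1 / (1 + 1 * y k)\<bar> \<le> 1" by simp
    then have "cmod (U $$ (i, k)) * \<bar>1 / (1 + 1 * y k)\<bar> * cmod (U $$ (j, k)) \<le> cmod (U $$ (i, k)) * 1 * cmod (U $$ (j, k))"
      by (intro mult_right_mono mult_left_mono) auto
    then show "cmod (U $$ (i, k) * complex_of_real (1 / (1 + 1 * y k)) * cnj (U $$ (j, k))) \<le> \<bar>cmod (U $$ (i, k))\<bar> * \<bar>cmod (U $$ (j, k))\<bar>"
      by (simp only: norm_mult norm_of_real complex_mod_cnj abs_norm_cancel mult_1_right)
  qed
  also have "\<dots> \<le> L2_set (\<lambda>k. cmod (U $$ (i, k))) {..<d} * L2_set (\<lambda>k. cmod (U $$ (j, k))) {..<d}"
    by (rule L2_set_mult_ineq)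
  also have "\<dots> = 1" using row assms by (simp add: L2_set_def)
  finally show ?thesis .
qed

text \<open>The bound holds whether or not \<open>X\<close> is small: for large \<open>X\<close> the right-hand side
  dominates because the entries of the resolvent are bounded by 1.\<close>

lemma resolvent_expansion:
  assumes Y: "psd d Y" and g: "\<And>i. i < d \<Longrightarrow> 0 \<le> g i"
    and X: "X \<in> carrier_mat d d"
    and XY: "\<And>i j. i < d \<Longrightarrow> j < d \<Longrightarrow> X $$ (i, j) =
      complex_of_real (sqrt (1 / (1 + g i))) * complex_of_real (sqrt (1 / (1 + g j))) * Y $$ (i, j)
        - (if i = j then complex_of_real (g i / (1 + g i)) else 0)"
    and ij: "i < d" "j < d"
  shows "cmod (minv (1\<^sub>m d + Y) $$ (i, j) - complex_of_real (sqrt (1 / (1 + g i)) * sqrt (1 / (1 + g j))) *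
      (1\<^sub>m d $$ (i, j) - X $$ (i, j) + (X * X) $$ (i, j) - (X * X * X) $$ (i, j))) \<le> 46 * fro_norm X ^ 4"
proof -
  define u where "u = (\<lambda>i. sqrt (1 / (1 + g i)))"
  define Q where "Q = minv (1\<^sub>m d + Y)"
  define f where "f = fro_norm X"
  have f0: "0 \<le> f" by (simp add: f_def)
  have u: "0 < u i" "u i \<le> 1" "u i * u i = 1 / (1 + g i)" if "i < d" for i
    using g[OF that] by (simp_all add: u_def)
  have Yc: "Y \<in> carrier_mat d d" using Y by (simp add: psd_def)
  have "1\<^sub>m d + complex_of_real 1 \<cdot>\<^sub>m Y = 1\<^sub>m d + Y" by (rule eq_matI) auto
  then have Q: "Q \<in> carrier_mat d d" "(1\<^sub>m d + Y) * Q = 1\<^sub>m d"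
    using resolvent_psd[OF Y, of 1] by (simp_all add: Q_def)
  \<comment> \<open>The square of \<open>D\<close> has the diagonal 1 / (1 + g), and 1 + X = D (1 +
    Y) D. Hence the resolvent of \<open>Y\<close> is D Z D with \<open>Z\<close> the inverse of 1 +
    X.\<close>
  define D where "D = rdiag d u"
  define D' where "D' = rdiag d (\<lambda>i. 1 / u i)"
  have DD': "D * D' = 1\<^sub>m d"
    unfolding D_def D'_def rdiag_mult by (rule eq_matI) (use u in \<open>force+\<close>)
  then have D'D: "D' * D = 1\<^sub>m d" using mat_mult_left_right_inverse[of D d D'] by (simp add: D_def D'_def)
  have Dc: "D \<in> carrier_mat d d" "D' \<in> carrier_mat d d" by (auto simp: D_def D'_def)
  note simps = assoc_mult_mat[of _ d d _ d _ d] mult_carrier_mat[of _ d d _ d]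
  have IX: "1\<^sub>m d + X = D * (1\<^sub>m d + Y) * D"
  proof (rule eq_matI)
    fix i j assume "i < dim_row (D * (1\<^sub>m d + Y) * D)" "j < dim_col (D * (1\<^sub>m d + Y) * D)"
    then have ij: "i < d" "j < d" using Dc by auto
    have IY: "1\<^sub>m d + Y \<in> carrier_mat d d" using Yc by simp
    have DIY: "D * (1\<^sub>m d + Y) \<in> carrier_mat d d" using Dc IY by auto
    have "(D * (1\<^sub>m d + Y) * D) $$ (i, j) = complex_of_real (u i) * (1\<^sub>m d + Y) $$ (i, j) * complex_of_real (u j)"
      unfolding D_def index_mult_rdiag[OF DIY[unfolded D_def] ij] index_rdiag_mult[OF IY ij] ..
    also have "\<dots> = (1\<^sub>m d + X) $$ (i, j)"
    proof -
      have "complex_of_real (u i) * complex_of_real (u i) = complex_of_real (1 / (1 + g i))"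
        unfolding u(3)[OF ij(1), symmetric] by simp
      moreover have "complex_of_real (1 / (1 + g i)) = 1 - complex_of_real (g i / (1 + g i))"
      proof -
        have "1 / (1 + g i) = 1 - g i / (1 + g i)" using g[OF ij(1)] by (simp add: field_simps)
        then show ?thesis by (metis of_real_1 of_real_diff)
      qed
      ultimately have uu: "complex_of_real (u i) * complex_of_real (u i) = 1 - complex_of_real (g i / (1 + g i))" by simp
      have "complex_of_real (u i) * (1\<^sub>m d + Y) $$ (i, j) * complex_of_real (u j) =
        (if i = j then complex_of_real (u i) * complex_of_real (u i) else 0) + complex_of_real (u i) * complex_of_real (u j) * Y $$ (i, j)"
        using ij Yc by (simp add: algebra_simps)
      also have "\<dots> = (1\<^sub>m d + X) $$ (i, j)"
        unfolding uu using ij X XY[OF ij, folded u_def] by (simp add: u_def)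
      finally show ?thesis .
    qed
    finally show "(1\<^sub>m d + X) $$ (i, j) = (D * (1\<^sub>m d + Y) * D) $$ (i, j)" by simp
  qed (use Dc X in auto)
  define Z where "Z = D' * Q * D'"
  have Z: "Z \<in> carrier_mat d d" using Dc Q by (auto simp: Z_def)
  have "(1\<^sub>m d + X) * Z = D * ((1\<^sub>m d + Y) * ((D * D') * (Q * D')))"
    unfolding IX Z_def using Dc Q(1) Yc by (simp add: simps)
  also have "\<dots> = D * (((1\<^sub>m d + Y) * Q) * D')" unfolding DD' using Dc Q(1) Yc by (simp add: simps)
  also have "\<dots> = 1\<^sub>m d" unfolding Q(2) using Dc DD' by simp
  finally have XZ: "(1\<^sub>m d + X) * Z = 1\<^sub>m d" .
  have QZ: "Q $$ (i, j) = complex_of_real (u i * u j) * Z $$ (i, j)"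
  proof -
    have D'Q: "D' * Q \<in> carrier_mat d d" using Dc Q by auto
    have "Z $$ (i, j) = complex_of_real (1 / u i) * Q $$ (i, j) * complex_of_real (1 / u j)"
      unfolding Z_def D'_def index_mult_rdiag[OF D'Q[unfolded D'_def] ij] index_rdiag_mult[OF Q(1) ij] ..
    then show ?thesis using u(1)[OF ij(1)] u(1)[OF ij(2)] by simp
  qed
  have uu1: "0 \<le> u i * u j" "u i * u j \<le> 1"
    using u[OF ij(1)] u[OF ij(2)] by (auto intro: mult_le_one)
  define P where "P = 1\<^sub>m d $$ (i, j) - X $$ (i, j) + (X * X) $$ (i, j) - (X * X * X) $$ (i, j)"
  have "cmod (Q $$ (i, j) - complex_of_real (u i * u j) * P) \<le> 46 * f ^ 4"
  proof (cases "f \<le> 1 / 2")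
    case True
    have "Q $$ (i, j) - complex_of_real (u i * u j) * P = complex_of_real (u i * u j) * (Z $$ (i, j) - P)"
      by (simp add: QZ algebra_simps)
    then have "cmod (Q $$ (i, j) - complex_of_real (u i * u j) * P) = (u i * u j) * cmod (Z $$ (i, j) - P)"
      using uu1 by (simp only: norm_mult norm_of_real abs_of_nonneg)
    also have "\<dots> \<le> 1 * cmod (Z $$ (i, j) - P)" using uu1 by (intro mult_right_mono) auto
    also have "\<dots> \<le> 2 * f ^ 4"
      using neumann_remainder[OF X Z XZ _ ij] True by (simp add: P_def f_def)
    finally show ?thesis using zero_le_power[OF f0, of 4] by linarith
  next
    case False
    then have f: "1 \<le> 2 * f" by simp
    have XX: "X * X \<in> carrier_mat d d" and XXX: "X * X * X \<in> carrier_mat d d" using X by auto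
    have b: "cmod (X $$ (i, j)) \<le> f" "cmod ((X * X) $$ (i, j)) \<le> f * f" "cmod ((X * X * X) $$ (i, j)) \<le> f * f * f"
    proof -
      show "cmod (X $$ (i, j)) \<le> f" unfolding f_def by (rule entry_le_fro_norm[OF X ij])
      have 2: "fro_norm (X * X) \<le> f * f" unfolding f_def by (rule fro_norm_mult_le[OF X X])
      then show "cmod ((X * X) $$ (i, j)) \<le> f * f" using entry_le_fro_norm[OF XX ij] by linarith
      have "fro_norm (X * X * X) \<le> fro_norm (X * X) * f" unfolding f_def by (rule fro_norm_mult_le[OF XX X])
      also have "\<dots> \<le> f * f * f" using 2 f0 by (intro mult_right_mono) auto
      finally show "cmod ((X * X * X) $$ (i, j)) \<le> f * f * f" using entry_le_fro_norm[OF XXX ij] by linarith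
    qed
    have "cmod (complex_of_real (u i * u j) * P) = (u i * u j) * cmod P"
      using uu1 by (simp only: norm_mult norm_of_real abs_of_nonneg)
    also have "\<dots> \<le> 1 * cmod P" using uu1 by (intro mult_right_mono) auto
    finally have P1: "cmod (complex_of_real (u i * u j) * P) \<le> cmod P" by simp
    have P2: "cmod P \<le> cmod (1\<^sub>m d $$ (i, j) :: complex) + cmod (X $$ (i, j)) + cmod ((X * X) $$ (i, j)) + cmod ((X * X * X) $$ (i, j))"
      unfolding P_def by (intro order_trans[OF norm_triangle_ineq4] order_trans[OF norm_triangle_ineq] add_mono order_refl)
    have "cmod (1\<^sub>m d $$ (i, j) :: complex) \<le> 1" using ij by simp
    then have P: "cmod (complex_of_real (u i * u j) * P) \<le> 1 + f + f * f + f * f * f" using P1 P2 b by linarith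
    have Q1: "cmod (Q $$ (i, j)) \<le> 1" unfolding Q_def by (rule resolvent_entry_le_1[OF Y ij])
    have pw: "f ^ k \<le> 2 ^ (4 - k) * f ^ 4" if "k \<le> 4" for k
    proof -
      have "f ^ k * 1 ^ (4 - k) \<le> f ^ k * (2 * f) ^ (4 - k)" using f f0 by (intro mult_left_mono power_mono) auto
      also have "\<dots> = 2 ^ (4 - k) * (f ^ k * f ^ (4 - k))" by (simp add: power_mult_distrib)
      also have "f ^ k * f ^ (4 - k) = f ^ 4" using that by (simp flip: power_add)
      finally show ?thesis by simp
    qed
    have "cmod (Q $$ (i, j) - complex_of_real (u i * u j) * P) \<le> 1 + (1 + f + f * f + f * f * f)"
      using norm_triangle_ineq4[of "Q $$ (i, j)" "complex_of_real (u i * u j) * P"] P Q1 by linarith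
    \<comment> \<open>46 = 2 * 16 + 8 + 4 + 2: since 2 f >= 1, a power f^k is at most 2^(4 - k) f^4,
      and the constant 1 occurs twice.\<close>
    also have "\<dots> \<le> 46 * f ^ 4"
      using pw[of 0] pw[of 1] pw[of 2] pw[of 3] by (simp add: power2_eq_square power3_eq_cube)
    finally show ?thesis .
  qed
  then show ?thesis by (simp add: P_def Q_def f_def u_def)
qed

section \<open>Measurability of determinants and inverses\<close>

lemma measurable_det:
  assumes dim: "\<And>\<omega>. A \<omega> \<in> carrier_mat n n" and A: "\<And>i j. i < n \<Longrightarrow> j < n \<Longrightarrow> (\<lambda>\<omega>. A \<omega> $$ (i, j)) \<in> borel_measurable M"
  shows "(\<lambda>\<omega>. Determinant.det (A \<omega>) :: complex) \<in> borel_measurable M"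
proof -
  have "(\<lambda>\<omega>. \<Sum>p | p permutes {0..<n}. signof p * (\<Prod>i = 0..<n. A \<omega> $$ (i, p i))) \<in> borel_measurable M"
    by (intro borel_measurable_sum borel_measurable_times borel_measurable_const borel_measurable_prod A)
      (auto dest: permutes_in_image)
  then show ?thesis by (simp only: det_def'[OF dim])
qed

text \<open>By the adjugate formula an entry of the inverse is a quotient of determinants, which are
  polynomials in the entries.\<close>

lemma measurable_minv_entry:
  assumes dim: "\<And>\<omega>. A \<omega> \<in> carrier_mat n n" and A: "\<And>i j. i < n \<Longrightarrow> j < n \<Longrightarrow> (\<lambda>\<omega>. A \<omega> $$ (i, j)) \<in> borel_measurable M"
    and inv: "\<And>\<omega>. \<exists>B \<in> carrier_mat n n. A \<omega> * B = 1\<^sub>m n" and ij: "i < n" "j < n"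
  shows "(\<lambda>\<omega>. minv (A \<omega>) $$ (i, j)) \<in> borel_measurable M"
proof -
  obtain m where m: "n = Suc m" using ij by (cases n) auto
  have eq: "minv (A \<omega>) $$ (i, j) = (1 / Determinant.det (A \<omega>)) * ((-1) ^ (j + i) * Determinant.det (mat_delete (A \<omega>) j i))" for \<omega>
  proof -
    obtain B where B: "B \<in> carrier_mat n n" "A \<omega> * B = 1\<^sub>m n" using inv by blast
    have "Determinant.det (A \<omega>) * Determinant.det B = 1" using det_mult[OF dim B(1), of \<omega>] B(2) by simp
    then have d: "Determinant.det (A \<omega>) \<noteq> 0" by auto
    note adj = adj_mat[OF dim, of \<omega>]
    have "A \<omega> * ((1 / Determinant.det (A \<omega>)) \<cdot>\<^sub>m adj_mat (A \<omega>)) = (1 / Determinant.det (A \<omega>)) \<cdot>\<^sub>m (A \<omega> * adj_mat (A \<omega>))"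
      by (rule mult_smult_distrib[OF dim adj(1)])
    also have "\<dots> = 1\<^sub>m n" unfolding adj(2) using d by (intro eq_matI) auto
    finally have "minv (A \<omega>) = (1 / Determinant.det (A \<omega>)) \<cdot>\<^sub>m adj_mat (A \<omega>)"
      using adj(1) by (intro minv_eqI[OF dim]) auto
    then show ?thesis using adj(1) ij carrier_matD[OF dim, of \<omega>] by (simp add: adj_mat_def cofactor_def)
  qed
  have "(\<lambda>\<omega>. Determinant.det (mat_delete (A \<omega>) j i)) \<in> borel_measurable M"
  proof (rule measurable_det[of _ m])
    show c: "mat_delete (A \<omega>) j i \<in> carrier_mat m m" for \<omega> using mat_delete_carrier[OF dim, of \<omega>] m by simp
    fix a b assume ab: "a < m" "b < m"
    have "mat_delete (A \<omega>) j i $$ (a, b) = A \<omega> $$ (insert_index j a, insert_index i b)" for \<omega>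
      using mat_delete_index[of "A \<omega>" m j i a b] dim[of \<omega>] ij ab m by simp
    moreover have "insert_index j a < n" "insert_index i b < n" using ab m by (auto simp: insert_index_def)
    ultimately show "(\<lambda>\<omega>. mat_delete (A \<omega>) j i $$ (a, b)) \<in> borel_measurable M" using A by simp
  qed
  moreover have "(\<lambda>\<omega>. Determinant.det (A \<omega>)) \<in> borel_measurable M" by (rule measurable_det[OF dim A])
  ultimately show ?thesis unfolding eq by measurable
qed

lemma mtrace_rdiag: "mtrace (rdiag n a) = complex_of_real (\<Sum>i<n. a i)"
  by (simp add: mtrace_def)

lemma mtrace_resolvent_rdiag_conj:
  assumes V: "unitary n V" and t: "\<And>i. i < n \<Longrightarrow> 0 \<le> t i" and c: "0 \<le> c"
  defines "T \<equiv> V * rdiag n t * V\<^sup>H"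
  shows "mtrace (T * minv (1\<^sub>m (dim_row T) + complex_of_real c \<cdot>\<^sub>m T)) = complex_of_real (\<Sum>i<n. t i / (1 + c * t i))"
proof -
  have dim: "dim_row T = n" using rdiag_conj_carrier[OF V] unfolding T_def by blast
  have "minv (1\<^sub>m n + complex_of_real c \<cdot>\<^sub>m T) = V * rdiag n (\<lambda>i. 1 / (1 + c * t i)) * V\<^sup>H"
    unfolding T_def by (rule resolvent_rdiag_conj(1)[OF V _ c]) (use t in auto)
  then have "T * minv (1\<^sub>m (dim_row T) + complex_of_real c \<cdot>\<^sub>m T) = V * rdiag n (\<lambda>i. t i * (1 / (1 + c * t i))) * V\<^sup>H"
    unfolding dim by (simp only: T_def rdiag_conj_mult[OF V])
  then show ?thesis by (simp add: mtrace_unitary_conj[OF V rdiag_carrier] mtrace_rdiag)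
qed

section \<open>The deterministic equivalent\<close>

text \<open>Existence: the right-hand side is continuous, nonnegative at 0 and bounded by its value
  with the denominators removed, so the intermediate value theorem applies. Uniqueness: after
  division by 1 + \<rho> d the left side is strictly increasing and the right side decreasing in
  d.\<close>

lemma fixed_point_exists_unique:
  fixes t :: "nat \<Rightarrow> real" and \<rho> :: real and n N :: nat
  assumes t: "\<And>i. i < N \<Longrightarrow> 0 \<le> t i" and \<rho>: "0 < \<rho>" and n: "0 < n"
  shows "\<exists>!d. 0 \<le> d \<and> d = (\<Sum>i<N. t i / (1 + \<rho> / (1 + \<rho> * d) * t i)) / real n"
proof -
  define f where "f = (\<lambda>d. (\<Sum>i<N. t i / (1 + \<rho> / (1 + \<rho> * d) * t i)) / real n)"
  have pos: "0 < 1 + \<rho> * d" if "0 \<le> d" for d using \<rho> that by (simp add: add_pos_nonneg)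
  have pos2: "0 < 1 + \<rho> / (1 + \<rho> * d) * t i" if "0 \<le> d" "i < N" for d i
    using pos[OF that(1)] t[OF that(2)] \<rho> by (intro add_pos_nonneg) auto
  define b where "b = (\<Sum>i<N. t i) / real n"
  have b: "0 \<le> b" unfolding b_def using t by (intro divide_nonneg_nonneg sum_nonneg) auto
  have fb: "f d \<le> b" if "0 \<le> d" for d
  proof -
    have "t i / (1 + \<rho> / (1 + \<rho> * d) * t i) \<le> t i" if i: "i < N" for i
    proof -
      have "1 \<le> 1 + \<rho> / (1 + \<rho> * d) * t i" using pos[OF \<open>0 \<le> d\<close>] t[OF i] \<rho> by simp
      then show ?thesis using t[OF i] by (simp add: divide_le_eq mult_le_cancel_left1)
    qed
    then show ?thesis unfolding f_def b_def by (intro divide_right_mono sum_mono) auto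
  qed
  have "0 \<le> f 0" unfolding f_def using t \<rho> by (intro divide_nonneg_nonneg sum_nonneg) auto
  moreover have "continuous_on {0..b} (\<lambda>d. d - f d)"
    unfolding f_def
  proof (intro continuous_intros ballI)
    fix d i assume "d \<in> {0..b}" "i \<in> {..<N}"
    then show "1 + \<rho> / (1 + \<rho> * d) * t i \<noteq> 0" using pos2[of d i] by auto
  next
    fix d assume "d \<in> {0..b}"
    then show "1 + \<rho> * d \<noteq> 0" using pos[of d] by auto
  qed (use n in auto)
  ultimately obtain d where d: "0 \<le> d" "d - f d = 0"
    using IVT'[of "\<lambda>d. d - f d" 0 0 b] fb[of b] b by auto
  have uniq: False if d: "0 \<le> d1" "d1 < d2" "d1 = f d1" "d2 = f d2" for d1 d2
  proof -
    \<comment> \<open>After the division d occurs in the denominators only, which makes the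
      monotonicity visible.\<close>
    have f_alt: "f d / (1 + \<rho> * d) = (\<Sum>i<N. t i / (1 + \<rho> * d + \<rho> * t i)) / real n" if "0 \<le> d" for d
    proof -
      have "t i / (1 + \<rho> / (1 + \<rho> * d) * t i) / (1 + \<rho> * d) = t i / (1 + \<rho> * d + \<rho> * t i)" if "i < N" for i
      proof -
        have "(1 + \<rho> / (1 + \<rho> * d) * t i) * (1 + \<rho> * d) = 1 + \<rho> * d + \<rho> * t i"
          using pos[OF \<open>0 \<le> d\<close>] unfolding distrib_right by simp
        then show ?thesis by (simp only: divide_divide_eq_left)
      qed
      then have "(\<Sum>i<N. t i / (1 + \<rho> / (1 + \<rho> * d) * t i)) / (1 + \<rho> * d) = (\<Sum>i<N. t i / (1 + \<rho> * d + \<rho> * t i))"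
        unfolding sum_divide_distrib by (intro sum.cong) auto
      moreover have "a / real n / b = a / b / real n" for a b :: real
        by (simp only: divide_divide_eq_left mult.commute)
      ultimately show ?thesis unfolding f_def by (simp only:)
    qed
    have "d1 / (1 + \<rho> * d1) < d2 / (1 + \<rho> * d2)"
      using pos[of d1] pos[of d2] d(1,2) by (simp add: field_simps)
    moreover have "(\<Sum>i<N. t i / (1 + \<rho> * d2 + \<rho> * t i)) / real n \<le> (\<Sum>i<N. t i / (1 + \<rho> * d1 + \<rho> * t i)) / real n"
    proof (intro divide_right_mono sum_mono divide_left_mono)
      fix i assume "i \<in> {..<N}"
      then have ti: "0 \<le> t i" using t by simp
      show "1 + \<rho> * d1 + \<rho> * t i \<le> 1 + \<rho> * d2 + \<rho> * t i" using d \<rho> by simp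
      show "0 \<le> t i" by (rule ti)
      show "0 < (1 + \<rho> * d2 + \<rho> * t i) * (1 + \<rho> * d1 + \<rho> * t i)"
        using pos[of d1] pos[of d2] d ti \<rho> by (intro mult_pos_pos add_pos_nonneg) auto
    qed simp
    ultimately show False using f_alt[of d1] f_alt[of d2] d by simp
  qed
  have df: "d = f d" using d(2) by simp
  show ?thesis
  proof (rule ex1I[of _ d])
    show "0 \<le> d \<and> d = (\<Sum>i<N. t i / (1 + \<rho> / (1 + \<rho> * d) * t i)) / real n"
      using d(1) df unfolding f_def by blast
    fix y assume "0 \<le> y \<and> y = (\<Sum>i<N. t i / (1 + \<rho> / (1 + \<rho> * y) * t i)) / real n"
    then have y: "0 \<le> y" "y = f y" unfolding f_def by blast+
    then show "y = d" using uniq[OF y(1) _ y(2) df] uniq[OF d(1) _ df y(2)] by (cases y d rule: linorder_cases) auto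
  qed
qed

text \<open>In an eigenbasis of \<open>T\<close> the matrix equation is the scalar one, so the
  definite description in \<open>delta\<close> has exactly one solution.\<close>

lemma delta_fixed_point:
  assumes V: "unitary N V" and t: "\<And>i. i < N \<Longrightarrow> 0 \<le> t i" and T: "T = V * rdiag N t * V\<^sup>H" and \<rho>: "0 < \<rho>" and n: "0 < n"
  shows "0 \<le> delta n T \<rho>" "delta n T \<rho> = (\<Sum>i<N. t i / (1 + \<rho> / (1 + \<rho> * delta n T \<rho>) * t i)) / real n"
proof -
  have eq: "(0 \<le> d \<and> complex_of_real d = 1 / of_nat n * mtrace (T * minv (1\<^sub>m (dim_row T) + complex_of_real (\<rho> / (1 + \<rho> * d)) \<cdot>\<^sub>m T)))
     \<longleftrightarrow> (0 \<le> d \<and> d = (\<Sum>i<N. t i / (1 + \<rho> / (1 + \<rho> * d) * t i)) / real n)" for d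
  \<comment> \<open>The resolvent formula needs a nonnegative coefficient; negative \<open>d\<close>
    fails on both sides.\<close>
  proof (cases "0 \<le> d")
    case True
    then have c: "0 \<le> \<rho> / (1 + \<rho> * d)" using \<rho> by simp
    have "mtrace (T * minv (1\<^sub>m (dim_row T) + complex_of_real (\<rho> / (1 + \<rho> * d)) \<cdot>\<^sub>m T)) = complex_of_real (\<Sum>i<N. t i / (1 + \<rho> / (1 + \<rho> * d) * t i))"
      unfolding T by (rule mtrace_resolvent_rdiag_conj[OF V _ c]) (use t in auto)
    then have "1 / of_nat n * mtrace (T * minv (1\<^sub>m (dim_row T) + complex_of_real (\<rho> / (1 + \<rho> * d)) \<cdot>\<^sub>m T))
        = complex_of_real ((\<Sum>i<N. t i / (1 + \<rho> / (1 + \<rho> * d) * t i)) / real n)"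
      by simp
    then show ?thesis by (simp only: of_real_eq_iff)
  qed simp
  have "\<exists>!d. 0 \<le> d \<and> d = (\<Sum>i<N. t i / (1 + \<rho> / (1 + \<rho> * d) * t i)) / real n"
    by (rule fixed_point_exists_unique[OF _ \<rho> n]) (use t in auto)
  from theI'[OF this] show "0 \<le> delta n T \<rho>" "delta n T \<rho> = (\<Sum>i<N. t i / (1 + \<rho> / (1 + \<rho> * delta n T \<rho>) * t i)) / real n"
    unfolding delta_def eq by auto
qed

text \<open>Here \<open>e\<close> stands for \<rho> \<delta>(\<rho>). The fixed point equation gives
  e = P / n up to 2 K^2 / n^2, where P is the sum of the g i / (1 + g i), and expanding (1 + e) / (1
  + e + g j) to first order in \<open>e\<close> costs at most e^2 <= 4 K^2 / n^2. The first-order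
  term is the one that the second moment of the Wishart deviation produces.\<close>

lemma deterministic_equivalent_expansion:
  fixes g :: "nat \<Rightarrow> real" and e :: real and n N K :: nat
  assumes g: "\<And>i. i < N \<Longrightarrow> 0 \<le> g i" and e: "0 \<le> e" "e = (\<Sum>i<N. g i * (1 + e) / (1 + e + g i)) / real n"
    and K: "card {i. i < N \<and> g i \<noteq> 0} \<le> K" and n: "0 < n" "2 * K \<le> n" and j: "j < N"
  shows "\<bar>(1 + e) / (1 + e + g j) - 1 / (1 + g j) * (1 + g j / (1 + g j) * (\<Sum>i<N. g i / (1 + g i)) / real n)\<bar> \<le> 6 * (real K)\<^sup>2 / (real n)\<^sup>2"
proof -
  let ?J = "{i. i < N \<and> g i \<noteq> 0}"
  define P where "P = (\<Sum>i<N. g i / (1 + g i))"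
  have sumJ: "(\<Sum>i<N. f i) = (\<Sum>i\<in>?J. f i)" if "\<And>i. i < N \<Longrightarrow> g i = 0 \<Longrightarrow> f i = 0" for f :: "nat \<Rightarrow> real"
    using that by (intro sum.mono_neutral_right) auto
  have nr: "0 < real n" "2 * real K \<le> real n" using n by simp_all
  have ne: "real n * e = (\<Sum>i<N. g i * (1 + e) / (1 + e + g i))" using e(2) nr(1) by (simp add: field_simps)
  \<comment> \<open>Each of the at most \<open>K\<close> nonzero terms is at most 1 + e; with 2 K <=
    n the part K e is absorbed into half of n e.\<close>
  have e_le: "e \<le> 2 * real K / real n"
  proof -
    have "(\<Sum>i<N. g i * (1 + e) / (1 + e + g i)) = (\<Sum>i\<in>?J. g i * (1 + e) / (1 + e + g i))" by (rule sumJ) auto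
    also have "\<dots> \<le> (\<Sum>i\<in>?J. 1 + e)"
    proof (rule sum_mono)
      fix i assume "i \<in> ?J"
      then have "0 \<le> g i" using g by simp
      then show "g i * (1 + e) / (1 + e + g i) \<le> 1 + e" using e by (simp add: divide_le_eq mult_right_mono algebra_simps)
    qed
    also have "\<dots> \<le> real K * (1 + e)" using K e by (simp add: mult_right_mono)
    finally have "real n * e \<le> real K * (1 + e)" using ne by simp
    moreover have "2 * real K * e \<le> real n * e" using nr e by (intro mult_right_mono) auto
    ultimately have "real n * e \<le> 2 * real K" by (simp add: algebra_simps)
    then show ?thesis using nr by (simp add: field_simps)
  qed
  \<comment> \<open>Replacing e by 0 in the terms changes each of them by e times a factor between 0
    and 1.\<close>
  have "0 \<le> real n * e - P \<and> real n * e - P \<le> real K * e"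
  proof -
    have diff: "g i * (1 + e) / (1 + e + g i) - g i / (1 + g i) = e * (g i * g i / ((1 + e + g i) * (1 + g i)))" if "i < N" for i
    proof -
      have "1 + e + g i \<noteq> 0" "1 + g i \<noteq> 0" using g[OF that] e by auto
      then show ?thesis by (simp add: divide_simps) (simp add: algebra_simps)
    qed
    have frac: "0 \<le> g i * g i / ((1 + e + g i) * (1 + g i))" "g i * g i / ((1 + e + g i) * (1 + g i)) \<le> 1" if "i < N" for i
    proof -
      have "g i * g i \<le> (1 + e + g i) * (1 + g i)" using g[OF that] e by (intro mult_mono) auto
      moreover have "0 < (1 + e + g i) * (1 + g i)" using g[OF that] e by (intro mult_pos_pos) auto
      ultimately show "0 \<le> g i * g i / ((1 + e + g i) * (1 + g i))" "g i * g i / ((1 + e + g i) * (1 + g i)) \<le> 1"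
        using g[OF that] by auto
    qed
    have eq: "real n * e - P = (\<Sum>i<N. e * (g i * g i / ((1 + e + g i) * (1 + g i))))"
      unfolding ne P_def sum_subtractf[symmetric] by (intro sum.cong refl) (simp add: diff)
    have "0 \<le> real n * e - P" unfolding eq using frac e by (intro sum_nonneg mult_nonneg_nonneg) auto
    moreover have "real n * e - P \<le> real K * e"
    proof -
      have "real n * e - P = (\<Sum>i\<in>?J. e * (g i * g i / ((1 + e + g i) * (1 + g i))))" unfolding eq by (rule sumJ) auto
      also have "\<dots> \<le> (\<Sum>i\<in>?J. e * 1)" using frac e by (intro sum_mono mult_left_mono) auto
      also have "\<dots> \<le> real K * e" using K e by (simp add: mult_right_mono)
      finally show ?thesis .
    qed
    ultimately show ?thesis by simp
  qed
  moreover have "e - P / real n = (real n * e - P) / real n" using nr by (simp add: diff_divide_distrib)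
  ultimately have eP: "0 \<le> e - P / real n" "e - P / real n \<le> real K * e / real n"
    using nr by (auto intro!: divide_right_mono)
  have "real K * e / real n \<le> real K * (2 * real K / real n) / real n"
    using e_le nr by (intro divide_right_mono mult_left_mono) auto
  then have eP2: "\<bar>e - P / real n\<bar> \<le> 2 * (real K)\<^sup>2 / (real n)\<^sup>2"
  proof -
    have "real K * (2 * real K / real n) / real n = 2 * (real K)\<^sup>2 / (real n)\<^sup>2" by (simp add: power2_eq_square)
    then show ?thesis using eP \<open>real K * e / real n \<le> real K * (2 * real K / real n) / real n\<close> by linarith
  qed
  have e2: "e\<^sup>2 \<le> 4 * (real K)\<^sup>2 / (real n)\<^sup>2"
  proof -
    have "e\<^sup>2 \<le> (2 * real K / real n)\<^sup>2" using e_le e by (intro power_mono) auto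
    then show ?thesis by (simp add: power_divide power_mult_distrib)
  qed
  have gj: "0 \<le> g j" using g[OF j] .
  define q where "q = 1 / (1 + g j)"
  define p where "p = g j / (1 + g j)"
  have qp: "0 \<le> q * p" "q * p \<le> 1"
  proof -
    have "0 \<le> q" "q \<le> 1" "0 \<le> p" "p \<le> 1" using gj by (simp_all add: q_def p_def)
    then show "0 \<le> q * p" "q * p \<le> 1" by (auto intro: mult_le_one)
  qed
  \<comment> \<open>Exact remainder of the first-order expansion; the factor of e^2 lies between -1
    and 0.\<close>
  have main: "(1 + e) / (1 + e + g j) - q * (1 + p * e) = - (e\<^sup>2 * (g j / ((1 + e + g j) * ((1 + g j) * (1 + g j)))))"
  proof -
    have "1 + e + g j \<noteq> 0" "1 + g j \<noteq> 0" using gj e by auto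
    then show ?thesis unfolding q_def p_def by (simp add: divide_simps) (simp add: algebra_simps power2_eq_square)
  qed
  have frac: "0 \<le> g j / ((1 + e + g j) * ((1 + g j) * (1 + g j)))" "g j / ((1 + e + g j) * ((1 + g j) * (1 + g j))) \<le> 1"
  proof -
    have "1 * 1 \<le> (1 + g j) * (1 + g j)" using gj by (intro mult_mono) auto
    then have "g j * 1 \<le> (1 + e + g j) * ((1 + g j) * (1 + g j))" using gj e by (intro mult_mono) auto
    moreover have "0 < (1 + e + g j) * ((1 + g j) * (1 + g j))" using gj e by (intro mult_pos_pos) auto
    ultimately show "0 \<le> g j / ((1 + e + g j) * ((1 + g j) * (1 + g j)))" "g j / ((1 + e + g j) * ((1 + g j) * (1 + g j))) \<le> 1"
      using gj by auto
  qed
  have split: "(1 + e) / (1 + e + g j) - q * (1 + p * P / real n) = ((1 + e) / (1 + e + g j) - q * (1 + p * e)) + (q * p) * (e - P / real n)"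
    by (simp add: algebra_simps)
  have "\<bar>(1 + e) / (1 + e + g j) - q * (1 + p * P / real n)\<bar> \<le> \<bar>(1 + e) / (1 + e + g j) - q * (1 + p * e)\<bar> + \<bar>(q * p) * (e - P / real n)\<bar>"
    unfolding split by (rule abs_triangle_ineq)
  also have "\<bar>(1 + e) / (1 + e + g j) - q * (1 + p * e)\<bar> \<le> e\<^sup>2 * 1"
    unfolding main abs_minus_cancel using frac(1) mult_left_mono[OF frac(2), of "e\<^sup>2"]
    by (simp only: abs_of_nonneg mult_nonneg_nonneg zero_le_power2)
  also have "\<bar>(q * p) * (e - P / real n)\<bar> \<le> 1 * \<bar>e - P / real n\<bar>"
    unfolding abs_mult[of "q * p"] using qp by (intro mult_right_mono) auto
  finally have "\<bar>(1 + e) / (1 + e + g j) - q * (1 + p * P / real n)\<bar> \<le> 6 * (real K)\<^sup>2 / (real n)\<^sup>2"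
    using e2 eP2 by simp
  then show ?thesis by (simp add: q_def p_def P_def)
qed

text \<open>The eigenvectors of \<open>S * X\<close> for nonzero eigenvalues lie in the range of \<open>S\<close>;
  the count is Bessel's inequality.\<close>

lemma card_nonzero_eigenvalues_mult_le:
  assumes U: "unitary n U" and V: "unitary n V" and X: "X \<in> carrier_mat n n"
    and eq: "V * rdiag n t * V\<^sup>H = (U * rdiag n s * U\<^sup>H) * X"
  shows "card {i. i < n \<and> t i \<noteq> 0} \<le> card {i. i < n \<and> s i \<noteq> 0}"
proof -
  note UD = unitaryD[OF U] and VD = unitaryD[OF V]
  let ?I = "{i. i < n \<and> t i \<noteq> 0}" and ?K = "{k. k < n \<and> s k \<noteq> 0}"
  define G where "G = U\<^sup>H * V"
  have G: "unitary n G"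
  proof -
    have "unitary n (U\<^sup>H)" using UD by (simp add: unitary_def)
    then show ?thesis unfolding G_def using V by (rule unitary_mult)
  qed
  note GD = unitaryD[OF G]
  define B where "B = U\<^sup>H * X * V"
  note simps = assoc_mult_mat[of _ n n _ n _ n] mult_carrier_mat[of _ n n _ n] left_mult_one_mat[of _ n n] right_mult_one_mat[of _ n n]
  have B: "B \<in> carrier_mat n n" using UD(1,2) VD(1,2) X by (simp add: B_def simps)
  have "G * rdiag n t = U\<^sup>H * (V * rdiag n t * V\<^sup>H) * V"
  proof -
    have "U\<^sup>H * (V * rdiag n t * V\<^sup>H) * V = G * rdiag n t * (V\<^sup>H * V)"
      using UD(1,2) VD(1,2) by (simp add: simps G_def)
    then show ?thesis unfolding VD(3) using GD by simp
  qed
  also have "\<dots> = (U\<^sup>H * U) * rdiag n s * B" unfolding eq using UD(1,2) VD(1,2) X by (simp add: simps B_def)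
  also have "\<dots> = rdiag n s * B" unfolding UD(3) using B by simp
  finally have GB: "G * rdiag n t = rdiag n s * B" .
  \<comment> \<open>Columns of \<open>G\<close> with \<open>t i \<noteq> 0\<close> are supported on
    the rows with \<open>s k \<noteq> 0\<close>. All rows and columns have length 1, so summing
    squared moduli over these columns compares the two cardinalities.\<close>
  have zero: "G $$ (k, i) = 0" if "i \<in> ?I" "k < n" "s k = 0" for i k
  proof -
    have "G $$ (k, i) * complex_of_real (t i) = complex_of_real (s k) * B $$ (k, i)"
      using index_mult_rdiag[OF GD(1), of k i t] index_rdiag_mult[OF B, of k i s] that GB by simp
    then show ?thesis using that by simp
  qed
  have col: "(\<Sum>k<n. (cmod (G $$ (k, i)))\<^sup>2) = 1" if "i < n" for i
  proof -
    have "(G\<^sup>H * G) $$ (i, i) = (\<Sum>k<n. G $$ (k, i) * cnj (G $$ (k, i)))"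
      using GD that by (subst index_mult_sum[OF GD(2,1)]) (auto simp: mult.commute)
    then have "complex_of_real (\<Sum>k<n. (cmod (G $$ (k, i)))\<^sup>2) = 1"
      unfolding GD(3) using that by (simp only: of_real_sum complex_norm_square) simp
    then show ?thesis by (metis of_real_eq_1_iff)
  qed
  have row: "(\<Sum>i<n. (cmod (G $$ (k, i)))\<^sup>2) = 1" if "k < n" for k
  proof -
    have "(G * G\<^sup>H) $$ (k, k) = (\<Sum>i<n. G $$ (k, i) * cnj (G $$ (k, i)))"
      using GD that by (subst index_mult_sum[OF GD(1,2)]) auto
    then have "complex_of_real (\<Sum>i<n. (cmod (G $$ (k, i)))\<^sup>2) = 1"
      unfolding GD(4) using that by (simp only: of_real_sum complex_norm_square) simp
    then show ?thesis by (metis of_real_eq_1_iff)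
  qed
  have "real (card ?I) = (\<Sum>i\<in>?I. \<Sum>k<n. (cmod (G $$ (k, i)))\<^sup>2)" using col by simp
  also have "\<dots> = (\<Sum>i\<in>?I. \<Sum>k\<in>?K. (cmod (G $$ (k, i)))\<^sup>2)"
    using zero by (intro sum.cong refl sum.mono_neutral_right) auto
  also have "\<dots> = (\<Sum>k\<in>?K. \<Sum>i\<in>?I. (cmod (G $$ (k, i)))\<^sup>2)" by (rule sum.swap)
  also have "\<dots> \<le> (\<Sum>k\<in>?K. \<Sum>i<n. (cmod (G $$ (k, i)))\<^sup>2)"
    by (intro sum_mono sum_mono2) auto
  also have "\<dots> = real (card ?K)" using row by simp
  finally show ?thesis by simp
qed

text \<open>The first K^2 comes from the third-order term, a double sum over nonzero directions; 46
  K^4 from the remainder, where the fourth power of the norm costs K^2 by Cauchy-Schwarz and K^2 for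
  the number of entries; 6 K^2 from the expansion of the fixed point.\<close>

definition resolvent_bound :: "nat \<Rightarrow> real" where
  "resolvent_bound K = (real K ^ 2 + 46 * real K ^ 4) * wishart_bound + 6 * (real K)\<^sup>2"

lemma resolvent_bound_nonneg: "0 \<le> resolvent_bound K"
  using wishart_bound_ge(2) by (simp add: resolvent_bound_def)

text \<open>Entries of a Gram matrix are inner products of columns, bounded by half the sum of two
  squared lengths. Besides the rank bound, only the trace of the transmit covariance thus enters the
  final error.\<close>

lemma psd_entry_le_trace:
  assumes "B \<in> carrier_mat m n" "i < n" "j < n"
  shows "cmod ((B\<^sup>H * B) $$ (i, j)) \<le> Re (mtrace (B\<^sup>H * B))"
proof -
  note B = assms(1)
  have BH: "B\<^sup>H \<in> carrier_mat n m" using B by simp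
  have tr: "mtrace (B\<^sup>H * B) = complex_of_real (\<Sum>i<n. \<Sum>k<m. (cmod (B $$ (k, i)))\<^sup>2)"
    using mtrace_mult_adjoint_self[OF BH] B by simp
  have col: "(\<Sum>k<m. (cmod (B $$ (k, i)))\<^sup>2) \<le> Re (mtrace (B\<^sup>H * B))" if "i < n" for i
    unfolding tr Re_complex_of_real using that member_le_sum[of i "{..<n}" "\<lambda>i. \<Sum>k<m. (cmod (B $$ (k, i)))\<^sup>2"]
    by (simp add: sum_nonneg)
  have "cmod ((B\<^sup>H * B) $$ (i, j)) \<le> (\<Sum>k<m. cmod (B $$ (k, i)) * cmod (B $$ (k, j)))"
    unfolding index_mult_sum[OF BH B assms(2,3)] using B assms by (intro order_trans[OF norm_sum] sum_mono) (simp add: norm_mult)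
  also have "\<dots> \<le> (\<Sum>k<m. (1 / 2) * (cmod (B $$ (k, i)))\<^sup>2 + (1 / 2) * (cmod (B $$ (k, j)))\<^sup>2)"
  proof (rule sum_mono)
    fix k
    have "0 \<le> (cmod (B $$ (k, i)) - cmod (B $$ (k, j)))\<^sup>2" by simp
    then show "cmod (B $$ (k, i)) * cmod (B $$ (k, j)) \<le> (1 / 2) * (cmod (B $$ (k, i)))\<^sup>2 + (1 / 2) * (cmod (B $$ (k, j)))\<^sup>2"
      by (simp add: power2_diff)
  qed
  also have "\<dots> = (1 / 2) * (\<Sum>k<m. (cmod (B $$ (k, i)))\<^sup>2) + (1 / 2) * (\<Sum>k<m. (cmod (B $$ (k, j)))\<^sup>2)"
    by (simp only: sum.distrib sum_distrib_left)
  also have "\<dots> \<le> Re (mtrace (B\<^sup>H * B))" using col[OF assms(2)] col[OF assms(3)] by linarith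
  finally show ?thesis .
qed

text \<open>\<open>A\<close> is the signal factor in the eigenbasis of the limit, so its rows are orthogonal.\<close>

theorem (in prob_space) expected_resolvent_entry:
  fixes A :: "complex mat" and S :: "'a \<Rightarrow> complex mat" and t :: "nat \<Rightarrow> real" and \<rho> :: real
  assumes S: "iid_cgauss_mat M N n (1 / real n) S" and n: "0 < n" "2 * K \<le> n" and \<rho>: "0 < \<rho>"
    and A: "A \<in> carrier_mat N N" and AA: "A * A\<^sup>H = rdiag N t" and t: "\<And>i. i < N \<Longrightarrow> 0 \<le> t i"
    and K: "card {i. i < N \<and> t i \<noteq> 0} \<le> K"
    and e: "0 \<le> e" "e = (\<Sum>i<N. \<rho> * t i * (1 + e) / (1 + e + \<rho> * t i)) / real n"
  defines "Q \<equiv> (\<lambda>\<omega>. minv (1\<^sub>m N + complex_of_real \<rho> \<cdot>\<^sub>m (A * S \<omega> * (A * S \<omega>)\<^sup>H)))"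
  shows "\<And>i j. i < N \<Longrightarrow> j < N \<Longrightarrow> integrable M (\<lambda>\<omega>. Q \<omega> $$ (i, j))"
    and "\<And>i j. i < N \<Longrightarrow> j < N \<Longrightarrow>
      cmod (expectation (\<lambda>\<omega>. Q \<omega> $$ (i, j)) - (if i = j then complex_of_real ((1 + e) / (1 + e + \<rho> * t i)) else 0)) \<le>
        (if t i = 0 \<or> t j = 0 then 0 else resolvent_bound K / (real n)\<^sup>2)"
proof -
  define g where "g = (\<lambda>i. \<rho> * t i)"
  have g: "0 \<le> g i" if "i < N" for i using t[OF that] \<rho> by (simp add: g_def)
  \<comment> \<open>Normalising factors: row i of \<open>A\<close> is multiplied by sqrt \<rho> u i,
    so its squared length becomes \<open>p i = g i / (1 + g i)\<close>, at most 1 however large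
    \<open>t i\<close> is.\<close>
  define u where "u = (\<lambda>i. sqrt (1 / (1 + g i)))"
  define p where "p = (\<lambda>i. g i / (1 + g i))"
  define c where "c = (\<lambda>i k. complex_of_real (sqrt \<rho> * u i) * A $$ (i, k))"
  \<comment> \<open>\<open>S\<close> is known to have the right format on the sample space only;
    \<open>S'\<close> coincides with it on that space and has the format everywhere, as the
    measurability lemma demands.\<close>
  define S' where "S' = (\<lambda>\<omega>. Matrix.mat N n (\<lambda>q. S \<omega> $$ q))"
  have S'c: "S' \<omega> \<in> carrier_mat N n" for \<omega> by (simp add: S'_def)
  have Sm: "S \<in> measurable M (mat_space N n)" using S by (simp add: iid_cgauss_mat_def)
  have SS': "S \<omega> = S' \<omega>" if "\<omega> \<in> space M" for \<omega>
    using measurable_space[OF Sm that] by (intro eq_matI) (auto simp: S'_def)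
  have S'q: "S' \<omega> $$ (k, s) = S \<omega> $$ (k, s)" if "k < N" "s < n" for \<omega> k s using that by (simp add: S'_def)
  define Y where "Y = (\<lambda>\<omega>. complex_of_real \<rho> \<cdot>\<^sub>m (A * S' \<omega> * (A * S' \<omega>)\<^sup>H))"
  have ASc: "A * S' \<omega> \<in> carrier_mat N n" for \<omega> using A S'c by auto
  have Yc: "Y \<omega> \<in> carrier_mat N N" for \<omega> using ASc[of \<omega>] by (simp add: Y_def mult_carrier_mat[of _ N n _ N])
  have Y: "psd N (Y \<omega>)" for \<omega>
  proof -
    define C where "C = complex_of_real (sqrt \<rho>) \<cdot>\<^sub>m (A * S' \<omega>)\<^sup>H"
    have Cc: "C \<in> carrier_mat n N" using ASc by (simp add: C_def)
    have "C\<^sup>H * C = Y \<omega>"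
    proof (rule eq_matI)
      fix i j assume "i < dim_row (Y \<omega>)" "j < dim_col (Y \<omega>)"
      then have ij: "i < N" "j < N" using Yc[of \<omega>] by auto
      have sq: "complex_of_real (sqrt \<rho>) * complex_of_real (sqrt \<rho>) = complex_of_real \<rho>" using \<rho> by (simp flip: of_real_mult)
      have CH: "C\<^sup>H \<in> carrier_mat N n" using Cc by simp
      have "(C\<^sup>H * C) $$ (i, j) = (\<Sum>k<n. (complex_of_real (sqrt \<rho>) * complex_of_real (sqrt \<rho>)) * ((A * S' \<omega>) $$ (i, k) * cnj ((A * S' \<omega>) $$ (j, k))))"
        unfolding index_mult_sum[OF CH Cc ij] using Cc ASc[of \<omega>] ij carrier_matD[OF ASc[of \<omega>]]
        by (intro sum.cong refl) (simp add: C_def mult_ac del: index_mult_mat)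
      also have "\<dots> = Y \<omega> $$ (i, j)"
        unfolding sq Y_def using ASc[of \<omega>] ij carrier_matD[OF ASc[of \<omega>]]
        by (simp add: index_mult_sum[OF ASc adjoint_carrier[OF ASc] ij] sum_distrib_left del: index_mult_mat(1))
      finally show "(C\<^sup>H * C) $$ (i, j) = Y \<omega> $$ (i, j)" .
    qed (use Cc Yc[of \<omega>] in auto)
    then show ?thesis using psd_gram[OF Cc] by simp
  qed
  define w where "w = (\<lambda>i s \<omega>. \<Sum>k<N. c i k * S \<omega> $$ (k, s))"
  define Xf where "Xf = (\<lambda>i j \<omega>. (\<Sum>s<n. w i s \<omega> * cnj (w j s \<omega>)) - (if i = j then complex_of_real (p i) else 0))"
  define X where "X = (\<lambda>\<omega>. Matrix.mat N N (\<lambda>(i, j). Xf i j \<omega>))"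
  have Xc: "X \<omega> \<in> carrier_mat N N" for \<omega> by (simp add: X_def)
  have Xij: "X \<omega> $$ (i, j) = Xf i j \<omega>" if "i < N" "j < N" for i j \<omega> using that by (simp add: X_def)
  have Yij: "Y \<omega> $$ (i, j) = complex_of_real \<rho> * (\<Sum>s<n. (\<Sum>k<N. A $$ (i, k) * S \<omega> $$ (k, s)) * cnj (\<Sum>k<N. A $$ (j, k) * S \<omega> $$ (k, s)))"
    if ij: "i < N" "j < N" for i j \<omega>
  proof -
    have as: "(A * S' \<omega>) $$ (i, s) = (\<Sum>k<N. A $$ (i, k) * S \<omega> $$ (k, s))" if "i < N" "s < n" for i s
      unfolding index_mult_sum[OF A S'c that] using that by (intro sum.cong refl) (simp add: S'q)
    have "(A * S' \<omega> * (A * S' \<omega>)\<^sup>H) $$ (i, j) = (\<Sum>s<n. (A * S' \<omega>) $$ (i, s) * cnj ((A * S' \<omega>) $$ (j, s)))"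
      unfolding index_mult_sum[OF ASc adjoint_carrier[OF ASc] ij] using ij carrier_matD[OF ASc[of \<omega>]]
      by (intro sum.cong refl) (simp del: index_mult_mat)
    moreover have "Y \<omega> $$ (i, j) = complex_of_real \<rho> * (A * S' \<omega> * (A * S' \<omega>)\<^sup>H) $$ (i, j)"
      unfolding Y_def by (rule index_smult_mat) (use ij carrier_matD[OF ASc[of \<omega>]] in auto)
    moreover have "(\<Sum>s<n. (A * S' \<omega>) $$ (i, s) * cnj ((A * S' \<omega>) $$ (j, s))) =
        (\<Sum>s<n. (\<Sum>k<N. A $$ (i, k) * S \<omega> $$ (k, s)) * cnj (\<Sum>k<N. A $$ (j, k) * S \<omega> $$ (k, s)))"
      by (intro sum.cong refl) (simp only: as[OF ij(1)] as[OF ij(2)] lessThan_iff)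
    ultimately show ?thesis by (simp only:)
  qed
  have wA: "w i s \<omega> = complex_of_real (sqrt \<rho> * u i) * (\<Sum>k<N. A $$ (i, k) * S \<omega> $$ (k, s))" for i s \<omega>
    by (simp add: w_def c_def sum_distrib_left mult_ac)
  have XY: "X \<omega> $$ (i, j) = complex_of_real (sqrt (1 / (1 + g i))) * complex_of_real (sqrt (1 / (1 + g j))) * Y \<omega> $$ (i, j)
      - (if i = j then complex_of_real (g i / (1 + g i)) else 0)" if ij: "i < N" "j < N" for i j \<omega>
  proof -
    have sq: "complex_of_real (sqrt \<rho>) * complex_of_real (sqrt \<rho>) = complex_of_real \<rho>" using \<rho> by (simp flip: of_real_mult)
    have "w i s \<omega> * cnj (w j s \<omega>) = complex_of_real (u i) * complex_of_real (u j) * ((complex_of_real (sqrt \<rho>) * complex_of_real (sqrt \<rho>)) *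
        ((\<Sum>k<N. A $$ (i, k) * S \<omega> $$ (k, s)) * cnj (\<Sum>k<N. A $$ (j, k) * S \<omega> $$ (k, s))))" for s
      unfolding wA complex_cnj_mult complex_cnj_complex_of_real of_real_mult by (simp only: mult_ac)
    then show ?thesis unfolding Xij[OF ij] Xf_def Yij[OF ij] sq
      by (simp only: sum_distrib_left[symmetric] u_def p_def)
  qed
  have u2: "u i * u i = 1 / (1 + g i)" if "i < N" for i using g[OF that] by (simp add: u_def)
  have orth: "(\<Sum>k<N. c i k * cnj (c j k)) = (if i = j then complex_of_real (p i) else 0)" if ij: "i < N" "j < N" for i j
  proof -
    have "(\<Sum>k<N. c i k * cnj (c j k)) = complex_of_real (sqrt \<rho> * u i) * complex_of_real (sqrt \<rho> * u j) * (\<Sum>k<N. A $$ (i, k) * cnj (A $$ (j, k)))"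
      by (simp add: c_def sum_distrib_left mult_ac)
    also have "(\<Sum>k<N. A $$ (i, k) * cnj (A $$ (j, k))) = rdiag N t $$ (i, j)"
      unfolding AA[symmetric] index_mult_sum[OF A adjoint_carrier[OF A] ij] using A ij by (intro sum.cong refl) simp
    also have "complex_of_real (sqrt \<rho> * u i) * complex_of_real (sqrt \<rho> * u j) * rdiag N t $$ (i, j) = (if i = j then complex_of_real (p i) else 0)"
    proof (cases "i = j")
      case True
      have "(sqrt \<rho> * u i) * (sqrt \<rho> * u i) * t i = (sqrt \<rho> * sqrt \<rho>) * (u i * u i) * t i" by (simp only: mult_ac)
      also have "\<dots> = p i" unfolding u2[OF ij(1)] using \<rho> by (simp add: p_def g_def)
      finally have "(sqrt \<rho> * u i) * (sqrt \<rho> * u i) * t i = p i" .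
      then show ?thesis using True ij by (simp only: index_rdiag if_True refl of_real_mult[symmetric])
    qed (use ij in simp)
    finally show ?thesis .
  qed
  have p1: "p i \<le> 1" if "i < N" for i using g[OF that] by (simp add: p_def)
  note W = wishart_deviation_moments[where J = "{..<N}" and c = c and p = p, OF S n(1)]
  have W1: "all_moments M (Xf i j)" if "i < N" "j < N" for i j
    unfolding Xf_def w_def by (rule W(1)) (use orth p1 that in auto)
  have W2: "expectation (Xf i j) = 0" if "i < N" "j < N" for i j
    unfolding Xf_def w_def by (rule W(2)) (use orth p1 that in auto)
  have W3: "expectation (\<lambda>\<omega>. Xf i k \<omega> * Xf k j \<omega>) = (if i = j then complex_of_real (p i * p k / real n) else 0)"
    if "i < N" "j < N" "k < N" for i j k
    unfolding Xf_def w_def by (rule W(3)) (use orth p1 that in auto)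
  have W4: "cmod (expectation (\<lambda>\<omega>. Xf i k \<omega> * Xf k l \<omega> * Xf l j \<omega>)) \<le> wishart_bound / (real n)\<^sup>2"
    if "i < N" "j < N" "k < N" "l < N" for i j k l
    unfolding Xf_def w_def by (rule W(4)) (use orth p1 that in auto)
  have W5: "expectation (\<lambda>\<omega>. cmod (Xf i j \<omega>) ^ 4) \<le> wishart_bound / (real n)\<^sup>2" if "i < N" "j < N" for i j
    unfolding Xf_def w_def by (rule W(5)) (use orth p1 that in auto)
  define J where "J = {i. i < N \<and> t i \<noteq> 0}"
  have cardJ: "card J \<le> K" using K by (simp add: J_def)
  \<comment> \<open>Row i of \<open>A\<close> has squared length \<open>t i\<close>, so null
    directions of the limit carry no signal, and \<open>X\<close> and \<open>Y\<close> vanish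
    there.\<close>
  have A0: "A $$ (i, k) = 0" if "i < N" "t i = 0" "k < N" for i k
  proof -
    have "(\<Sum>k<N. A $$ (i, k) * cnj (A $$ (i, k))) = (A * A\<^sup>H) $$ (i, i)"
      unfolding index_mult_sum[OF A adjoint_carrier[OF A] that(1) that(1)] using A that by (intro sum.cong refl) simp
    also have "\<dots> = 0" unfolding AA using that by simp
    finally have "complex_of_real (\<Sum>k<N. (cmod (A $$ (i, k)))\<^sup>2) = 0" by (simp only: of_real_sum complex_norm_square)
    then have "(\<Sum>k<N. (cmod (A $$ (i, k)))\<^sup>2) = 0" by (simp only: of_real_eq_0_iff)
    then show ?thesis using that by (subst (asm) sum_nonneg_eq_0_iff) auto
  qed
  have X0: "Xf i j \<omega> = 0" if "i < N" "j < N" "t i = 0 \<or> t j = 0" for i j \<omega>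
    using that A0 by (auto simp: Xf_def w_def c_def p_def g_def)
  have Y0: "Y \<omega> $$ (i, j) = 0" if "i < N" "j < N" "t i = 0 \<or> t j = 0" for i j \<omega>
    using that A0 by (auto simp: Yij)
  define Q' where "Q' = (\<lambda>\<omega>. minv (1\<^sub>m N + Y \<omega>))"
  have QQ': "Q \<omega> = Q' \<omega>" if "\<omega> \<in> space M" for \<omega> by (simp add: Q_def Q'_def Y_def SS'[OF that])
  have one_smult: "1\<^sub>m N + complex_of_real 1 \<cdot>\<^sub>m Y \<omega> = 1\<^sub>m N + Y \<omega>" for \<omega> by (rule eq_matI) auto
  have IYc: "1\<^sub>m N + Y \<omega> \<in> carrier_mat N N" for \<omega> using Yc by simp
  have Q'c: "Q' \<omega> \<in> carrier_mat N N" and Q'I: "(1\<^sub>m N + Y \<omega>) * Q' \<omega> = 1\<^sub>m N" for \<omega>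
    using resolvent_psd[OF Y, of 1 \<omega>] one_smult by (simp_all add: Q'_def)
  \<comment> \<open>Read off from Q' + Y Q' = 1 and Q' + Q' Y = 1: in null directions the resolvent
    is the identity for every sample, so no error arises there.\<close>
  have Q'0: "Q' \<omega> $$ (i, j) = 1\<^sub>m N $$ (i, j)" if ij: "i < N" "j < N" and z: "t i = 0 \<or> t j = 0" for i j \<omega>
  proof -
    have "Q' \<omega> + Y \<omega> * Q' \<omega> = 1\<^sub>m N" using add_mult_distrib_mat[OF one_carrier_mat Yc[of \<omega>] Q'c[of \<omega>]] Q'I[of \<omega>] left_mult_one_mat[OF Q'c[of \<omega>]] by simp
    then have r: "Q' \<omega> $$ (i, j) + (Y \<omega> * Q' \<omega>) $$ (i, j) = 1\<^sub>m N $$ (i, j)"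
      using ij Q'c[of \<omega>] Yc[of \<omega>] by (metis carrier_matD(1) carrier_matD(2) index_add_mat(1) mult_carrier_mat)
    have "Q' \<omega> * (1\<^sub>m N + Y \<omega>) = 1\<^sub>m N" by (rule mat_mult_left_right_inverse[OF IYc Q'c Q'I])
    then have "Q' \<omega> + Q' \<omega> * Y \<omega> = 1\<^sub>m N" using mult_add_distrib_mat[OF Q'c one_carrier_mat Yc] Q'c[of \<omega>] by simp
    then have l: "Q' \<omega> $$ (i, j) + (Q' \<omega> * Y \<omega>) $$ (i, j) = 1\<^sub>m N $$ (i, j)"
      using ij Q'c[of \<omega>] Yc[of \<omega>] by (metis carrier_matD(1) carrier_matD(2) index_add_mat(1) mult_carrier_mat)
    from z show ?thesis
    proof
      assume "t i = 0"
      then have "(Y \<omega> * Q' \<omega>) $$ (i, j) = 0" unfolding index_mult_sum[OF Yc Q'c ij] using Y0 ij by simp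
      then show ?thesis using r by simp
    next
      assume "t j = 0"
      then have "(Q' \<omega> * Y \<omega>) $$ (i, j) = 0" unfolding index_mult_sum[OF Q'c Yc ij] using Y0 ij by simp
      then show ?thesis using l by simp
    qed
  qed
  have Ym: "(\<lambda>\<omega>. Y \<omega> $$ (i, j)) \<in> borel_measurable M" if ij: "i < N" "j < N" for i j
  proof -
    have m1: "(\<lambda>\<omega>. \<Sum>k<N. A $$ (i, k) * S \<omega> $$ (k, s)) \<in> borel_measurable M" if "s < n" for i s
      using measurable_compose[OF Sm measurable_mat_entry] that by (intro borel_measurable_sum borel_measurable_times borel_measurable_const) auto
    have m2: "(\<lambda>\<omega>. cnj (\<Sum>k<N. A $$ (j, k) * S \<omega> $$ (k, s))) \<in> borel_measurable M" if "s < n" for s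
      by (rule measurable_compose[OF m1[OF that] borel_measurable_continuous_onI[OF continuous_on_cnj[OF continuous_on_id]]])
    show ?thesis unfolding Yij[OF ij]
      by (rule borel_measurable_times[OF borel_measurable_const], rule borel_measurable_sum, rule borel_measurable_times[OF m1 m2]) auto
  qed
  have Q'm: "(\<lambda>\<omega>. Q' \<omega> $$ (i, j)) \<in> borel_measurable M" if ij: "i < N" "j < N" for i j
    unfolding Q'_def
  proof (rule measurable_minv_entry[OF _ _ _ ij])
    show "1\<^sub>m N + Y \<omega> \<in> carrier_mat N N" for \<omega> by (rule IYc)
    show "\<exists>B\<in>carrier_mat N N. (1\<^sub>m N + Y \<omega>) * B = 1\<^sub>m N" for \<omega> using Q'c Q'I by blast
    show "(\<lambda>\<omega>. (1\<^sub>m N + Y \<omega>) $$ (i, j)) \<in> borel_measurable M" if "i < N" "j < N" for i j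
    proof -
      have "(1\<^sub>m N + Y \<omega>) $$ (i, j) = 1\<^sub>m N $$ (i, j) + Y \<omega> $$ (i, j)" for \<omega> using that Yc[of \<omega>] by simp
      then show ?thesis using Ym[OF that] by simp
    qed
  qed
  have Q'int: "integrable M (\<lambda>\<omega>. Q' \<omega> $$ (i, j))" if ij: "i < N" "j < N" for i j
    by (rule integrable_const_bound[of _ 1]) (use resolvent_entry_le_1[OF Y ij] Q'm[OF ij] in \<open>auto simp: Q'_def\<close>)
  show "integrable M (\<lambda>\<omega>. Q \<omega> $$ (i, j))" if ij: "i < N" "j < N" for i j
    using Q'int[OF ij] by (rule Bochner_Integration.integrable_cong[THEN iffD1, rotated -1]) (simp_all add: QQ')
  have EQ: "expectation (\<lambda>\<omega>. Q \<omega> $$ (i, j)) = expectation (\<lambda>\<omega>. Q' \<omega> $$ (i, j))" for i j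
    by (rule Bochner_Integration.integral_cong) (simp_all add: QQ')
  show "cmod (expectation (\<lambda>\<omega>. Q \<omega> $$ (i, j)) - (if i = j then complex_of_real ((1 + e) / (1 + e + \<rho> * t i)) else 0)) \<le>
        (if t i = 0 \<or> t j = 0 then 0 else resolvent_bound K / (real n)\<^sup>2)" if ij: "i < N" "j < N" for i j
  proof (cases "t i = 0 \<or> t j = 0")
    case True
    have "expectation (\<lambda>\<omega>. Q' \<omega> $$ (i, j)) = 1\<^sub>m N $$ (i, j)"
      unfolding Q'0[OF ij True] by (simp add: prob_space)
    moreover have "(if i = j then complex_of_real ((1 + e) / (1 + e + \<rho> * t i)) else 0) = 1\<^sub>m N $$ (i, j)"
    proof (cases "i = j")
      case i: True
      then have "t i = 0" using True by simp
      then have "(1 + e) / (1 + e + \<rho> * t i) = 1" using e(1) by simp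
      then show ?thesis using i ij by (simp only: if_True refl of_real_1 index_one_mat)
    qed (use ij in simp)
    ultimately show ?thesis unfolding EQ using True by simp
  next
    case False
    let ?P = "\<lambda>\<omega>. 1\<^sub>m N $$ (i, j) - X \<omega> $$ (i, j) + (X \<omega> * X \<omega>) $$ (i, j) - (X \<omega> * X \<omega> * X \<omega>) $$ (i, j)"
    let ?u = "complex_of_real (u i * u j)"
    have XXc: "X \<omega> * X \<omega> \<in> carrier_mat N N" for \<omega> using Xc[of \<omega>] by auto
    have XX: "(X \<omega> * X \<omega>) $$ (i, j) = (\<Sum>k<N. Xf i k \<omega> * Xf k j \<omega>)" if "i < N" "j < N" for i j \<omega>
      unfolding index_mult_sum[OF Xc Xc that] using that by (intro sum.cong refl) (simp add: Xij)
    \<comment> \<open>The inner indices may be restricted to \<open>J\<close>, which keeps the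
      number of third-order terms at K^2 at most.\<close>
    have XXX: "(X \<omega> * X \<omega> * X \<omega>) $$ (i, j) = (\<Sum>l\<in>J. \<Sum>k\<in>J. Xf i k \<omega> * Xf k l \<omega> * Xf l j \<omega>)" for \<omega>
    proof -
      have "(X \<omega> * X \<omega> * X \<omega>) $$ (i, j) = (\<Sum>l<N. (\<Sum>k<N. Xf i k \<omega> * Xf k l \<omega>) * Xf l j \<omega>)"
        unfolding index_mult_sum[OF XXc Xc ij] using ij by (intro sum.cong refl) (simp only: XX Xij lessThan_iff)
      also have "\<dots> = (\<Sum>l\<in>J. (\<Sum>k<N. Xf i k \<omega> * Xf k l \<omega>) * Xf l j \<omega>)"
        using ij X0 by (intro sum.mono_neutral_right) (auto simp: J_def)
      also have "\<dots> = (\<Sum>l\<in>J. (\<Sum>k\<in>J. Xf i k \<omega> * Xf k l \<omega>) * Xf l j \<omega>)"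
        using ij X0 by (intro sum.cong refl arg_cong2[where f="(*)"] sum.mono_neutral_right) (auto simp: J_def)
      finally show ?thesis by (simp only: sum_distrib_right)
    qed
    have JN: "k < N" if "k \<in> J" for k using that by (simp add: J_def)
    have mX: "all_moments M (Xf a b)" if "a < N" "b < N" for a b by (rule W1[OF that])
    have i1: "integrable M (\<lambda>\<omega>. X \<omega> $$ (i, j))" unfolding Xij[OF ij] by (intro all_moments_integrable mX ij)
    have i2: "integrable M (\<lambda>\<omega>. (X \<omega> * X \<omega>) $$ (i, j))"
      unfolding XX[OF ij] using ij by (intro all_moments_integrable all_moments_sum all_moments_mult mX) auto
    have i3: "integrable M (\<lambda>\<omega>. (X \<omega> * X \<omega> * X \<omega>) $$ (i, j))"
      unfolding XXX using ij JN by (intro all_moments_integrable all_moments_sum all_moments_mult mX) auto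
    have E1: "expectation (\<lambda>\<omega>. X \<omega> $$ (i, j)) = 0" unfolding Xij[OF ij] by (rule W2[OF ij])
    \<comment> \<open>The term of order 1 / n is kept exactly, to be matched with the expansion of
      the fixed point.\<close>
    have E2: "expectation (\<lambda>\<omega>. (X \<omega> * X \<omega>) $$ (i, j)) = (if i = j then complex_of_real (p i * (\<Sum>k<N. p k) / real n) else 0)"
    proof -
      have "expectation (\<lambda>\<omega>. (X \<omega> * X \<omega>) $$ (i, j)) = (\<Sum>k<N. expectation (\<lambda>\<omega>. Xf i k \<omega> * Xf k j \<omega>))"
        unfolding XX[OF ij] using ij by (intro Bochner_Integration.integral_sum all_moments_integrable all_moments_mult mX) auto
      also have "\<dots> = (\<Sum>k<N. if i = j then complex_of_real (p i * p k / real n) else 0)"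
        using ij by (intro sum.cong refl W3) auto
      finally show ?thesis by (simp add: sum_distrib_left sum_divide_distrib)
    qed
    have E3: "cmod (expectation (\<lambda>\<omega>. (X \<omega> * X \<omega> * X \<omega>) $$ (i, j))) \<le> (real K)\<^sup>2 * (wishart_bound / (real n)\<^sup>2)"
    proof -
      have "expectation (\<lambda>\<omega>. (X \<omega> * X \<omega> * X \<omega>) $$ (i, j)) = (\<Sum>l\<in>J. expectation (\<lambda>\<omega>. \<Sum>k\<in>J. Xf i k \<omega> * Xf k l \<omega> * Xf l j \<omega>))"
        unfolding XXX using ij JN by (intro Bochner_Integration.integral_sum all_moments_integrable all_moments_sum all_moments_mult mX) auto
      also have "\<dots> = (\<Sum>l\<in>J. \<Sum>k\<in>J. expectation (\<lambda>\<omega>. Xf i k \<omega> * Xf k l \<omega> * Xf l j \<omega>))"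
        using ij JN by (intro sum.cong refl Bochner_Integration.integral_sum all_moments_integrable all_moments_mult mX) auto
      finally have "cmod (expectation (\<lambda>\<omega>. (X \<omega> * X \<omega> * X \<omega>) $$ (i, j))) \<le> (\<Sum>l\<in>J. \<Sum>k\<in>J. cmod (expectation (\<lambda>\<omega>. Xf i k \<omega> * Xf k l \<omega> * Xf l j \<omega>)))"
        by (simp only:) (intro order_trans[OF norm_sum] sum_mono order_refl)
      also have "\<dots> \<le> (\<Sum>l\<in>J. \<Sum>k\<in>J. wishart_bound / (real n)\<^sup>2)"
        using ij JN by (intro sum_mono W4) auto
      also have "\<dots> = (real (card J))\<^sup>2 * (wishart_bound / (real n)\<^sup>2)" by (simp add: power2_eq_square)
      also have "\<dots> \<le> (real K)\<^sup>2 * (wishart_bound / (real n)\<^sup>2)"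
        using cardJ wishart_bound_ge(2) by (intro mult_right_mono power_mono) auto
      finally show ?thesis .
    qed
    \<comment> \<open>Cauchy-Schwarz over the pairs in J x J turns the square of a sum of squares
      into a sum of fourth powers.\<close>
    have F: "fro_norm (X \<omega>) ^ 4 \<le> (real K)\<^sup>2 * (\<Sum>a\<in>J. \<Sum>b\<in>J. cmod (Xf a b \<omega>) ^ 4)" for \<omega>
    proof -
      have "(fro_norm (X \<omega>))\<^sup>2 = (\<Sum>a<N. \<Sum>b<N. (cmod (Xf a b \<omega>))\<^sup>2)"
        unfolding fro_norm_square[OF Xc] by (intro sum.cong refl) (simp add: Xij)
      also have "\<dots> = (\<Sum>a\<in>J. \<Sum>b<N. (cmod (Xf a b \<omega>))\<^sup>2)"
        using X0 by (intro sum.mono_neutral_right) (auto simp: J_def)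
      also have "\<dots> = (\<Sum>a\<in>J. \<Sum>b\<in>J. (cmod (Xf a b \<omega>))\<^sup>2)"
        using X0 by (intro sum.cong refl sum.mono_neutral_right) (auto simp: J_def)
      also have "\<dots> = (\<Sum>q\<in>J \<times> J. (cmod (Xf (fst q) (snd q) \<omega>))\<^sup>2)" by (simp add: sum.cartesian_product split_beta)
      finally have "((fro_norm (X \<omega>))\<^sup>2)\<^sup>2 = (\<Sum>q\<in>J \<times> J. (cmod (Xf (fst q) (snd q) \<omega>))\<^sup>2)\<^sup>2" by simp
      also have "\<dots> \<le> (\<Sum>q\<in>J \<times> J. ((cmod (Xf (fst q) (snd q) \<omega>))\<^sup>2)\<^sup>2) * real (card (J \<times> J))"
        by (rule sum_squared_le_sum_of_squares)
      also have "\<dots> = (real (card J))\<^sup>2 * (\<Sum>a\<in>J. \<Sum>b\<in>J. cmod (Xf a b \<omega>) ^ 4)"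
        by (simp add: sum.cartesian_product split_beta card_cartesian_product power2_eq_square mult.commute flip: power_mult)
          (simp add: power4_eq_xxxx mult_ac)
      also have "\<dots> \<le> (real K)\<^sup>2 * (\<Sum>a\<in>J. \<Sum>b\<in>J. cmod (Xf a b \<omega>) ^ 4)"
        using cardJ by (intro mult_right_mono power_mono sum_nonneg) auto
      finally show ?thesis by (simp flip: power_mult)
    qed
    have i4: "integrable M (\<lambda>\<omega>. cmod (Xf a b \<omega>) ^ 4)" if "a < N" "b < N" for a b by (rule all_moments_norm_power[OF mX[OF that]])
    have iF: "integrable M (\<lambda>\<omega>. (real K)\<^sup>2 * (\<Sum>a\<in>J. \<Sum>b\<in>J. cmod (Xf a b \<omega>) ^ 4))"
      using JN by (intro integrable_mult_right Bochner_Integration.integrable_sum i4) auto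
    have EF: "expectation (\<lambda>\<omega>. (real K)\<^sup>2 * (\<Sum>a\<in>J. \<Sum>b\<in>J. cmod (Xf a b \<omega>) ^ 4)) \<le> (real K) ^ 4 * (wishart_bound / (real n)\<^sup>2)"
    proof -
      have "expectation (\<lambda>\<omega>. (real K)\<^sup>2 * (\<Sum>a\<in>J. \<Sum>b\<in>J. cmod (Xf a b \<omega>) ^ 4)) = (real K)\<^sup>2 * (\<Sum>a\<in>J. expectation (\<lambda>\<omega>. \<Sum>b\<in>J. cmod (Xf a b \<omega>) ^ 4))"
        using JN by (simp add: Bochner_Integration.integral_sum i4)
      also have "\<dots> = (real K)\<^sup>2 * (\<Sum>a\<in>J. \<Sum>b\<in>J. expectation (\<lambda>\<omega>. cmod (Xf a b \<omega>) ^ 4))"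
        using JN by (simp add: Bochner_Integration.integral_sum i4)
      also have "\<dots> \<le> (real K)\<^sup>2 * (\<Sum>a\<in>J. \<Sum>b\<in>J. wishart_bound / (real n)\<^sup>2)"
        using JN by (intro mult_left_mono sum_mono W5) auto
      also have "\<dots> = (real K)\<^sup>2 * ((real (card J))\<^sup>2 * (wishart_bound / (real n)\<^sup>2))" by (simp add: power2_eq_square)
      also have "\<dots> \<le> (real K)\<^sup>2 * ((real K)\<^sup>2 * (wishart_bound / (real n)\<^sup>2))"
        using cardJ wishart_bound_ge(2) by (intro mult_left_mono mult_right_mono power_mono) auto
      finally show ?thesis by (simp add: power2_eq_square power4_eq_xxxx mult_ac)
    qed
    have iP: "integrable M ?P" using i1 i2 i3 by simp
    have EP: "expectation ?P = (if i = j then complex_of_real (1 + p i * (\<Sum>k<N. p k) / real n) else 0) - expectation (\<lambda>\<omega>. (X \<omega> * X \<omega> * X \<omega>) $$ (i, j))"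
    proof -
      have "expectation ?P = 1\<^sub>m N $$ (i, j) - expectation (\<lambda>\<omega>. X \<omega> $$ (i, j)) + expectation (\<lambda>\<omega>. (X \<omega> * X \<omega>) $$ (i, j)) - expectation (\<lambda>\<omega>. (X \<omega> * X \<omega> * X \<omega>) $$ (i, j))"
        using i1 i2 i3 by (simp add: prob_space del: index_one_mat index_mult_mat)
      then show ?thesis unfolding E1 E2 using ij by simp
    qed
    have rem: "cmod (Q' \<omega> $$ (i, j) - ?u * ?P \<omega>) \<le> 46 * ((real K)\<^sup>2 * (\<Sum>a\<in>J. \<Sum>b\<in>J. cmod (Xf a b \<omega>) ^ 4))" for \<omega>
    proof -
      have "cmod (Q' \<omega> $$ (i, j) - ?u * ?P \<omega>) \<le> 46 * fro_norm (X \<omega>) ^ 4"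
        unfolding Q'_def u_def by (rule resolvent_expansion[OF Y g Xc XY ij]) auto
      then show ?thesis using F[of \<omega>] by linarith
    qed
    have iuP: "integrable M (\<lambda>\<omega>. ?u * ?P \<omega>)" by (rule integrable_mult_right) (rule iP)
    have iD: "integrable M (\<lambda>\<omega>. Q' \<omega> $$ (i, j) - ?u * ?P \<omega>)"
      by (rule Bochner_Integration.integrable_diff[OF Q'int[OF ij] iuP])
    have iF46: "integrable M (\<lambda>\<omega>. 46 * ((real K)\<^sup>2 * (\<Sum>a\<in>J. \<Sum>b\<in>J. cmod (Xf a b \<omega>) ^ 4)))"
      by (rule integrable_mult_right) (rule iF)
    have R: "cmod (expectation (\<lambda>\<omega>. Q' \<omega> $$ (i, j)) - ?u * expectation ?P) \<le> 46 * (real K ^ 4 * (wishart_bound / (real n)\<^sup>2))"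
    proof -
      have "expectation (\<lambda>\<omega>. Q' \<omega> $$ (i, j)) - ?u * expectation ?P = expectation (\<lambda>\<omega>. Q' \<omega> $$ (i, j) - ?u * ?P \<omega>)"
        unfolding Bochner_Integration.integral_diff[OF Q'int[OF ij] iuP] integral_mult_right_zero ..
      then have "cmod (expectation (\<lambda>\<omega>. Q' \<omega> $$ (i, j)) - ?u * expectation ?P) \<le> expectation (\<lambda>\<omega>. cmod (Q' \<omega> $$ (i, j) - ?u * ?P \<omega>))"
        using integral_norm_bound[of M "\<lambda>\<omega>. Q' \<omega> $$ (i, j) - ?u * ?P \<omega>"] by (simp only:)
      also have "\<dots> \<le> expectation (\<lambda>\<omega>. 46 * ((real K)\<^sup>2 * (\<Sum>a\<in>J. \<Sum>b\<in>J. cmod (Xf a b \<omega>) ^ 4)))"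
        by (rule integral_mono[OF integrable_norm[OF iD] iF46 rem])
      also have "\<dots> = 46 * expectation (\<lambda>\<omega>. (real K)\<^sup>2 * (\<Sum>a\<in>J. \<Sum>b\<in>J. cmod (Xf a b \<omega>) ^ 4))" by (rule integral_mult_right_zero)
      finally show ?thesis using EF by linarith
    qed
    define m where "m = (if i = j then complex_of_real ((1 + e) / (1 + e + \<rho> * t i)) else 0)"
    have uij: "0 \<le> u i * u j" "u i * u j \<le> 1"
    proof -
      have "0 \<le> u k" "u k \<le> 1" if "k < N" for k using g[OF that] by (simp_all add: u_def)
      then show "0 \<le> u i * u j" "u i * u j \<le> 1" using ij by (auto intro: mult_le_one)
    qed
    have D: "cmod (?u * expectation ?P - m) \<le> (real K)\<^sup>2 * (wishart_bound / (real n)\<^sup>2) + 6 * (real K)\<^sup>2 / (real n)\<^sup>2"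
    proof -
      let ?E3 = "expectation (\<lambda>\<omega>. (X \<omega> * X \<omega> * X \<omega>) $$ (i, j))"
      let ?d = "if i = j then complex_of_real (1 + p i * (\<Sum>k<N. p k) / real n) else 0"
      have h1: "cmod (?u * ?d - m) \<le> 6 * (real K)\<^sup>2 / (real n)\<^sup>2"
      proof (cases "i = j")
        case True
        have "\<bar>(1 + e) / (1 + e + g i) - 1 / (1 + g i) * (1 + g i / (1 + g i) * (\<Sum>k<N. g k / (1 + g k)) / real n)\<bar> \<le> 6 * (real K)\<^sup>2 / (real n)\<^sup>2"
        proof (rule deterministic_equivalent_expansion[OF g e(1) _ _ n ij(1)])
          show "e = (\<Sum>i<N. g i * (1 + e) / (1 + e + g i)) / real n" using e(2) by (simp only: g_def)
          have "{i. i < N \<and> g i \<noteq> 0} = J" using \<rho> by (auto simp: J_def g_def)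
          then show "card {i. i < N \<and> g i \<noteq> 0} \<le> K" using cardJ by simp
        qed auto
        \<comment> \<open>For i = j the factor \<open>u i * u j\<close> is 1 / (1 + g i), so the
          mean up to second order is exactly the first-order expansion of the fixed point
          formula.\<close>
        moreover have "?u * ?d - m = complex_of_real (- ((1 + e) / (1 + e + g i) - 1 / (1 + g i) * (1 + g i / (1 + g i) * (\<Sum>k<N. g k / (1 + g k)) / real n)))"
        proof -
          have "?u = complex_of_real (1 / (1 + g i))" using u2[OF ij(1)] True by simp
          then show ?thesis using True unfolding m_def g_def[symmetric] by (simp only: if_True p_def g_def of_real_mult of_real_diff of_real_minus minus_diff_eq refl)
        qed
        ultimately show ?thesis by (simp only: norm_of_real abs_minus_cancel)
      qed (simp add: m_def)
      have h2: "cmod (?u * ?E3) \<le> (real K)\<^sup>2 * (wishart_bound / (real n)\<^sup>2)"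
      proof -
        have "cmod (?u * ?E3) = (u i * u j) * cmod ?E3" using uij by (simp only: norm_mult norm_of_real abs_of_nonneg)
        also have "\<dots> \<le> 1 * cmod ?E3" using uij by (intro mult_right_mono) auto
        finally show ?thesis using E3 by simp
      qed
      have eq: "?u * expectation ?P - m = (?u * ?d - m) - ?u * ?E3"
        unfolding EP right_diff_distrib by (simp only: diff_diff_eq add.commute)
      show ?thesis
        unfolding eq by (subst add.commute) (rule order_trans[OF norm_triangle_ineq4 add_mono[OF h1 h2]])
    qed
    have tri: "cmod (a - b) \<le> cmod (a - c) + cmod (c - b)" for a b c :: complex
      using norm_triangle_ineq[of "a - c" "c - b"] by simp
    have "cmod (expectation (\<lambda>\<omega>. Q' \<omega> $$ (i, j)) - m) \<le> cmod (expectation (\<lambda>\<omega>. Q' \<omega> $$ (i, j)) - ?u * expectation ?P) + cmod (?u * expectation ?P - m)"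
      by (rule tri)
    also have "\<dots> \<le> resolvent_bound K / (real n)\<^sup>2"
      using R D by (simp add: resolvent_bound_def add_divide_distrib algebra_simps)
    finally show ?thesis unfolding EQ using False by (simp only: m_def if_False)
  qed
qed

section \<open>From the entries of the resolvent to its trace against the covariance\<close>

lemma mtrace_mult_sum:
  assumes "A \<in> carrier_mat m n" "B \<in> carrier_mat n m"
  shows "mtrace (A * B) = (\<Sum>i<m. \<Sum>j<n. A $$ (i, j) * B $$ (j, i))"
  unfolding mtrace_def using assms
  by (intro sum.cong) (auto simp: index_mult_sum[OF assms] simp del: index_mult_mat(1))

lemma mtrace_mult_unitary_conj:
  assumes V: "unitary n V" and R: "R \<in> carrier_mat n n" and X: "X \<in> carrier_mat n n"
  shows "mtrace (R * (V * X * V\<^sup>H)) = mtrace ((V\<^sup>H * R * V) * X)"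
proof -
  note VD = unitaryD[OF V]
  note simps = assoc_mult_mat[of _ n n _ n _ n] mult_carrier_mat[of _ n n _ n]
  have RVX: "R * V * X \<in> carrier_mat n n" using R X VD(1) by (simp add: simps)
  have "mtrace (R * (V * X * V\<^sup>H)) = mtrace ((R * V * X) * V\<^sup>H)"
    using R X VD(1,2) by (simp add: simps)
  also have "\<dots> = mtrace (V\<^sup>H * (R * V * X))" by (rule mtrace_mult_comm[OF RVX VD(2)])
  also have "V\<^sup>H * (R * V * X) = (V\<^sup>H * R * V) * X" using R X VD(1,2) by (simp add: simps)
  finally show ?thesis .
qed

lemma resolvent_unitary_conj:
  assumes V: "unitary n V" and Y: "psd n Y" and \<rho>: "0 \<le> \<rho>"
  shows "minv (1\<^sub>m n + complex_of_real \<rho> \<cdot>\<^sub>m (V * Y * V\<^sup>H)) = V * minv (1\<^sub>m n + complex_of_real \<rho> \<cdot>\<^sub>m Y) * V\<^sup>H"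
proof -
  note VD = unitaryD[OF V]
  have Yc: "Y \<in> carrier_mat n n" using Y by (simp add: psd_def)
  note Q = resolvent_psd[OF Y \<rho>]
  have eq: "1\<^sub>m n + complex_of_real \<rho> \<cdot>\<^sub>m (V * Y * V\<^sup>H) = V * (1\<^sub>m n + complex_of_real \<rho> \<cdot>\<^sub>m Y) * V\<^sup>H"
    using unitary_conj_plus[OF V one_carrier_mat smult_carrier_mat[OF Yc]] unitary_conj_smult[OF V Yc] unitary_conj_one[OF V] by simp
  have c: "V * X * V\<^sup>H \<in> carrier_mat n n" if "X \<in> carrier_mat n n" for X
    using VD(1,2) that by (meson mult_carrier_mat)
  show ?thesis
    unfolding eq
  proof (rule minv_eqI[OF c c])
    show "V * (1\<^sub>m n + complex_of_real \<rho> \<cdot>\<^sub>m Y) * V\<^sup>H * (V * minv (1\<^sub>m n + complex_of_real \<rho> \<cdot>\<^sub>m Y) * V\<^sup>H) = 1\<^sub>m n"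
      using unitary_conj_mult[OF V _ Q(1), of "1\<^sub>m n + complex_of_real \<rho> \<cdot>\<^sub>m Y"] Q(2) Yc unitary_conj_one[OF V] by simp
  qed (use Yc Q(1) in auto)
qed

text \<open>The deterministic factor is moved to the eigenbasis of \<open>T\<close>:
  \<open>A = V\<^sup>H * A0\<close> has orthogonal rows, while \<open>S\<close> itself is not
  rotated. The trace then pairs the entries of \<open>H = V\<^sup>H * R * V\<close>, bounded by the
  trace of \<open>R\<close>, with entries of the resolvent, and at most K^2 of these carry an
  error.\<close>

theorem (in prob_space) expected_resolvent_trace:
  fixes S :: "'a \<Rightarrow> complex mat"
  assumes S: "iid_cgauss_mat M N n (1 / real n) S" and n: "0 < n" "2 * K \<le> n" and \<rho>: "0 < \<rho>"
    and F: "F \<in> carrier_mat N N" and R: "psd N R" and K: "mrank R \<le> K"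
  defines "L \<equiv> psd_sqrt R"
  defines "f \<equiv> (\<lambda>\<omega>. mtrace (R * minv (1\<^sub>m N + complex_of_real \<rho> \<cdot>\<^sub>m (L * F * S \<omega> * (S \<omega>)\<^sup>H * F\<^sup>H * L))))"
  shows "integrable M f"
    and "cmod (expectation f - mtrace (R * M_mat n (T_mat R (F * F\<^sup>H)) \<rho>)) \<le> (real K)\<^sup>2 * cmod (mtrace R) * resolvent_bound K / (real n)\<^sup>2"
proof -
  note simps = assoc_mult_mat[of _ N N _ N _ N] mult_carrier_mat[of _ N N _ N]
  have L: "L \<in> carrier_mat N N" "L\<^sup>H = L" "L * L = R" using psd_sqrt[OF R] by (auto simp: psd_def L_def)
  have Rc: "R \<in> carrier_mat N N" using R by (simp add: psd_def)
  define T where "T = T_mat R (F * F\<^sup>H)"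
  define A0 where "A0 = L * F"
  have A0: "A0 \<in> carrier_mat N N" using L F by (auto simp: A0_def)
  have FH: "F\<^sup>H \<in> carrier_mat N N" using F by simp
  have A0H: "A0\<^sup>H = F\<^sup>H * L" using L F by (simp add: A0_def adjoint_mult[of _ N N _ N])
  have T: "T = A0 * A0\<^sup>H"
    unfolding A0H using L(1) F FH by (simp add: T_def T_mat_def L_def[symmetric] A0_def simps)
  have psdT: "psd N T" using psd_gram[OF adjoint_carrier[OF A0]] by (simp add: T)
  obtain V t where V: "unitary N V" and TV: "T = V * rdiag N t * V\<^sup>H" and t: "\<And>i. i < N \<Longrightarrow> 0 \<le> t i"
    using psd_spectral[OF psdT] by blast
  note VD = unitaryD[OF V]
  define A where "A = V\<^sup>H * A0"
  have A: "A \<in> carrier_mat N N" using VD A0 by (auto simp: A_def)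
  have A0A: "A0 = V * A"
    using assoc_mult_mat[OF VD(1,2) A0] VD(4) A0 by (simp add: A_def)
  have AA: "A * A\<^sup>H = rdiag N t"
  proof -
    have "A * A\<^sup>H = V\<^sup>H * T * V"
      unfolding T A_def using VD(1,2) A0 by (simp add: adjoint_mult[of _ N N _ N] simps)
    also have "\<dots> = (V\<^sup>H * V) * rdiag N t * (V\<^sup>H * V)" unfolding TV using VD(1,2) by (simp add: simps)
    also have "\<dots> = rdiag N t" unfolding VD(3) by simp
    finally show ?thesis .
  qed
  \<comment> \<open>\<open>T\<close> is the square root of \<open>R\<close> times another matrix,
    and this root has the same null directions as \<open>R\<close>; hence \<open>T\<close> has at
    most as many nonzero eigenvalues as the rank of \<open>R\<close>.\<close>
  have card: "card {i. i < N \<and> t i \<noteq> 0} \<le> K"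
  proof -
    obtain U r where U: "unitary N U" and RU: "R = U * rdiag N r * U\<^sup>H" and r: "\<And>i. i < N \<Longrightarrow> 0 \<le> r i"
      using psd_spectral[OF R] by blast
    have LU: "L = U * rdiag N (\<lambda>i. sqrt (r i)) * U\<^sup>H"
      unfolding L_def RU by (rule psd_sqrt_rdiag_conj[OF U]) (use r in auto)
    have eq: "V * rdiag N t * V\<^sup>H = (U * rdiag N (\<lambda>i. sqrt (r i)) * U\<^sup>H) * (F * (F\<^sup>H * L))"
      unfolding TV[symmetric] LU[symmetric] unfolding T unfolding A0H unfolding A0_def using L(1) F FH by (simp add: simps)
    have "card {i. i < N \<and> t i \<noteq> 0} \<le> card {i. i < N \<and> sqrt (r i) \<noteq> 0}"
      by (rule card_nonzero_eigenvalues_mult_le[OF U V _ eq]) (use F FH L(1) in \<open>auto intro!: mult_carrier_mat[of _ N N _ N]\<close>)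
    also have "\<dots> \<le> mrank R" using card_nonzero_eigenvalues_le_rank[OF U RU] by simp
    finally show ?thesis using K by simp
  qed
  \<comment> \<open>In terms of \<open>e\<close> the coefficient of \<open>T\<close> in
    \<open>M_mat\<close> becomes \<rho> / (1 + e), and the diagonal of that matrix in the eigenbasis
    becomes (1 + e) / (1 + e + \<rho> t i).\<close>
  define e where "e = \<rho> * delta n T \<rho>"
  note df = delta_fixed_point[OF V _ TV \<rho> n(1)]
  have d0: "0 \<le> delta n T \<rho>" by (rule df(1)) (use t in auto)
  have d1: "delta n T \<rho> = (\<Sum>i<N. t i / (1 + \<rho> / (1 + \<rho> * delta n T \<rho>) * t i)) / real n" by (rule df(2)) (use t in auto)
  have e0: "0 \<le> e" using d0 \<rho> by (simp add: e_def)
  have inv: "1 / (1 + \<rho> / (1 + e) * t i) = (1 + e) / (1 + e + \<rho> * t i)" if "i < N" for i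
  proof -
    have "(1 + \<rho> / (1 + e) * t i) * (1 + e) = 1 + e + \<rho> * t i" using e0 unfolding distrib_right by simp
    then have "(1 + e) / (1 + e + \<rho> * t i) = (1 * (1 + e)) / ((1 + \<rho> / (1 + e) * t i) * (1 + e))" by simp
    also have "\<dots> = 1 / (1 + \<rho> / (1 + e) * t i)" by (rule mult_divide_mult_cancel_right) (use e0 in simp)
    finally show ?thesis by simp
  qed
  have e1: "e = (\<Sum>i<N. \<rho> * t i * (1 + e) / (1 + e + \<rho> * t i)) / real n"
  proof -
    have "e = \<rho> * ((\<Sum>i<N. t i / (1 + \<rho> / (1 + e) * t i)) / real n)"
      using arg_cong[OF d1, of "\<lambda>x. \<rho> * x"] by (simp only: e_def)
    also have "\<dots> = (\<Sum>i<N. \<rho> * t i * (1 / (1 + \<rho> / (1 + e) * t i))) / real n"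
      by (simp add: sum_distrib_left)
    also have "\<dots> = (\<Sum>i<N. \<rho> * t i * (1 + e) / (1 + e + \<rho> * t i)) / real n"
      by (intro arg_cong[where f="\<lambda>x. x / real n"] sum.cong refl) (simp only: inv lessThan_iff times_divide_eq_right)
    finally show ?thesis .
  qed
  \<comment> \<open>Gram factor of the conjugated covariance \<open>H\<close>, needed for the entry
    bound.\<close>
  define B where "B = L * V"
  have B: "B \<in> carrier_mat N N" using L VD by (auto simp: B_def)
  define H where "H = V\<^sup>H * R * V"
  have Hc: "H \<in> carrier_mat N N" using VD Rc by (simp add: H_def simps)
  have HB: "H = B\<^sup>H * B"
    unfolding H_def B_def L(3)[symmetric] using VD(1,2) L(1,2) by (simp add: adjoint_mult[of _ N N _ N] simps)
  have trH: "mtrace H = mtrace R"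
  proof -
    have "mtrace H = mtrace (V * (V\<^sup>H * R))" unfolding H_def using VD(1,2) Rc by (intro mtrace_mult_comm[of _ N N]) auto
    also have "V * (V\<^sup>H * R) = R" using assoc_mult_mat[OF VD(1,2) Rc] VD(4) Rc by simp
    finally show ?thesis .
  qed
  have Hb: "cmod (H $$ (i, j)) \<le> cmod (mtrace R)" if "i < N" "j < N" for i j
    using psd_entry_le_trace[OF B that] complex_Re_le_cmod[of "mtrace R"] unfolding HB[symmetric] trH by linarith
  define Q where "Q = (\<lambda>\<omega>. minv (1\<^sub>m N + complex_of_real \<rho> \<cdot>\<^sub>m (A * S \<omega> * (A * S \<omega>)\<^sup>H)))"
  have Qint: "integrable M (\<lambda>\<omega>. Q \<omega> $$ (i, j))" if "i < N" "j < N" for i j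
    unfolding Q_def by (rule expected_resolvent_entry(1)[OF S n \<rho> A AA _ card e0 e1 that]) (use t in auto)
  have QE: "cmod (expectation (\<lambda>\<omega>. Q \<omega> $$ (i, j)) - (if i = j then complex_of_real ((1 + e) / (1 + e + \<rho> * t i)) else 0)) \<le>
        (if t i = 0 \<or> t j = 0 then 0 else resolvent_bound K / (real n)\<^sup>2)" if "i < N" "j < N" for i j
    unfolding Q_def by (rule expected_resolvent_entry(2)[OF S n \<rho> A AA _ card e0 e1 that]) (use t in auto)
  have Sm: "S \<in> measurable M (mat_space N n)" using S by (simp add: iid_cgauss_mat_def)
  have f_eq: "f \<omega> = (\<Sum>i<N. \<Sum>j<N. H $$ (i, j) * Q \<omega> $$ (j, i))" if om: "\<omega> \<in> space M" for \<omega>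
  proof -
    have s: "S \<omega> \<in> carrier_mat N n" using measurable_space[OF Sm om] by simp
    have sH: "(S \<omega>)\<^sup>H \<in> carrier_mat n N" using s by simp
    have AS: "A * S \<omega> \<in> carrier_mat N n" using A s by auto
    define Y where "Y = A * S \<omega> * (A * S \<omega>)\<^sup>H"
    have Y: "psd N Y" unfolding Y_def using psd_gram[OF adjoint_carrier[OF AS]] by simp
    have AH: "A\<^sup>H \<in> carrier_mat N N" using A by simp
    have SS: "S \<omega> * (S \<omega>)\<^sup>H \<in> carrier_mat N N" using s by auto
    have Y2: "Y = A * (S \<omega> * (S \<omega>)\<^sup>H) * A\<^sup>H"
      unfolding Y_def adjoint_mult[OF A s] using A s sH AH
      by (simp add: assoc_mult_mat[of _ N N _ n _ N] assoc_mult_mat[of _ N n _ N _ N] assoc_mult_mat[of _ N N _ N _ N] mult_carrier_mat[of _ n N _ N] mult_carrier_mat[of _ N n _ N])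
    have "L * F * S \<omega> * (S \<omega>)\<^sup>H * F\<^sup>H * L = A0 * (S \<omega> * (S \<omega>)\<^sup>H) * A0\<^sup>H"
    proof -
      have "L * F * S \<omega> * (S \<omega>)\<^sup>H = A0 * (S \<omega> * (S \<omega>)\<^sup>H)" unfolding A0_def[symmetric] by (rule assoc_mult_mat[OF A0 s sH])
      then show ?thesis unfolding A0H using assoc_mult_mat[OF mult_carrier_mat[OF A0 SS] FH L(1)] by simp
    qed
    also have "\<dots> = V * Y * V\<^sup>H"
      unfolding Y2 A0A using VD(1,2) A AH SS by (simp add: adjoint_mult[of _ N N _ N] simps)
    finally have arg: "L * F * S \<omega> * (S \<omega>)\<^sup>H * F\<^sup>H * L = V * Y * V\<^sup>H" .
    have Qc: "Q \<omega> \<in> carrier_mat N N" using resolvent_psd(1)[OF Y, of \<rho>] \<rho> by (simp add: Q_def Y_def)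
    have "minv (1\<^sub>m N + complex_of_real \<rho> \<cdot>\<^sub>m (V * Y * V\<^sup>H)) = V * Q \<omega> * V\<^sup>H"
      using resolvent_unitary_conj[OF V Y] \<rho> by (simp add: Q_def Y_def)
    then have "f \<omega> = mtrace (R * (V * Q \<omega> * V\<^sup>H))" unfolding f_def arg by simp
    also have "\<dots> = mtrace (H * Q \<omega>)" unfolding H_def by (rule mtrace_mult_unitary_conj[OF V Rc Qc])
    also have "\<dots> = (\<Sum>i<N. \<Sum>j<N. H $$ (i, j) * Q \<omega> $$ (j, i))" by (rule mtrace_mult_sum[OF Hc Qc])
    finally show ?thesis .
  qed
  have int: "integrable M (\<lambda>\<omega>. \<Sum>i<N. \<Sum>j<N. H $$ (i, j) * Q \<omega> $$ (j, i))"
    by (intro Bochner_Integration.integrable_sum integrable_mult_right Qint) auto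
  show "integrable M f"
    using int by (rule Bochner_Integration.integrable_cong[THEN iffD1, rotated -1]) (simp_all add: f_eq)
  have Ef: "expectation f = (\<Sum>i<N. \<Sum>j<N. H $$ (i, j) * expectation (\<lambda>\<omega>. Q \<omega> $$ (j, i)))"
  proof -
    have "expectation f = expectation (\<lambda>\<omega>. \<Sum>i<N. \<Sum>j<N. H $$ (i, j) * Q \<omega> $$ (j, i))"
      by (rule Bochner_Integration.integral_cong) (simp_all add: f_eq)
    also have "\<dots> = (\<Sum>i<N. expectation (\<lambda>\<omega>. \<Sum>j<N. H $$ (i, j) * Q \<omega> $$ (j, i)))"
      by (intro Bochner_Integration.integral_sum Bochner_Integration.integrable_sum integrable_mult_right Qint) auto
    also have "\<dots> = (\<Sum>i<N. \<Sum>j<N. expectation (\<lambda>\<omega>. H $$ (i, j) * Q \<omega> $$ (j, i)))"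
      by (intro sum.cong refl Bochner_Integration.integral_sum integrable_mult_right Qint) auto
    also have "\<dots> = (\<Sum>i<N. \<Sum>j<N. H $$ (i, j) * expectation (\<lambda>\<omega>. Q \<omega> $$ (j, i)))"
      by (simp only: integral_mult_right_zero)
    finally show ?thesis .
  qed
  define D where "D = rdiag N (\<lambda>i. (1 + e) / (1 + e + \<rho> * t i))"
  have ED: "mtrace (R * M_mat n T \<rho>) = (\<Sum>i<N. \<Sum>j<N. H $$ (i, j) * D $$ (j, i))"
  proof -
    have dimT: "dim_row T = N" using psdT by (auto simp: psd_def)
    have "M_mat n T \<rho> = minv (1\<^sub>m N + complex_of_real (\<rho> / (1 + e)) \<cdot>\<^sub>m (V * rdiag N t * V\<^sup>H))"
      unfolding M_mat_def dimT e_def[symmetric] TV[symmetric] ..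
    also have "\<dots> = V * rdiag N (\<lambda>i. 1 / (1 + \<rho> / (1 + e) * t i)) * V\<^sup>H"
      by (rule resolvent_rdiag_conj(1)[OF V]) (use t \<rho> e0 in auto)
    also have "rdiag N (\<lambda>i. 1 / (1 + \<rho> / (1 + e) * t i)) = D" unfolding D_def by (rule rdiag_cong) (rule inv)
    finally have "mtrace (R * M_mat n T \<rho>) = mtrace (R * (V * D * V\<^sup>H))" by simp
    also have "\<dots> = mtrace (H * D)" unfolding H_def D_def by (rule mtrace_mult_unitary_conj[OF V Rc rdiag_carrier])
    also have "\<dots> = (\<Sum>i<N. \<Sum>j<N. H $$ (i, j) * D $$ (j, i))" unfolding D_def by (rule mtrace_mult_sum[OF Hc rdiag_carrier])
    finally show ?thesis .
  qed
  let ?b = "resolvent_bound K / (real n)\<^sup>2"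
  let ?J = "{i. i < N \<and> t i \<noteq> 0}"
  have "expectation f - mtrace (R * M_mat n T \<rho>) = (\<Sum>i<N. \<Sum>j<N. H $$ (i, j) * (expectation (\<lambda>\<omega>. Q \<omega> $$ (j, i)) - D $$ (j, i)))"
    unfolding Ef ED by (simp only: sum_subtractf right_diff_distrib)
  then have "cmod (expectation f - mtrace (R * M_mat n T \<rho>)) \<le> (\<Sum>i<N. \<Sum>j<N. cmod (H $$ (i, j)) * cmod (expectation (\<lambda>\<omega>. Q \<omega> $$ (j, i)) - D $$ (j, i)))"
    by (simp only:) (intro order_trans[OF norm_sum] sum_mono; simp only: norm_mult order_refl)
  also have "\<dots> \<le> (\<Sum>i<N. \<Sum>j<N. if t i = 0 \<or> t j = 0 then 0 else cmod (mtrace R) * ?b)"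
  proof (intro sum_mono)
    fix i j assume "i \<in> {..<N}" "j \<in> {..<N}"
    then have ij: "i < N" "j < N" by auto
    have "cmod (expectation (\<lambda>\<omega>. Q \<omega> $$ (j, i)) - D $$ (j, i)) \<le> (if t j = 0 \<or> t i = 0 then 0 else ?b)"
      using QE[OF ij(2,1)] ij by (simp add: D_def)
    then have "cmod (H $$ (i, j)) * cmod (expectation (\<lambda>\<omega>. Q \<omega> $$ (j, i)) - D $$ (j, i)) \<le> cmod (mtrace R) * (if t j = 0 \<or> t i = 0 then 0 else ?b)"
      using Hb[OF ij] by (intro mult_mono) auto
    then show "cmod (H $$ (i, j)) * cmod (expectation (\<lambda>\<omega>. Q \<omega> $$ (j, i)) - D $$ (j, i)) \<le> (if t i = 0 \<or> t j = 0 then 0 else cmod (mtrace R) * ?b)"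
      by (auto split: if_splits)
  qed
  \<comment> \<open>The sums collapse from N^2 to at most K^2 terms; a factor N^2 would destroy the
    estimate.\<close>
  also have "\<dots> = (\<Sum>i\<in>?J. \<Sum>j<N. if t i = 0 \<or> t j = 0 then 0 else cmod (mtrace R) * ?b)"
    by (intro sum.mono_neutral_right) auto
  also have "\<dots> = (\<Sum>i\<in>?J. \<Sum>j\<in>?J. if t i = 0 \<or> t j = 0 then 0 else cmod (mtrace R) * ?b)"
    by (intro sum.cong refl sum.mono_neutral_right) auto
  also have "\<dots> = (\<Sum>i\<in>?J. \<Sum>j\<in>?J. cmod (mtrace R) * ?b)"
    by (intro sum.cong refl) auto
  also have "\<dots> = (real (card ?J))\<^sup>2 * (cmod (mtrace R) * ?b)" by (simp add: power2_eq_square)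
  also have "\<dots> \<le> (real K)\<^sup>2 * (cmod (mtrace R) * ?b)"
    using card resolvent_bound_nonneg by (intro mult_right_mono power_mono) auto
  finally show "cmod (expectation f - mtrace (R * M_mat n (T_mat R (F * F\<^sup>H)) \<rho>)) \<le> (real K)\<^sup>2 * cmod (mtrace R) * resolvent_bound K / (real n)\<^sup>2"
    by (simp add: T_def)
qed

text \<open>The identity with the trace formula is exact for each n. The asymptotic part compares,
  for each eigenvalue of \<open>R\<^sub>R\<close> separately, the mean of one resolvent trace with
  its deterministic counterpart; \<open>N\<^sub>R\<close>, \<open>R\<^sub>R\<close> and \<sigma> are
  fixed, so the finite weighted sum of errors keeps the order.\<close>

theorem proposition3:
  fixes M :: "nat \<Rightarrow> 'a measure"
    and N\<^sub>S N\<^sub>T :: "nat \<Rightarrow> nat" and N\<^sub>R K :: nat and c \<sigma> :: real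
    and F R\<^sub>T :: "nat \<Rightarrow> complex mat" and R\<^sub>R :: "complex mat"
    and S H N :: "nat \<Rightarrow> 'a \<Rightarrow> complex mat"
  defines "R \<equiv> (\<lambda>n. R\<^sub>R \<otimes>\<^sub>K R\<^sub>T n)"
    and "\<Phi> \<equiv> (\<lambda>n. F n * mat_adjoint (F n))"
    and "J \<equiv> (\<lambda>n. J_ELMMSE (M n) N\<^sub>R (N\<^sub>T n) (N\<^sub>S n) (F n) (S n) (H n) (N n))"
  assumes c: "0 < c" and \<sigma>: "0 < \<sigma>"
    and N\<^sub>S_lim: "filterlim N\<^sub>S at_top sequentially"
    and N\<^sub>T_lim: "filterlim N\<^sub>T at_top sequentially"
    and ratio: "\<And>n. real (N\<^sub>S n) / real (N\<^sub>T n) = c"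
    and N\<^sub>S_ge: "\<And>n. N\<^sub>T n \<le> N\<^sub>S n"
    and F: "\<And>n. F n \<in> carrier_mat (N\<^sub>T n) (N\<^sub>T n)"
    and R\<^sub>R: "psd N\<^sub>R R\<^sub>R" "mrank R\<^sub>R \<le> K"
    and R\<^sub>T: "\<And>n. psd (N\<^sub>T n) (R\<^sub>T n)" "\<And>n. mrank (R\<^sub>T n) \<le> K"
    and R\<^sub>T_growth: "(\<lambda>n. mtrace (R\<^sub>T n)) \<in> O(\<lambda>n. of_nat (N\<^sub>T n))"
    and prob: "\<And>n. prob_space (M n)"
    and S: "\<And>n. iid_cgauss_mat (M n) (N\<^sub>T n) (N\<^sub>S n) (1 / real (N\<^sub>S n)) (S n)"
    and N: "\<And>n. iid_cgauss_mat (M n) N\<^sub>R (N\<^sub>S n) (\<sigma>\<^sup>2) (N n)"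
    and H: "\<And>n. cgauss_vec (M n) (N\<^sub>R * N\<^sub>T n) (R n) (\<lambda>\<omega>. vectorize (mat_adjoint (H n \<omega>)))"
    and indep: "\<And>n. indep_mats3 (M n) (N\<^sub>T n, N\<^sub>S n) (S n) (N\<^sub>R, N\<^sub>T n) (H n) (N\<^sub>R, N\<^sub>S n) (N n)"
  shows "(\<forall>n. complex_of_real (J n) =
            (LINT \<omega>|M n. mtrace (R n * minv (1\<^sub>m (N\<^sub>R * N\<^sub>T n) +
               complex_of_real (1 / \<sigma>\<^sup>2) \<cdot>\<^sub>m
                 (R\<^sub>R \<otimes>\<^sub>K (psd_sqrt (R\<^sub>T n) * F n * S n \<omega> * mat_adjoint (S n \<omega>) *
                         mat_adjoint (F n) * psd_sqrt (R\<^sub>T n)))))))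
       \<and> (\<lambda>n. complex_of_real (J n) - (\<Sum>j<K. kappa_bar K (N\<^sub>S n) \<sigma> R\<^sub>R (R\<^sub>T n) (\<Phi> n) j))
           \<in> O(\<lambda>n. 1 / of_nat (N\<^sub>S n))"
proof -
  have s2: "0 < \<sigma>\<^sup>2" using \<sigma> by simp
  have Sc: "S n \<omega> \<in> carrier_mat (N\<^sub>T n) (N\<^sub>S n)" if "\<omega> \<in> space (M n)" for n \<omega>
  proof -
    have "S n \<in> measurable (M n) (mat_space (N\<^sub>T n) (N\<^sub>S n))" using S[of n] by (simp add: iid_cgauss_mat_def)
    from measurable_space[OF this that] show ?thesis by simp
  qed
  define W where "W = (\<lambda>n \<omega>. psd_sqrt (R\<^sub>T n) * F n * S n \<omega> * (S n \<omega>)\<^sup>H * (F n)\<^sup>H * psd_sqrt (R\<^sub>T n))"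
  have J_eq: "complex_of_real (J n) = (LINT \<omega>|M n. mtrace (R n * minv (1\<^sub>m (N\<^sub>R * N\<^sub>T n) +
      complex_of_real (1 / \<sigma>\<^sup>2) \<cdot>\<^sub>m (R\<^sub>R \<otimes>\<^sub>K W n \<omega>))))" for n
    unfolding J_def J_ELMMSE_def Let_def integral_complex_of_real[symmetric] R_def W_def
    using H[of n] unfolding R_def
    by (intro Bochner_Integration.integral_cong refl lmmse_kronecker_channel[OF prob \<sigma> F R\<^sub>R(1) R\<^sub>T(1) N _ indep Sc])
  obtain U r where U: "unitary N\<^sub>R U" and RU: "R\<^sub>R = U * rdiag N\<^sub>R r * U\<^sup>H" and r: "\<And>i. i < N\<^sub>R \<Longrightarrow> 0 \<le> r i"
    using psd_spectral[OF R\<^sub>R(1)] by blast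
  \<comment> \<open>Eigenvalues of R_R / \<sigma>^2, indexed by the eigenbasis of
    \<open>R\<^sub>R\<close> and not by size.\<close>
  define l where "l = (\<lambda>j. 1 / \<sigma>\<^sup>2 * r j)"
  have l: "0 \<le> l j" if "j < N\<^sub>R" for j using r[OF that] s2 by (simp add: l_def)
  have r_l: "r j = \<sigma>\<^sup>2 * l j" for j using \<sigma> by (simp add: l_def)
  define g where "g = (\<lambda>n j \<omega>. mtrace (R\<^sub>T n * minv (1\<^sub>m (N\<^sub>T n) + complex_of_real (l j) \<cdot>\<^sub>m W n \<omega>)))"
  \<comment> \<open>The summand as a function of the eigenvalue; it vanishes at 0, as the passage
    from the \<open>K\<close> largest eigenvalues to all eigenvalues requires.\<close>
  define h where "h = (\<lambda>n x. complex_of_real (\<sigma>\<^sup>2 * x) * mtrace (R\<^sub>T n * M_mat (N\<^sub>S n) (T_mat (R\<^sub>T n) (\<Phi> n)) x))"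
  have J_sum: "complex_of_real (J n) = (LINT \<omega>|M n. (\<Sum>j<N\<^sub>R. complex_of_real (r j) * g n j \<omega>))" for n
    unfolding J_eq
  proof (rule Bochner_Integration.integral_cong[OF refl])
    fix \<omega> assume om: "\<omega> \<in> space (M n)"
    let ?L = "psd_sqrt (R\<^sub>T n)"
    have L: "?L \<in> carrier_mat (N\<^sub>T n) (N\<^sub>T n)" "?L\<^sup>H = ?L" using psd_sqrt[OF R\<^sub>T(1)[of n]] by (auto simp: psd_def)
    have LFS: "?L * F n * S n \<omega> \<in> carrier_mat (N\<^sub>T n) (N\<^sub>S n)" using L(1) F Sc[OF om] by (meson mult_carrier_mat)
    have "(?L * F n * S n \<omega>)\<^sup>H = (S n \<omega>)\<^sup>H * ((F n)\<^sup>H * ?L)"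
      using adjoint_mult[OF mult_carrier_mat[OF L(1) F] Sc[OF om]] adjoint_mult[OF L(1) F] L(2) by simp
    then have "W n \<omega> = (?L * F n * S n \<omega>) * (?L * F n * S n \<omega>)\<^sup>H"
      using assoc_mult_mat[OF mult_carrier_mat[OF LFS adjoint_carrier[OF Sc[OF om]]] adjoint_carrier[OF F] L(1)]
        assoc_mult_mat[OF LFS adjoint_carrier[OF Sc[OF om]] mult_carrier_mat[OF adjoint_carrier[OF F] L(1)]]
      by (simp add: W_def)
    then have psdW: "psd (N\<^sub>T n) (W n \<omega>)" using psd_gram[OF adjoint_carrier[OF LFS]] by simp
    have "mtrace (R n * minv (1\<^sub>m (N\<^sub>R * N\<^sub>T n) + complex_of_real (1 / \<sigma>\<^sup>2) \<cdot>\<^sub>m (R\<^sub>R \<otimes>\<^sub>K W n \<omega>))) =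
      (\<Sum>j<N\<^sub>R. complex_of_real (r j) * mtrace (R\<^sub>T n * minv (1\<^sub>m (N\<^sub>T n) + complex_of_real (1 / \<sigma>\<^sup>2 * r j) \<cdot>\<^sub>m W n \<omega>)))"
      unfolding R_def by (rule mtrace_kronecker_resolvent[OF U RU _ _ psdW]) (use r R\<^sub>T(1)[of n] s2 in \<open>auto simp: psd_def\<close>)
    then show "mtrace (R n * minv (1\<^sub>m (N\<^sub>R * N\<^sub>T n) + complex_of_real (1 / \<sigma>\<^sup>2) \<cdot>\<^sub>m (R\<^sub>R \<otimes>\<^sub>K W n \<omega>))) = (\<Sum>j<N\<^sub>R. complex_of_real (r j) * g n j \<omega>)"
      by (simp only: g_def l_def)
  qed
  have kappa_sum: "(\<Sum>j<K. kappa_bar K (N\<^sub>S n) \<sigma> R\<^sub>R (R\<^sub>T n) (\<Phi> n) j) = (\<Sum>j<N\<^sub>R. h n (l j))" for n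
  proof -
    have A: "complex_of_real (1 / \<sigma>\<^sup>2) \<cdot>\<^sub>m R\<^sub>R = U * rdiag N\<^sub>R l * U\<^sup>H"
    proof -
      have "complex_of_real (1 / \<sigma>\<^sup>2) \<cdot>\<^sub>m rdiag N\<^sub>R r = rdiag N\<^sub>R l" by (rule eq_matI) (auto simp: l_def)
      then show ?thesis unfolding RU using unitary_conj_smult[OF U rdiag_carrier, of "complex_of_real (1 / \<sigma>\<^sup>2)" r] by simp
    qed
    have "card {i. i < N\<^sub>R \<and> l i \<noteq> 0} \<le> K"
      using card_nonzero_eigenvalues_le_rank[OF U RU] R\<^sub>R(2) \<sigma> by (simp add: l_def)
    then have "(\<Sum>j<K. h n (largest_eigenvalues K (complex_of_real (1 / \<sigma>\<^sup>2) \<cdot>\<^sub>m R\<^sub>R) ! j)) = (\<Sum>j<N\<^sub>R. h n (l j))"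
      by (intro sum_largest_eigenvalues[OF U A]) (use l in \<open>auto simp: h_def\<close>)
    then show ?thesis by (simp only: kappa_bar_def Let_def h_def)
  qed
  \<comment> \<open>Independent of n, because \<open>R\<^sub>R\<close> and hence its eigenvalues
    \<open>r\<close> are fixed.\<close>
  define C where "C = (\<Sum>j<N\<^sub>R. r j) * ((real K)\<^sup>2 * resolvent_bound K)"
  have C0: "0 \<le> C" unfolding C_def using r resolvent_bound_nonneg by (intro mult_nonneg_nonneg sum_nonneg) auto
  have bound: "cmod (complex_of_real (J n) - (\<Sum>j<K. kappa_bar K (N\<^sub>S n) \<sigma> R\<^sub>R (R\<^sub>T n) (\<Phi> n) j)) \<le> C * cmod (mtrace (R\<^sub>T n)) / (real (N\<^sub>S n))\<^sup>2"
    if n: "0 < N\<^sub>S n" "2 * K \<le> N\<^sub>S n" for n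
  proof -
    interpret P: prob_space "M n" by (rule prob)
    \<comment> \<open>Only nonzero eigenvalues are treated, since the resolvent estimate asks for
      \<rho> > 0; the others enter with weight \<open>r j = 0\<close>.\<close>
    have gi: "integrable (M n) (g n j)"
      and gb: "cmod (P.expectation (g n j) - mtrace (R\<^sub>T n * M_mat (N\<^sub>S n) (T_mat (R\<^sub>T n) (\<Phi> n)) (l j))) \<le> (real K)\<^sup>2 * cmod (mtrace (R\<^sub>T n)) * resolvent_bound K / (real (N\<^sub>S n))\<^sup>2"
      if "j < N\<^sub>R" "r j \<noteq> 0" for j
    proof -
      have lj: "0 < l j" using r[OF that(1)] that(2) s2 by (simp add: l_def)
      note E = P.expected_resolvent_trace[OF S n lj F R\<^sub>T(1) R\<^sub>T(2)]
      show "integrable (M n) (g n j)" unfolding g_def W_def by (rule E(1))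
      show "cmod (P.expectation (g n j) - mtrace (R\<^sub>T n * M_mat (N\<^sub>S n) (T_mat (R\<^sub>T n) (\<Phi> n)) (l j))) \<le> (real K)\<^sup>2 * cmod (mtrace (R\<^sub>T n)) * resolvent_bound K / (real (N\<^sub>S n))\<^sup>2"
        unfolding g_def W_def \<Phi>_def by (rule E(2))
    qed
    have rgi: "integrable (M n) (\<lambda>\<omega>. complex_of_real (r j) * g n j \<omega>)" if "j < N\<^sub>R" for j
      by (rule integrable_mult_right) (use gi[OF that] in simp)
    have "complex_of_real (J n) = (\<Sum>j<N\<^sub>R. P.expectation (\<lambda>\<omega>. complex_of_real (r j) * g n j \<omega>))"
      unfolding J_sum by (intro Bochner_Integration.integral_sum rgi) simp
    also have "\<dots> = (\<Sum>j<N\<^sub>R. complex_of_real (r j) * P.expectation (g n j))" by (simp only: integral_mult_right_zero)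
    finally have "complex_of_real (J n) - (\<Sum>j<K. kappa_bar K (N\<^sub>S n) \<sigma> R\<^sub>R (R\<^sub>T n) (\<Phi> n) j) =
        (\<Sum>j<N\<^sub>R. complex_of_real (r j) * (P.expectation (g n j) - mtrace (R\<^sub>T n * M_mat (N\<^sub>S n) (T_mat (R\<^sub>T n) (\<Phi> n)) (l j))))"
      unfolding kappa_sum h_def r_l[symmetric] by (simp only: sum_subtractf right_diff_distrib)
    then have "cmod (complex_of_real (J n) - (\<Sum>j<K. kappa_bar K (N\<^sub>S n) \<sigma> R\<^sub>R (R\<^sub>T n) (\<Phi> n) j)) \<le>
        (\<Sum>j<N\<^sub>R. r j * ((real K)\<^sup>2 * cmod (mtrace (R\<^sub>T n)) * resolvent_bound K / (real (N\<^sub>S n))\<^sup>2))"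
    proof (simp only:, intro order_trans[OF norm_sum] sum_mono)
      fix j assume "j \<in> {..<N\<^sub>R}"
      then have j: "j < N\<^sub>R" by simp
      show "cmod (complex_of_real (r j) * (P.expectation (g n j) - mtrace (R\<^sub>T n * M_mat (N\<^sub>S n) (T_mat (R\<^sub>T n) (\<Phi> n)) (l j))))
        \<le> r j * ((real K)\<^sup>2 * cmod (mtrace (R\<^sub>T n)) * resolvent_bound K / (real (N\<^sub>S n))\<^sup>2)"
      proof (cases "r j = 0")
        case False
        show ?thesis unfolding norm_mult norm_of_real abs_of_nonneg[OF r[OF j]]
          by (rule mult_left_mono[OF gb[OF j False] r[OF j]])
      qed simp
    qed
    also have "\<dots> = C * cmod (mtrace (R\<^sub>T n)) / (real (N\<^sub>S n))\<^sup>2"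
      unfolding sum_distrib_right[symmetric] by (simp add: C_def mult_ac)
    finally show ?thesis .
  qed
  obtain b where b: "0 < b" "eventually (\<lambda>n. cmod (mtrace (R\<^sub>T n)) \<le> b * cmod (of_nat (N\<^sub>T n))) sequentially"
    using R\<^sub>T_growth by (rule landau_o.bigE)
  \<comment> \<open>2 K + 1 yields both conditions of \<open>bound\<close>, N_S positive and at
    least 2 K, also for K = 0.\<close>
  have ev: "eventually (\<lambda>n. 2 * K + 1 \<le> N\<^sub>S n) sequentially"
    using N\<^sub>S_lim by (simp add: filterlim_at_top)
  have "(\<lambda>n. complex_of_real (J n) - (\<Sum>j<K. kappa_bar K (N\<^sub>S n) \<sigma> R\<^sub>R (R\<^sub>T n) (\<Phi> n) j)) \<in> O(\<lambda>n. 1 / of_nat (N\<^sub>S n))"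
  proof (rule landau_o.bigI[of "C * b + 1"])
    \<comment> \<open>\<open>C\<close> may be zero, whereas a Landau constant has to be
      positive.\<close>
    show "0 < C * b + 1" using C0 b by (simp add: add_nonneg_pos)
    show "eventually (\<lambda>n. cmod (complex_of_real (J n) - (\<Sum>j<K. kappa_bar K (N\<^sub>S n) \<sigma> R\<^sub>R (R\<^sub>T n) (\<Phi> n) j)) \<le> (C * b + 1) * cmod (1 / of_nat (N\<^sub>S n))) sequentially"
      using b(2) ev
    proof eventually_elim
      case (elim n)
      then have n: "0 < N\<^sub>S n" "2 * K \<le> N\<^sub>S n" by auto
      \<comment> \<open>The trace grows at most like N_T <= N_S, which uses up one of the two powers
        of 1 / N_S.\<close>
      have "cmod (mtrace (R\<^sub>T n)) \<le> b * real (N\<^sub>S n)"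
      proof -
        have "b * real (N\<^sub>T n) \<le> b * real (N\<^sub>S n)" using b(1) N\<^sub>S_ge[of n] by simp
        then show ?thesis using elim(1) by simp
      qed
      then have "C * cmod (mtrace (R\<^sub>T n)) / (real (N\<^sub>S n))\<^sup>2 \<le> C * (b * real (N\<^sub>S n)) / (real (N\<^sub>S n))\<^sup>2"
        using C0 by (intro divide_right_mono mult_left_mono) auto
      also have "\<dots> = C * b * (1 / real (N\<^sub>S n))" using n by (simp add: power2_eq_square)
      also have "\<dots> \<le> (C * b + 1) * (1 / real (N\<^sub>S n))" by (intro mult_right_mono) auto
      finally show ?case using bound[OF n] by (simp add: norm_divide)
    qed
  qed
  then show ?thesis using J_eq unfolding W_def by blast
qed

end
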